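(* Fix an integer $p\geq 2$ and let $G_p=BS(1,p)=\langle a,t \mid tat^{-1}=a^p\rangle$. There is a deterministic algorithm, on a random access machine, which takes as input an arbitrary word $w$ of length $n$ in the letters $a^{\pm1},t^{\pm1}$ and outputs a geodesic word $v$ with $v=_{G}w$, and which runs in time $O(n)$ and space $O(n\log n)$. Consequently, the geodesic problem, the geodesic length problem and the bounded geodesic length problem for $G_p$ with generating set $\{a^{\pm1},t^{\pm1}\}$ are solvable in linear time.
   Context: Words are finite strings over the alphabet $\{a,a^{-1},t,t^{-1}\}$. $\ell(w)$ is the number of letters of the string $w$, and $u=_G w$ means that $u$ and $w$ represent the same element of $G_p$. A word $v$ is geodesic if $\ell(v)\le \ell(w)$ for every word $w$ with $w=_G v$. The geodesic length of a word $w$ is the length of a geodesic word representing the same group element. Problems for $G_p$ with generating set $\{a^{\pm1},t^{\pm1}\}$: the geodesic problem is, given a word, to output a geodesic word representing the same element; the geodesic length problem is, given a word, to compute its geodesic length; the bounded geodesic length problem is, given a word and an integer $k$, to decide whether the geodesic length of the word is less than $k$. Computational model: a random access machine, in which any specified location in an array can be accessed (read, written, deleted) in constant time; array entries are symbols from a fixed finite alphabet or integers of absolute value $O(n)$ (handled in constant time per elementary operation), and space is counted in bits, with integers written in binary. The integer $p$ is fixed, so implied constants may depend on $p$. *)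

theory Defs
  imports Complex_Main "HOL-Library.Landau_Symbols" "HOL-Library.Log_Nat"
begin

section \<open>Words and the group BS(1,p)\<close>

datatype letter = A_pos | A_neg | T_pos | T_neg

type_synonym word = "letter list"

fun inv_letter :: "letter \<Rightarrow> letter" where
  "inv_letter A_pos = A_neg"
| "inv_letter A_neg = A_pos"
| "inv_letter T_pos = T_neg"
| "inv_letter T_neg = T_pos"

text \<open>
  Equality of words in the group presented by generators a, t and the single relation
  t a t^(-1) = a^p: the congruence on words generated by free cancellation and that relation.
\<close>

inductive eq_BS :: "nat \<Rightarrow> word \<Rightarrow> word \<Rightarrow> bool" for p :: nat where
  refl: "eq_BS p u u"
| sym: "eq_BS p u v \<Longrightarrow> eq_BS p v u"
| trans: "eq_BS p u v \<Longrightarrow> eq_BS p v w \<Longrightarrow> eq_BS p u w"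
| cancel: "eq_BS p (u @ [x, inv_letter x] @ v) (u @ v)"
| relator: "eq_BS p (u @ [T_pos, A_pos, T_neg] @ v) (u @ replicate p A_pos @ v)"

definition geodesic :: "nat \<Rightarrow> word \<Rightarrow> bool" where
  "geodesic p v \<longleftrightarrow> (\<forall>w. eq_BS p w v \<longrightarrow> length v \<le> length w)"

definition geodesic_length :: "nat \<Rightarrow> word \<Rightarrow> nat" where
  "geodesic_length p w = (THE m. \<exists>v. eq_BS p v w \<and> geodesic p v \<and> length v = m)"


section \<open>Random access machines\<close>

text \<open>
  A program is a finite list of instructions over integer registers and arrays of cells
  indexed by integers. The value \<open>None\<close> marks an empty (never written, or deleted) cell.
  Symbols of a finite alphabet are represented by fixed integers.
\<close>

datatype instr =
    Const nat int            \<comment> \<open>\<open>Const r z\<close>: r := z\<close>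
  | Add nat nat nat          \<comment> \<open>\<open>Add r x y\<close>: r := x + y\<close>
  | Sub nat nat nat          \<comment> \<open>\<open>Sub r x y\<close>: r := x - y\<close>
  | Load nat nat nat         \<comment> \<open>\<open>Load r b i\<close>: r := b[i], an empty cell being read as 0\<close>
  | Store nat nat nat        \<comment> \<open>\<open>Store b i r\<close>: b[i] := r\<close>
  | Delete nat nat           \<comment> \<open>\<open>Delete b i\<close>: empty the cell b[i]\<close>
  | Jump_if_pos nat nat      \<comment> \<open>\<open>Jump_if_pos r l\<close>: go to l if r > 0\<close>
  | Jump_if_empty nat nat nat \<comment> \<open>\<open>Jump_if_empty b i l\<close>: go to l if b[i] is empty\<close>

record config =
  pc :: nat
  reg :: "nat \<Rightarrow> int"
  arr :: "nat \<Rightarrow> int \<Rightarrow> int option"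

fun exec :: "instr \<Rightarrow> config \<Rightarrow> config" where
  "exec (Const r z) c = c\<lparr>pc := pc c + 1, reg := (reg c)(r := z)\<rparr>"
| "exec (Add r x y) c = c\<lparr>pc := pc c + 1, reg := (reg c)(r := reg c x + reg c y)\<rparr>"
| "exec (Sub r x y) c = c\<lparr>pc := pc c + 1, reg := (reg c)(r := reg c x - reg c y)\<rparr>"
| "exec (Load r b i) c =
     c\<lparr>pc := pc c + 1,
       reg := (reg c)(r := (case arr c b (reg c i) of None \<Rightarrow> 0 | Some z \<Rightarrow> z))\<rparr>"
| "exec (Store b i r) c =
     c\<lparr>pc := pc c + 1, arr := (arr c)(b := (arr c b)(reg c i := Some (reg c r)))\<rparr>"
| "exec (Delete b i) c =
     c\<lparr>pc := pc c + 1, arr := (arr c)(b := (arr c b)(reg c i := None))\<rparr>"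
| "exec (Jump_if_pos r l) c =
     c\<lparr>pc := (if reg c r > 0 then l else pc c + 1)\<rparr>"
| "exec (Jump_if_empty b i l) c =
     c\<lparr>pc := (if arr c b (reg c i) = None then l else pc c + 1)\<rparr>"

definition halted :: "instr list \<Rightarrow> config \<Rightarrow> bool" where
  "halted P c \<longleftrightarrow> length P \<le> pc c"

definition step :: "instr list \<Rightarrow> config \<Rightarrow> config" where
  "step P c = (if halted P c then c else exec (P ! pc c) c)"

definition array_of :: "int list \<Rightarrow> int \<Rightarrow> int option" where
  "array_of xs i = (if 0 \<le> i \<and> i < int (length xs) then Some (xs ! nat i) else None)"

text \<open>
  Array 0 is the output array; the input arrays are 1, 2, and so on. Everything else is
  initially empty, and all registers are 0 (in particular the machine is not told the input
  length; it can find the end of an input array by the test for empty cells).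
\<close>

definition init :: "int list list \<Rightarrow> config" where
  "init ins =
     \<lparr>pc = 0, reg = (\<lambda>_. 0),
      arr = (\<lambda>b. if 1 \<le> b \<and> b \<le> length ins then array_of (ins ! (b - 1)) else (\<lambda>_. None))\<rparr>"

definition run :: "instr list \<Rightarrow> int list list \<Rightarrow> nat \<Rightarrow> config" where
  "run P ins k = (step P ^^ k) (init ins)"

definition outputs_within :: "instr list \<Rightarrow> int list list \<Rightarrow> int list \<Rightarrow> nat \<Rightarrow> bool" where
  "outputs_within P ins out k \<longleftrightarrow>
     (\<exists>j\<le>k. halted P (run P ins j) \<and> arr (run P ins j) 0 = array_of out)"

text \<open>
  All integers ever held in a register or an array cell have absolute value at most \<open>m\<close>.
  As indices are taken from registers, this bounds all addresses as well.
\<close>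

definition entries_bounded :: "instr list \<Rightarrow> int list list \<Rightarrow> nat \<Rightarrow> bool" where
  "entries_bounded P ins m \<longleftrightarrow>
     (\<forall>k. (\<forall>r. \<bar>reg (run P ins k) r\<bar> \<le> int m) \<and>
          (\<forall>b i z. arr (run P ins k) b i = Some z \<longrightarrow> \<bar>z\<bar> \<le> int m))"

text \<open>Number of binary digits, plus a sign bit.\<close>

definition bits :: "int \<Rightarrow> nat" where
  "bits z = floorlog 2 (nat \<bar>z\<bar>) + 1"

text \<open>
  Space in bits. A nonempty cell is charged for its content and for its index, so that
  information cannot be stored for free in the choice of the occupied cells. Both sums are
  finite in every reachable configuration; only finitely many registers occur in a program,
  so leaving out those with value 0 changes the space by a constant at most.
\<close>

definition config_space :: "config \<Rightarrow> nat" where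
  "config_space c =
     (\<Sum>r | reg c r \<noteq> 0. bits (reg c r)) +
     (\<Sum>(b, i) | arr c b i \<noteq> None. bits i + bits (the (arr c b i)))"

definition space_within :: "instr list \<Rightarrow> int list list \<Rightarrow> nat \<Rightarrow> bool" where
  "space_within P ins s \<longleftrightarrow> (\<forall>k. config_space (run P ins k) \<le> s)"


section \<open>Encodings and linear-time solvability\<close>

fun letter_code :: "letter \<Rightarrow> int" where
  "letter_code A_pos = 1"
| "letter_code A_neg = 2"
| "letter_code T_pos = 3"
| "letter_code T_neg = 4"

definition word_code :: "word \<Rightarrow> int list" where
  "word_code w = map letter_code w"

text \<open>
  Sign (1 for negative integers), followed by the binary digits of the absolute value, most
  significant digit first. An input integer need not be linear in the length of the input
  word, so it is not given as a single array entry.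
\<close>

definition int_code :: "int \<Rightarrow> int list" where
  "int_code k =
     of_bool (k < 0) #
     map (\<lambda>i. of_bool (bit \<bar>k\<bar> i)) (rev [0..<floorlog 2 (nat \<bar>k\<bar>)])"

definition input_size :: "int list list \<Rightarrow> nat" where
  "input_size ins = sum_list (map length ins)"

text \<open>
  A problem is given by an encoding of its instances and the relation between instances and
  correct outputs.
\<close>

definition linear_time_solvable ::
    "('i \<Rightarrow> int list list) \<Rightarrow> ('i \<Rightarrow> int list \<Rightarrow> bool) \<Rightarrow> bool" where
  "linear_time_solvable enc correct \<longleftrightarrow>
     (\<exists>P (time :: nat \<Rightarrow> nat) (bound :: nat \<Rightarrow> nat).
        (\<lambda>n. real (time n)) \<in> O(\<lambda>n. real n) \<and>
        (\<lambda>n. real (bound n)) \<in> O(\<lambda>n. real n) \<and>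
        (\<forall>x. entries_bounded P (enc x) (bound (input_size (enc x))) \<and>
             (\<exists>out. correct x out \<and>
                outputs_within P (enc x) out (time (input_size (enc x))))))"

definition geodesic_problem_linear :: "nat \<Rightarrow> bool" where
  "geodesic_problem_linear p \<longleftrightarrow>
     linear_time_solvable (\<lambda>w. [word_code w])
       (\<lambda>w out. \<exists>v. geodesic p v \<and> eq_BS p v w \<and> out = word_code v)"

definition geodesic_length_problem_linear :: "nat \<Rightarrow> bool" where
  "geodesic_length_problem_linear p \<longleftrightarrow>
     linear_time_solvable (\<lambda>w. [word_code w])
       (\<lambda>w out. out = [int (geodesic_length p w)])"

definition bounded_geodesic_length_problem_linear :: "nat \<Rightarrow> bool" where
  "bounded_geodesic_length_problem_linear p \<longleftrightarrow>
     linear_time_solvable (\<lambda>(w, k). [word_code w, int_code k])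
       (\<lambda>(w, k) out. out = [of_bool (int (geodesic_length p w) < k)])"

end

theory Submission
  imports Defs
begin

text \<open>
  An element of the group is an affine map: a height \<open>h\<close> and a translation \<open>x\<close> in Z[1/p]. A word walks
  along the heights and adds \<open>\<plusminus>p\<^sup>j\<close> at height \<open>j\<close>, so a geodesic amounts to an expansion of \<open>x\<close> as a sum of
  \<open>c\<^sub>j p\<^sup>j\<close> over \<open>L \<le> j \<le> M\<close>, where \<open>[L, M]\<close> contains 0 and \<open>h\<close>, that minimises
  \<open>2 (M - L) - \<bar>h\<bar>\<close> plus the sum of all \<open>\<bar>c\<^sub>j\<bar>\<close>. Compared with the standard expansion with digits in
  \<open>{0..<p}\<close>, only carries 0 and 1 are needed (by the triangle inequality), so a dynamic program with two
  states per position computes the optimum. The lowest position is forced, and the top position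
  lies between the end of the standard expansion and the first position, going down, where the
  remaining quotient exceeds 2 in absolute value. Normalising the digits takes linear
  time because every carry is paid for by a decrease of the sum of the absolute values.
\<close>

section \<open>The group as affine maps\<close>

text \<open>The integer \<open>X\<close> behind the translation can have linearly many digits, so no
  register may hold it. The machine sees only single digits and, near the top, quotients of absolute
  value at most \<open>3 * p\<close>. Stopping the search as soon as a quotient reaches absolute
  value 3 is therefore what keeps both entries and time linear. The threshold is dictated by
  negative quotients: floor division rounds down, the matching carry turns r into r + 1, and the
  price 2 of one more position is surely recovered only if r \<le> -3. Optimality is proved against
  arbitrary words, whose exponent sums may carry any integer and may start below the forced
  position. What such a word has paid so far covers some \<open>dp\<close> value plus the distance
  between its remaining tail and the quotient with carry; this invariant replaces any rewriting of
  words. Entries must stay O(n) in every reachable configuration. This is checked once on the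
  program text, and for that reason two variable quantities are never added directly, except for
  comparisons and final counters: digits and products are transferred in unit steps.\<close>

fun ht :: "word \<Rightarrow> int" where
  "ht [] = 0"
| "ht (A_pos # w) = ht w"
| "ht (A_neg # w) = ht w"
| "ht (T_pos # w) = 1 + ht w"
| "ht (T_neg # w) = -1 + ht w"

fun transl :: "nat \<Rightarrow> word \<Rightarrow> real" where
  "transl p [] = 0"
| "transl p (A_pos # w) = 1 + transl p w"
| "transl p (A_neg # w) = -1 + transl p w"
| "transl p (T_pos # w) = real p * transl p w"
| "transl p (T_neg # w) = transl p w / real p"

lemma ht_append: "ht (u @ v) = ht u + ht v"
  by (induction u rule: ht.induct) auto

lemma transl_append:
  assumes "p > 0"
  shows "transl p (u @ v) = transl p u + real p powi (ht u) * transl p v"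
proof (induction u)
  case (Cons x u)
  then show ?case
    using assms
    by (cases x) (auto simp: algebra_simps power_int_add power_int_diff divide_simps)
qed simp

lemma ht_replicate_A [simp]: "ht (replicate n A_pos) = 0" "ht (replicate n A_neg) = 0"
  by (induction n) auto

lemma ht_replicate_T [simp]: "ht (replicate n T_pos) = int n" "ht (replicate n T_neg) = - int n"
  by (induction n) auto

lemma transl_replicate_A [simp]:
  "transl p (replicate n A_pos) = real n" "transl p (replicate n A_neg) = - real n"
  by (induction n) auto

lemma transl_replicate_T [simp]:
  "transl p (replicate n T_pos) = 0" "transl p (replicate n T_neg) = 0"
  by (induction n) auto

lemma eq_BS_sound:
  assumes "eq_BS p u v" "p > 0"
  shows "ht u = ht v \<and> transl p u = transl p v"
  using assms
proof (induction rule: eq_BS.induct)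
  case (cancel u x v)
  then show ?case
    by (cases x) (auto simp: ht_append transl_append power_int_add)
next
  case (relator u v)
  then show ?case
    by (auto simp: ht_append transl_append power_int_add field_simps)
qed auto

lemma eq_BS_context: "eq_BS p u v \<Longrightarrow> eq_BS p (x @ u @ y) (x @ v @ y)"
proof (induction rule: eq_BS.induct)
  case (cancel u a v)
  then show ?case
    using eq_BS.cancel[of p "x @ u" a "v @ y"] by simp
next
  case (relator u v)
  then show ?case
    using eq_BS.relator[of p "x @ u" "v @ y"] by simp
qed (auto intro: eq_BS.intros)

lemma eq_BS_append:
  assumes "eq_BS p u u'" "eq_BS p v v'"
  shows "eq_BS p (u @ v) (u' @ v')"
  using eq_BS_context[OF assms(1), of "[]" v] eq_BS_context[OF assms(2), of u' "[]"]
  by (auto intro: eq_BS.trans)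

lemma eq_BS_cancel_inv: "eq_BS p (u @ [inv_letter x, x] @ v) (u @ v)"
  using eq_BS.cancel[of p u "inv_letter x" v] by (cases x) auto

declare eq_BS.trans [trans]

section \<open>Powers of a and their commutation with t\<close>

definition apow :: "int \<Rightarrow> word" where
  "apow k = (if k \<ge> 0 then replicate (nat k) A_pos else replicate (nat (- k)) A_neg)"

lemma ht_apow [simp]: "ht (apow k) = 0"
  by (simp add: apow_def)

lemma transl_apow [simp]: "transl p (apow k) = of_int k"
  by (simp add: apow_def)

lemma length_apow [simp]: "length (apow k) = nat \<bar>k\<bar>"
  by (simp add: apow_def)

lemma apow_0 [simp]: "apow 0 = []"
  by (simp add: apow_def)

lemma apow_snoc_pos: "eq_BS p (apow k @ [A_pos]) (apow (k + 1))"
proof (cases "k \<ge> 0")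
  case True
  then have "apow k @ [A_pos] = apow (k + 1)"
    by (simp add: apow_def nat_add_distrib replicate_append_same)
  then show ?thesis by (simp add: eq_BS.refl)
next
  case False
  define m where "m = nat (- k) - 1"
  have m: "k = - int m - 1" using False by (simp add: m_def)
  have "apow k = replicate m A_neg @ [A_neg]" "apow (k + 1) = replicate m A_neg"
    unfolding m apow_def by (auto simp: replicate_append_same nat_add_distrib)
  then show ?thesis
    using eq_BS.cancel[of p "replicate m A_neg" A_neg "[]"] by simp
qed

lemma apow_snoc_neg: "eq_BS p (apow k @ [A_neg]) (apow (k - 1))"
proof (cases "k \<le> 0")
  case True
  then obtain m where m: "k = - int m"
    using nonpos_int_cases by blast
  have "nat (1 + int m) = Suc m" by simp
  then have "apow k @ [A_neg] = apow (k - 1)"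
    by (auto simp add: apow_def m replicate_append_same)
  then show ?thesis by (simp add: eq_BS.refl)
next
  case False
  define m where "m = nat k - 1"
  have m: "k = int m + 1" using False by (simp add: m_def)
  have "apow k = replicate m A_pos @ [A_pos]" "apow (k - 1) = replicate m A_pos"
    unfolding m apow_def by (auto simp: replicate_append_same nat_add_distrib)
  then show ?thesis
    using eq_BS.cancel[of p "replicate m A_pos" A_pos "[]"] by simp
qed

lemma apow_add: "eq_BS p (apow j @ apow k) (apow (j + k))"
proof (induction k rule: int_induct[where k = 0])
  case base
  then show ?case by (simp add: eq_BS.refl)
next
  case (step1 k)
  have "eq_BS p (apow j @ apow (k + 1)) (apow j @ apow k @ [A_pos])"
    by (intro eq_BS_append eq_BS.refl eq_BS.sym[OF apow_snoc_pos])
  also have "eq_BS p \<dots> (apow (j + k) @ [A_pos])"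
    using eq_BS_append[OF step1(2) eq_BS.refl] by simp
  also have "eq_BS p \<dots> (apow (j + k + 1))" by (rule apow_snoc_pos)
  finally show ?case by (simp add: add.assoc)
next
  case (step2 k)
  have "eq_BS p (apow j @ apow (k - 1)) (apow j @ apow k @ [A_neg])"
    by (intro eq_BS_append eq_BS.refl eq_BS.sym[OF apow_snoc_neg])
  also have "eq_BS p \<dots> (apow (j + k) @ [A_neg])"
    using eq_BS_append[OF step2(2) eq_BS.refl] by simp
  also have "eq_BS p \<dots> (apow (j + k - 1))" by (rule apow_snoc_neg)
  finally show ?case by (simp add: algebra_simps)
qed

lemma T_A_pos: "eq_BS p [T_pos, A_pos] (apow (int p) @ [T_pos])"
proof -
  have "eq_BS p [T_pos, A_pos] ([T_pos, A_pos] @ [inv_letter T_pos, T_pos] @ [])"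
    using eq_BS.sym[OF eq_BS_cancel_inv[of p "[T_pos, A_pos]" T_pos "[]"]] by simp
  also have "eq_BS p \<dots> (replicate p A_pos @ [T_pos])"
    using eq_BS.relator[of p "[]" "[T_pos]"] by simp
  finally show ?thesis by (simp add: apow_def)
qed

text \<open>The defining relation only moves t past the positive letter. Inserting the trivial
  product of the powers -p and p of a turns the second factor back into t a, whose a then
  cancels.\<close>

lemma T_A_neg: "eq_BS p [T_pos, A_neg] (apow (- int p) @ [T_pos])"
proof -
  have "eq_BS p [T_pos, A_neg] ((apow (- int p) @ apow (int p)) @ [T_pos, A_neg])"
    using eq_BS_append[OF eq_BS.sym[OF apow_add[of p "- int p" "int p"]] eq_BS.refl] by simp
  also have "\<dots> = apow (- int p) @ (apow (int p) @ [T_pos]) @ [A_neg]" by simp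
  also have "eq_BS p \<dots> (apow (- int p) @ [T_pos, A_pos] @ [A_neg])"
    by (intro eq_BS_context eq_BS.sym[OF T_A_pos])
  also have "eq_BS p \<dots> (apow (- int p) @ [T_pos])"
    using eq_BS.cancel[of p "apow (- int p) @ [T_pos]" A_pos "[]"] by simp
  finally show ?thesis .
qed

lemma T_apow: "eq_BS p ([T_pos] @ apow k) (apow (int p * k) @ [T_pos])"
proof (induction k rule: int_induct[where k = 0])
  case base
  then show ?case by (simp add: eq_BS.refl)
next
  case (step1 k)
  have "eq_BS p ([T_pos] @ apow (k + 1)) ([T_pos] @ apow k @ [A_pos])"
    by (intro eq_BS_append eq_BS.refl eq_BS.sym[OF apow_snoc_pos])
  also have "eq_BS p \<dots> (apow (int p * k) @ [T_pos, A_pos])"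
    using eq_BS_append[OF step1(2) eq_BS.refl[of p "[A_pos]"]] by simp
  also have "eq_BS p \<dots> ((apow (int p * k) @ apow (int p)) @ [T_pos])"
    using eq_BS_append[OF eq_BS.refl T_A_pos] by simp
  also have "eq_BS p \<dots> (apow (int p * k + int p) @ [T_pos])"
    by (intro eq_BS_append eq_BS.refl apow_add)
  finally show ?case by (simp add: algebra_simps)
next
  case (step2 k)
  have "eq_BS p ([T_pos] @ apow (k - 1)) ([T_pos] @ apow k @ [A_neg])"
    by (intro eq_BS_append eq_BS.refl eq_BS.sym[OF apow_snoc_neg])
  also have "eq_BS p \<dots> (apow (int p * k) @ [T_pos, A_neg])"
    using eq_BS_append[OF step2(2) eq_BS.refl[of p "[A_neg]"]] by simp
  also have "eq_BS p \<dots> ((apow (int p * k) @ apow (- int p)) @ [T_pos])"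
    using eq_BS_append[OF eq_BS.refl T_A_neg] by simp
  also have "eq_BS p \<dots> (apow (int p * k + - int p) @ [T_pos])"
    by (intro eq_BS_append eq_BS.refl apow_add)
  finally show ?case by (simp add: algebra_simps)
qed

lemma replicate_T_apow:
  "eq_BS p (replicate j T_pos @ apow k) (apow (int p ^ j * k) @ replicate j T_pos)"
proof (induction j)
  case (Suc j)
  have "eq_BS p (replicate (Suc j) T_pos @ apow k)
          ([T_pos] @ apow (int p ^ j * k) @ replicate j T_pos)"
    using eq_BS_append[OF eq_BS.refl[of p "[T_pos]"] Suc] by simp
  also have "eq_BS p \<dots> (apow (int p * (int p ^ j * k)) @ [T_pos] @ replicate j T_pos)"
    using eq_BS_append[OF T_apow eq_BS.refl[of p "replicate j T_pos"]] by simp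
  finally show ?case by (simp add: mult.assoc)
qed (simp add: eq_BS.refl)

lemma apow_T_neg: "eq_BS p (apow k @ [T_neg]) ([T_neg] @ apow (int p * k))"
proof -
  have "eq_BS p (apow k @ [T_neg]) ([T_neg] @ [T_pos] @ apow k @ [T_neg])"
    using eq_BS.sym[OF eq_BS_cancel_inv[of p "[]" T_pos "apow k @ [T_neg]"]] by simp
  also have "eq_BS p \<dots> ([T_neg] @ (apow (int p * k) @ [T_pos]) @ [T_neg])"
    using eq_BS_context[OF T_apow, of p "[T_neg]" k "[T_neg]"] by simp
  also have "eq_BS p \<dots> ([T_neg] @ apow (int p * k))"
    using eq_BS.cancel[of p "[T_neg] @ apow (int p * k)" T_pos "[]"] by simp
  finally show ?thesis .
qed

lemma T_conj_apow: "eq_BS p (replicate m T_neg @ apow (int p ^ m * k) @ replicate m T_pos) (apow k)"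
proof (induction m arbitrary: k)
  case 0
  then show ?case by (simp add: eq_BS.refl)
next
  case (Suc m)
  have "eq_BS p (replicate (Suc m) T_neg @ apow (int p ^ Suc m * k) @ replicate (Suc m) T_pos)
      (replicate m T_neg @ ([T_neg] @ apow (int p * (int p ^ m * k))) @ [T_pos] @ replicate m T_pos)"
    by (simp add: mult.assoc eq_BS.refl replicate_app_Cons_same)
  also have "eq_BS p \<dots> (replicate m T_neg @ (apow (int p ^ m * k) @ [T_neg]) @ [T_pos] @ replicate m T_pos)"
    by (intro eq_BS_context eq_BS.sym[OF apow_T_neg])
  also have "eq_BS p \<dots> (replicate m T_neg @ apow (int p ^ m * k) @ replicate m T_pos)"
    using eq_BS_cancel_inv[of p "replicate m T_neg @ apow (int p ^ m * k)" T_pos "replicate m T_pos"]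
    by simp
  also have "eq_BS p \<dots> (apow k)" by (rule Suc)
  finally show ?case .
qed

section \<open>Normal forms and the word problem\<close>

definition nform :: "nat \<Rightarrow> int \<Rightarrow> nat \<Rightarrow> word" where
  "nform i k j = replicate i T_neg @ apow k @ replicate j T_pos"

lemma nform_apow: "eq_BS p (nform i k j @ apow m) (nform i (k + int p ^ j * m) j)"
proof -
  have "eq_BS p (nform i k j @ apow m)
      ((replicate i T_neg @ apow k) @ apow (int p ^ j * m) @ replicate j T_pos)"
    using eq_BS_append[OF eq_BS.refl replicate_T_apow, of p "replicate i T_neg @ apow k" j m]
    by (simp add: nform_def)
  also have "eq_BS p \<dots> (nform i (k + int p ^ j * m) j)"
    using eq_BS_context[OF apow_add[of p k "int p ^ j * m"], of "replicate i T_neg" "replicate j T_pos"]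
    by (simp add: nform_def)
  finally show ?thesis .
qed

text \<open>Only a final inverse of t with no t left to cancel needs work: it is moved left past the
  power of a, which multiplies the exponent by p.\<close>

lemma nform_snoc: "\<exists>i' k' j'. eq_BS p (nform i k j @ [x]) (nform i' k' j')"
proof (cases x)
  case A_pos
  then show ?thesis using nform_apow[of p i k j 1] by (auto simp: apow_def)
next
  case A_neg
  then show ?thesis using nform_apow[of p i k j "-1"] by (auto simp: apow_def)
next
  case T_pos
  then have "nform i k j @ [x] = nform i k (Suc j)"
    using replicate_append_same[of j T_pos] by (simp add: nform_def)
  then show ?thesis by (metis eq_BS.refl)
next
  case T_neg
  show ?thesis
  proof (cases j)
    case 0
    have "eq_BS p (nform i k j @ [x]) (replicate i T_neg @ ([T_neg] @ apow (int p * k)) @ [])"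
      using eq_BS_context[OF apow_T_neg, of p "replicate i T_neg" k "[]"] by (simp add: nform_def 0 T_neg)
    also have "\<dots> = nform (Suc i) (int p * k) 0"
      using replicate_append_same[of i T_neg] by (simp add: nform_def)
    finally show ?thesis by blast
  next
    case (Suc j')
    have "nform i k j @ [x] = nform i k j' @ [T_pos, inv_letter T_pos] @ []"
      using replicate_append_same[of j' T_pos] by (simp add: nform_def Suc T_neg)
    then show ?thesis using eq_BS.cancel[of p "nform i k j'" T_pos "[]"] by auto
  qed
qed

lemma nform_exists: "\<exists>i k j. eq_BS p w (nform i k j)"
proof (induction w rule: rev_induct)
  case Nil
  have "nform 0 0 0 = []" by (simp add: nform_def)
  then show ?case by (metis eq_BS.refl)
next
  case (snoc x w)
  then obtain i k j where "eq_BS p w (nform i k j)" by blast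
  then have "eq_BS p (w @ [x]) (nform i k j @ [x])" by (intro eq_BS_append eq_BS.refl)
  with nform_snoc[of p i k j x] show ?case by (blast intro: eq_BS.trans)
qed

text \<open>Normal forms are not unique; this shift is their only ambiguity, as
  \<open>nform_unique\<close> shows.\<close>

lemma nform_shift: "eq_BS p (nform (i + m) (int p ^ m * k) (j + m)) (nform i k j)"
proof -
  have "replicate (j + m) T_pos = replicate m T_pos @ replicate j T_pos"
    by (simp add: replicate_add[symmetric] add.commute)
  then have "nform (i + m) (int p ^ m * k) (j + m) = replicate i T_neg
      @ (replicate m T_neg @ apow (int p ^ m * k) @ replicate m T_pos) @ replicate j T_pos"
    by (simp add: nform_def replicate_add)
  then show ?thesis
    using eq_BS_context[OF T_conj_apow, of p "replicate i T_neg" m k "replicate j T_pos"]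
    by (simp add: nform_def)
qed

text \<open>Equal heights force \<open>i' - i = j' - j\<close>. With this number called
  \<open>m\<close>, equal translations force \<open>k' = p ^ m * k\<close>, so the two forms differ
  by a shift.\<close>

lemma nform_unique:
  assumes "p > 0" "i \<le> i'" "ht (nform i k j) = ht (nform i' k' j')"
    "transl p (nform i k j) = transl p (nform i' k' j')"
  shows "eq_BS p (nform i' k' j') (nform i k j)"
proof -
  define m where "m = i' - i"
  have i': "i' = i + m" using assms(2) by (simp add: m_def)
  have j': "j' = j + m"
    using assms(3) by (simp add: nform_def ht_append i')
  have "real p powi (- int i) * of_int k = real p powi (- int (i + m)) * of_int k'"
    using assms by (simp add: nform_def transl_append i')
  then have "of_int k' = (of_int (int p ^ m * k) :: real)"
    using assms(1)
    by (simp add: power_int_minus power_add field_simps del: of_nat_add)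
  then have "k' = int p ^ m * k" by (simp only: of_int_eq_iff)
  then show ?thesis using nform_shift[of p i m k j] by (simp add: i' j')
qed

lemma eq_BS_iff:
  assumes "p > 0"
  shows "eq_BS p u v \<longleftrightarrow> ht u = ht v \<and> transl p u = transl p v"
proof
  show "ht u = ht v \<and> transl p u = transl p v" if "eq_BS p u v"
    using eq_BS_sound[OF that assms] .
next
  assume uv: "ht u = ht v \<and> transl p u = transl p v"
  obtain i k j where u: "eq_BS p u (nform i k j)" using nform_exists by blast
  obtain i' k' j' where v: "eq_BS p v (nform i' k' j')" using nform_exists by blast
  have eq: "ht (nform i k j) = ht (nform i' k' j')"
    "transl p (nform i k j) = transl p (nform i' k' j')"
    using uv eq_BS_sound[OF u assms] eq_BS_sound[OF v assms] by auto
  have "eq_BS p (nform i k j) (nform i' k' j')"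
    using nform_unique[OF assms _ eq] nform_unique[OF assms _ eq[symmetric]]
    by (meson eq_BS.sym linear)
  then show "eq_BS p u v"
    using u v by (meson eq_BS.sym eq_BS.trans)
qed

section \<open>Lower bound for the length of a word\<close>

text \<open>Scanning a word yields its final, minimal and maximal height, and for every height \<open>j\<close>
  the exponent sum of the letters a read at height \<open>j\<close>.\<close>

fun scan1 :: "letter \<Rightarrow> int \<times> int \<times> int \<times> (int \<Rightarrow> int) \<Rightarrow> int \<times> int \<times> int \<times> (int \<Rightarrow> int)" where
  "scan1 A_pos (h, lo, hi, D) = (h, lo, hi, D(h := D h + 1))"
| "scan1 A_neg (h, lo, hi, D) = (h, lo, hi, D(h := D h - 1))"
| "scan1 T_pos (h, lo, hi, D) = (h + 1, lo, max hi (h + 1), D)"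
| "scan1 T_neg (h, lo, hi, D) = (h - 1, min lo (h - 1), hi, D)"

definition scan :: "word \<Rightarrow> int \<times> int \<times> int \<times> (int \<Rightarrow> int)" where
  "scan w = fold scan1 w (0, 0, 0, \<lambda>_. 0)"

lemma scan_Nil [simp]: "scan [] = (0, 0, 0, \<lambda>_. 0)"
  by (simp add: scan_def)

lemma scan_snoc [simp]: "scan (w @ [x]) = scan1 x (scan w)"
  by (simp add: scan_def)

lemma sum_fun_upd_int:
  fixes f :: "int \<Rightarrow> int \<Rightarrow> 'b :: ab_group_add"
  assumes "finite A" "j \<in> A"
  shows "(\<Sum>i\<in>A. f i ((D(j := v)) i)) = (\<Sum>i\<in>A. f i (D i)) + f j v - f j (D j)"
proof -
  have "(\<Sum>i\<in>A - {j}. f i ((D(j := v)) i)) = (\<Sum>i\<in>A - {j}. f i (D i))"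
    by (intro sum.cong) auto
  then show ?thesis
    using sum.remove[OF assms, of "\<lambda>i. f i ((D(j := v)) i)"] sum.remove[OF assms, of "\<lambda>i. f i (D i)"]
    by simp
qed

text \<open>\<open>2 * (hi - lo) - \<bar>h\<bar>\<close> is the length of the shortest walk from 0
  to \<open>h\<close> with range \<open>[lo, hi]\<close>. A letter t or its inverse raises it by at
  most 1: extending the range costs 2, but then \<open>\<bar>h\<bar>\<close> grows as well. A letter
  a or its inverse changes one exponent sum by 1.\<close>

lemma scan_props:
  assumes "p > 0" "scan w = (h, lo, hi, D)"
  shows "h = ht w \<and> lo \<le> 0 \<and> 0 \<le> hi \<and> lo \<le> h \<and> h \<le> hi \<and>
    (\<forall>j. j < lo \<or> j > hi \<longrightarrow> D j = 0) \<and>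
    transl p w = (\<Sum>j=lo..hi. of_int (D j) * real p powi j) \<and>
    2 * (hi - lo) - \<bar>h\<bar> + (\<Sum>j=lo..hi. \<bar>D j\<bar>) \<le> int (length w)"
  using assms(2)
proof (induction w arbitrary: h lo hi D rule: rev_induct)
  case Nil
  then show ?case by auto
next
  case (snoc x w)
  obtain h' lo' hi' D' where sc: "scan w = (h', lo', hi', D')"
    by (metis prod_cases4)
  note IH = snoc.IH[OF sc]
  have ab: "\<bar>D' h' + 1\<bar> \<le> \<bar>D' h'\<bar> + 1" "\<bar>D' h' - 1\<bar> \<le> \<bar>D' h'\<bar> + 1" by auto
  show ?case
  proof (cases x)
    case A_pos
    then have eq: "h = h'" "lo = lo'" "hi = hi'" "D = D'(h' := D' h' + 1)"
      using snoc.prems sc by auto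
    have "(\<Sum>j=lo'..hi'. real_of_int (D j) * real p powi j)
        = (\<Sum>j=lo'..hi'. of_int (D' j) * real p powi j) + real p powi h'"
      using sum_fun_upd_int[of "{lo'..hi'}" h' "\<lambda>j z. real_of_int z * real p powi j" D' "D' h' + 1"] IH
      by (simp add: eq algebra_simps)
    moreover have "(\<Sum>j=lo'..hi'. \<bar>D j\<bar>) \<le> (\<Sum>j=lo'..hi'. \<bar>D' j\<bar>) + 1"
      using sum_fun_upd_int[of "{lo'..hi'}" h' "\<lambda>j. abs" D' "D' h' + 1"] IH ab
      by (simp add: eq)
    moreover have "\<forall>j. j < lo' \<or> j > hi' \<longrightarrow> D j = 0"
      using IH by (auto simp: eq)
    moreover have "transl p (w @ [x]) = transl p w + real p powi h'" "ht (w @ [x]) = ht w"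
      using IH by (simp_all add: A_pos ht_append transl_append[OF \<open>p > 0\<close>])
    moreover have "2 * (hi - lo) - \<bar>h\<bar> + (\<Sum>j=lo'..hi'. \<bar>D' j\<bar>) \<le> int (length w)"
      using IH unfolding eq(1-3) by blast
    moreover have "h = ht w"
      using IH eq(1) by blast
    ultimately show ?thesis
      using IH eq(2,3) by auto
  next
    case A_neg
    then have eq: "h = h'" "lo = lo'" "hi = hi'" "D = D'(h' := D' h' - 1)"
      using snoc.prems sc by auto
    have "(\<Sum>j=lo'..hi'. real_of_int (D j) * real p powi j)
        = (\<Sum>j=lo'..hi'. of_int (D' j) * real p powi j) - real p powi h'"
      using sum_fun_upd_int[of "{lo'..hi'}" h' "\<lambda>j z. real_of_int z * real p powi j" D' "D' h' - 1"] IH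
      by (simp add: eq algebra_simps)
    moreover have "(\<Sum>j=lo'..hi'. \<bar>D j\<bar>) \<le> (\<Sum>j=lo'..hi'. \<bar>D' j\<bar>) + 1"
      using sum_fun_upd_int[of "{lo'..hi'}" h' "\<lambda>j. abs" D' "D' h' - 1"] IH ab
      by (simp add: eq)
    moreover have "\<forall>j. j < lo' \<or> j > hi' \<longrightarrow> D j = 0"
      using IH by (auto simp: eq)
    moreover have "transl p (w @ [x]) = transl p w - real p powi h'" "ht (w @ [x]) = ht w"
      using IH by (simp_all add: A_neg ht_append transl_append[OF \<open>p > 0\<close>])
    moreover have "2 * (hi - lo) - \<bar>h\<bar> + (\<Sum>j=lo'..hi'. \<bar>D' j\<bar>) \<le> int (length w)"
      using IH unfolding eq(1-3) by blast
    moreover have "h = ht w"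
      using IH eq(1) by blast
    ultimately show ?thesis
      using IH eq(2,3) by auto
  next
    case T_pos
    then have eq: "h = h' + 1" "lo = lo'" "hi = max hi' (h' + 1)" "D = D'"
      using snoc.prems sc by auto
    have ht: "ht (w @ [x]) = ht w + 1" "transl p (w @ [x]) = transl p w"
      by (simp_all add: T_pos ht_append transl_append[OF \<open>p > 0\<close>])
    \<comment> \<open>The range may have grown by one height, but nothing has been read there yet,
      so the new summand vanishes.\<close>
    have sums: "(\<Sum>j=lo..hi. f (D j) j) = (\<Sum>j=lo'..hi'. f (D' j) j)"
      if "\<And>j. f 0 j = 0" for f :: "int \<Rightarrow> int \<Rightarrow> 'b :: comm_monoid_add"
      using IH that by (intro sum.mono_neutral_cong_right) (auto simp: eq)
    have "transl p w = (\<Sum>j=lo..hi. of_int (D j) * real p powi j)"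
      using IH sums[of "\<lambda>z j. of_int z * real p powi j"] by simp
    moreover have "(\<Sum>j=lo..hi. \<bar>D j\<bar>) = (\<Sum>j=lo'..hi'. \<bar>D' j\<bar>)"
      using sums[of "\<lambda>z j. \<bar>z\<bar>"] by simp
    moreover have "\<forall>j. j < lo \<or> j > hi \<longrightarrow> D j = 0"
      using IH by (auto simp: eq)
    moreover from IH have "lo' \<le> 0" "0 \<le> hi'" "lo' \<le> h'" "h' \<le> hi'" by blast+
    then have "2 * (hi - lo) - \<bar>h\<bar> \<le> 2 * (hi' - lo') - \<bar>h'\<bar> + 1"
      "lo \<le> 0" "0 \<le> hi" "lo \<le> h" "h \<le> hi"
      unfolding eq by (auto simp: max_def min_def abs_if)
    ultimately show ?thesis
      using IH ht eq(1) by auto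
  next
    case T_neg
    then have eq: "h = h' - 1" "lo = min lo' (h' - 1)" "hi = hi'" "D = D'"
      using snoc.prems sc by auto
    have ht: "ht (w @ [x]) = ht w - 1" "transl p (w @ [x]) = transl p w"
      by (simp_all add: T_neg ht_append transl_append[OF \<open>p > 0\<close>])
    have sums: "(\<Sum>j=lo..hi. f (D j) j) = (\<Sum>j=lo'..hi'. f (D' j) j)"
      if "\<And>j. f 0 j = 0" for f :: "int \<Rightarrow> int \<Rightarrow> 'b :: comm_monoid_add"
      using IH that by (intro sum.mono_neutral_cong_right) (auto simp: eq)
    have "transl p w = (\<Sum>j=lo..hi. of_int (D j) * real p powi j)"
      using IH sums[of "\<lambda>z j. of_int z * real p powi j"] by simp
    moreover have "(\<Sum>j=lo..hi. \<bar>D j\<bar>) = (\<Sum>j=lo'..hi'. \<bar>D' j\<bar>)"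
      using sums[of "\<lambda>z j. \<bar>z\<bar>"] by simp
    moreover have "\<forall>j. j < lo \<or> j > hi \<longrightarrow> D j = 0"
      using IH by (auto simp: eq)
    moreover from IH have "lo' \<le> 0" "0 \<le> hi'" "lo' \<le> h'" "h' \<le> hi'" by blast+
    then have "2 * (hi - lo) - \<bar>h\<bar> \<le> 2 * (hi' - lo') - \<bar>h'\<bar> + 1"
      "lo \<le> 0" "0 \<le> hi" "lo \<le> h" "h \<le> hi"
      unfolding eq by (auto simp: max_def min_def abs_if)
    ultimately show ?thesis
      using IH ht eq(1) by auto
  qed
qed

text \<open>The value of the part of the expansion from position \<open>j\<close> upwards, in units
  of the power at \<open>j\<close>. For the standard expansion the quotients
  \<open>X div p ^ i\<close> play this role.\<close>

definition tail :: "nat \<Rightarrow> (int \<Rightarrow> int) \<Rightarrow> int \<Rightarrow> int \<Rightarrow> int" where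
  "tail p D hi j = (\<Sum>i=j..hi. D i * int p ^ nat (i - j))"

lemma tail_beyond: "j > hi \<Longrightarrow> tail p D hi j = 0"
  by (simp add: tail_def)

lemma tail_rec:
  assumes "j \<le> hi"
  shows "tail p D hi j = D j + int p * tail p D hi (j + 1)"
proof -
  have split: "{j..hi} = insert j {j+1..hi}" using assms by auto
  have "(\<Sum>i=j+1..hi. D i * int p ^ nat (i - j))
      = (\<Sum>i=j+1..hi. int p * (D i * int p ^ nat (i - (j + 1))))"
  proof (rule sum.cong[OF HOL.refl])
    fix i assume "i \<in> {j+1..hi}"
    then have "nat (i - j) = Suc (nat (i - (j + 1)))" by auto
    then show "D i * int p ^ nat (i - j) = int p * (D i * int p ^ nat (i - (j + 1)))"
      by simp
  qed
  then show ?thesis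
    unfolding tail_def split by (simp add: sum_distrib_left)
qed

lemma tail_real:
  assumes "p > 0"
  shows "(\<Sum>j=lo..hi. of_int (D j) * real p powi j) = of_int (tail p D hi lo) * real p powi lo"
proof -
  have "of_int (D j) * real p powi j = of_int (D j * int p ^ nat (j - lo)) * real p powi lo"
    if "j \<in> {lo..hi}" for j
  proof -
    have "real p powi j = real p powi (int (nat (j - lo)) + lo)" using that by simp
    also have "\<dots> = real p ^ nat (j - lo) * real p powi lo"
      using assms by (subst power_int_add) (auto simp del: int_nat_eq)
    finally show ?thesis by simp
  qed
  then have "(\<Sum>j=lo..hi. of_int (D j) * real p powi j)
      = (\<Sum>j=lo..hi. of_int (D j * int p ^ nat (j - lo)) * real p powi lo)"
    by (rule sum.cong[OF HOL.refl])
  then show ?thesis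
    by (simp add: tail_def sum_distrib_right)
qed

section \<open>Optimal digit expansions\<close>

text \<open>A reduced digit expansion of \<open>X\<close> differs from the standard one by carries in \<open>{0, 1}\<close>. The
  value \<open>dp p X m k\<close> is the cost of the cheapest way to fix the \<open>m\<close> lowest digits so that \<open>k\<close> is
  carried on, where moving up by one position costs 2 (the walk has to come back). A carry into
  position 0 is impossible; since it is never chosen, charging it 2 serves as infinity.\<close>

fun dp :: "int \<Rightarrow> int \<Rightarrow> nat \<Rightarrow> int \<Rightarrow> int" where
  "dp p X 0 k = 2 * k"
| "dp p X (Suc m) k =
     2 + \<bar>p * k - X div p ^ m mod p\<bar> + min (dp p X m 0) (dp p X m 1 + 1 - 2 * k)"

text \<open>With top position \<open>m\<close>, the top digit has to absorb the whole remaining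
  quotient together with the carry. The cost 2 per position is already contained in
  \<open>dp\<close>.\<close>

definition cand :: "int \<Rightarrow> int \<Rightarrow> nat \<Rightarrow> int" where
  "cand p X m = min (dp p X m 0 + \<bar>X div p ^ m\<bar>) (dp p X m 1 + \<bar>X div p ^ m + 1\<bar>)"

section \<open>Arbitrary expansions compared with the dynamic program\<close>

lemma div_power_Suc: "(X :: int) div p ^ Suc m = X div p ^ m div p" if "p > 0"
  using that by (simp add: zdiv_zmult2_eq power_Suc2 del: power_Suc)

lemma div_power_digit:
  fixes X p :: int
  assumes "p > 0"
  shows "X div p ^ m = p * (X div p ^ Suc m) + X div p ^ m mod p"
  using mult_div_mod_eq[of p "X div p ^ m"] by (simp only: div_power_Suc[OF assms])

text \<open>Descending below the lowest position does not pay. \<open>T\<close> lists the tails of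
  an expansion that starts \<open>e\<close> positions too low, so its digits are
  \<open>T i - p * T (Suc i)\<close>. The deviation from the exact multiple of \<open>X\<close> is
  divided by p at each position and grows by at most the absolute value of the digit there.\<close>

lemma low_digits_bound:
  fixes p X :: int
  assumes "p \<ge> 2" "T 0 = p ^ e * X" "m \<le> e"
  shows "\<bar>T m - p ^ (e - m) * X\<bar> \<le> (\<Sum>i<m. \<bar>T i - p * T (Suc i)\<bar>)"
  using assms(3)
proof (induction m)
  case 0
  then show ?case using assms by simp
next
  case (Suc m)
  have "p ^ (e - m) = p * p ^ (e - Suc m)"
    using Suc.prems by (metis Suc_diff_Suc Suc_le_eq power_Suc)
  then have "p * (T (Suc m) - p ^ (e - Suc m) * X) = (T m - p ^ (e - m) * X) - (T m - p * T (Suc m))"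
    by (simp add: algebra_simps)
  then have "\<bar>p * (T (Suc m) - p ^ (e - Suc m) * X)\<bar> \<le> \<bar>T m - p ^ (e - m) * X\<bar> + \<bar>T m - p * T (Suc m)\<bar>"
    by (simp only: abs_triangle_ineq4)
  then have "p * \<bar>T (Suc m) - p ^ (e - Suc m) * X\<bar> \<le> \<bar>T m - p ^ (e - m) * X\<bar> + \<bar>T m - p * T (Suc m)\<bar>"
    using assms(1) by (simp only: abs_mult) simp
  moreover have "1 * \<bar>T (Suc m) - p ^ (e - Suc m) * X\<bar> \<le> p * \<bar>T (Suc m) - p ^ (e - Suc m) * X\<bar>"
    using assms(1) by (intro mult_right_mono) auto
  ultimately show ?case using Suc by simp
qed

lemma dp_upper:
  assumes "k \<in> {0, 1}"
  shows "dp p X (Suc m) k' \<le> 2 + \<bar>p * k' - X div p ^ m mod p\<bar> + dp p X m k + k - 2 * k' * k"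
  using assms by auto

text \<open>With \<open>u\<close> the excess of the tail over the quotient, the digit is
  \<open>d + k - p * u\<close>. If \<open>u \<le> 0\<close> it is at least \<open>d + k\<close> plus
  \<open>\<bar>u\<bar>\<close>, and carry 0 will do. If \<open>u \<ge> 1\<close>, its absolute value
  is at least \<open>p - d - k\<close> plus \<open>u - 1\<close>, and carry 1 will do. An arbitrary
  integer carry is thus replaced by the nearer one of 0 and 1.\<close>

lemma dp_step_bound:
  fixes p X :: int
  assumes p: "p \<ge> 2" and k: "k \<in> {0, 1}"
  shows "\<exists>k'\<in>{0, 1}. dp p X (Suc m) k' + \<bar>T - X div p ^ Suc m - k'\<bar>
           \<le> dp p X m k + 2 + \<bar>X div p ^ m + k - p * T\<bar>"
proof -
  define d where "d = X div p ^ m mod p"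
  define u where "u = T - X div p ^ Suc m"
  have d: "0 \<le> d" "d < p" using p by (auto simp: d_def)
  have eq: "X div p ^ m + k - p * T = d + k - p * u"
    using div_power_digit[of p X m] p by (simp add: d_def u_def algebra_simps del: power_Suc)
  have dp: "dp p X (Suc m) k' \<le> 2 + \<bar>p * k' - d\<bar> + dp p X m k + k - 2 * k' * k" for k'
    using dp_upper[OF k] by (simp only: d_def)
  show ?thesis
  proof (cases "u \<le> 0")
    case True
    have "p * \<bar>u\<bar> = - (p * u)" using True by simp
    moreover have "1 * \<bar>u\<bar> \<le> p * \<bar>u\<bar>" using p by (intro mult_right_mono) auto
    moreover have "0 \<le> k" using k by auto
    ultimately have "d + k + \<bar>u\<bar> \<le> \<bar>d + k - p * u\<bar>" using d by linarith
    then have "dp p X (Suc m) 0 + \<bar>u - 0\<bar> \<le> dp p X m k + 2 + \<bar>d + k - p * u\<bar>"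
      using dp[of 0] d by simp
    then show ?thesis unfolding eq u_def[symmetric] by (intro bexI[of _ 0]) simp_all
  next
    case False
    have "1 * (u - 1) \<le> p * (u - 1)" using p False by (intro mult_right_mono) auto
    then have "u - 1 \<le> p * u - p" by (simp add: algebra_simps)
    then have "(p - d - k) + \<bar>u - 1\<bar> \<le> \<bar>d + k - p * u\<bar>"
      using False by linarith
    then have "dp p X (Suc m) 1 + \<bar>u - 1\<bar> \<le> dp p X m k + 2 + \<bar>d + k - p * u\<bar>"
      using dp[of 1] d by simp
    then show ?thesis unfolding eq u_def[symmetric] by (intro bexI[of _ 1]) simp_all
  qed
qed

text \<open>The left side is the invariant of the comparison: a \<open>dp\<close> value plus the
  distance that the expansion still has to make up for, covered by what it has paid so far.\<close>

lemma dp_bound: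
  fixes p X :: int
  assumes p: "p \<ge> 2" and "T 0 = p ^ e * X"
  shows "\<exists>k\<in>{0, 1}. dp p X m k + \<bar>T (e + m) - X div p ^ m - k\<bar>
     \<le> 2 * int m + (\<Sum>i<e + m. \<bar>T i - p * T (Suc i)\<bar>)"
proof (induction m)
  case 0
  then show ?case using low_digits_bound[of p T e X e] assms by simp
next
  case (Suc m)
  then obtain k where k: "k \<in> {0, 1}" "dp p X m k + \<bar>T (e + m) - X div p ^ m - k\<bar>
     \<le> 2 * int m + (\<Sum>i<e + m. \<bar>T i - p * T (Suc i)\<bar>)" by blast
  obtain k' where k': "k' \<in> {0, 1}"
    "dp p X (Suc m) k' + \<bar>T (Suc (e + m)) - X div p ^ Suc m - k'\<bar>
           \<le> dp p X m k + 2 + \<bar>X div p ^ m + k - p * T (Suc (e + m))\<bar>"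
    using dp_step_bound[OF p k(1)] by blast
  have "X div p ^ m + k - p * T (Suc (e + m))
      = (T (e + m) - p * T (Suc (e + m))) - (T (e + m) - X div p ^ m - k)" by simp
  then have "\<bar>X div p ^ m + k - p * T (Suc (e + m))\<bar>
      \<le> \<bar>T (e + m) - p * T (Suc (e + m))\<bar> + \<bar>T (e + m) - X div p ^ m - k\<bar>"
    by (simp only: abs_triangle_ineq4)
  moreover have "(\<Sum>i<Suc (e + m). \<bar>T i - p * T (Suc i)\<bar>)
      = (\<Sum>i<e + m. \<bar>T i - p * T (Suc i)\<bar>) + \<bar>T (e + m) - p * T (Suc (e + m))\<bar>" by simp
  moreover have "2 * int (Suc m) = 2 * int m + 2" by simp
  ultimately have "dp p X (Suc m) k' + \<bar>T (Suc (e + m)) - X div p ^ Suc m - k'\<bar>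
     \<le> 2 * int (Suc m) + (\<Sum>i<Suc (e + m). \<bar>T i - p * T (Suc i)\<bar>)"
    using k(2) k'(2) by linarith
  then show ?case using k'(1) unfolding add_Suc_right by blast
qed

lemma cand_bound:
  fixes p X :: int
  assumes p: "p \<ge> 2" and "T 0 = p ^ e * X" and T: "T (Suc (e + m)) = 0"
  shows "cand p X m \<le> 2 * int m + (\<Sum>i\<le>e + m. \<bar>T i - p * T (Suc i)\<bar>)"
proof -
  obtain k where k: "k \<in> {0, 1}" "dp p X m k + \<bar>T (e + m) - X div p ^ m - k\<bar>
     \<le> 2 * int m + (\<Sum>i<e + m. \<bar>T i - p * T (Suc i)\<bar>)" using dp_bound[of p T e X m] assms by blast
  have "cand p X m \<le> dp p X m k + \<bar>X div p ^ m + k\<bar>"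
    using k(1) by (auto simp: cand_def)
  also have "\<bar>X div p ^ m + k\<bar> = \<bar>T (e + m) - (T (e + m) - X div p ^ m - k)\<bar>" by simp
  also have "\<dots> \<le> \<bar>T (e + m)\<bar> + \<bar>T (e + m) - X div p ^ m - k\<bar>" by (rule abs_triangle_ineq4)
  finally have "cand p X m \<le> dp p X m k + \<bar>T (e + m) - X div p ^ m - k\<bar> + \<bar>T (e + m)\<bar>" by simp
  also have "\<dots> \<le> 2 * int m + (\<Sum>i<e + m. \<bar>T i - p * T (Suc i)\<bar>) + \<bar>T (e + m)\<bar>"
    using k(2) by simp
  \<comment> \<open>As the next tail is 0, the tail \<open>T (e + m)\<close> is the top digit itself
    and supplies the last summand.\<close>
  finally show ?thesis
    using T by (simp add: lessThan_Suc_atMost[symmetric])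
qed

text \<open>Once the quotient is 0 or -1 the top digit costs at most 1, with either carry, whereas
  any further position costs 2.\<close>

lemma cand_above:
  fixes p X :: int
  assumes p: "p \<ge> 2" and "X div p ^ m \<in> {0, - 1}" "m \<le> m'"
  shows "cand p X m \<le> cand p X m'"
proof -
  have "X div p ^ m' \<in> {0, - 1} \<and> cand p X m \<le> cand p X m'"
    using assms(3)
  proof (induction m' rule: dec_induct)
    case base
    then show ?case using assms by simp
  next
    case (step n)
    define d where "d = X div p ^ n mod p"
    have d: "0 \<le> d" "d < p" using p by (auto simp: d_def)
    have dv: "X div p ^ Suc n \<in> {0, - 1}"
      using step.IH div_power_Suc[of p X n] p by (auto simp: div_minus_minus zdiv_eq_0_iff div_eq_minus1)
    have ge: "\<exists>k'\<in>{0, 1}. dp p X (Suc n) k \<ge> 2 + dp p X n k'" if k: "k \<in> {0, 1}" for k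
    proof -
      consider "dp p X n 0 \<le> dp p X n 1 + 1 - 2 * k" | "dp p X n 1 + 1 - 2 * k \<le> dp p X n 0"
        by linarith
      then show ?thesis
      proof cases
        case 1
        then show ?thesis by (intro bexI[of _ 0]) auto
      next
        case 2
        then show ?thesis using k d by (intro bexI[of _ 1]) (auto simp: d_def[symmetric])
      qed
    qed
    have "cand p X n \<le> dp p X (Suc n) k" if "k \<in> {0, 1}" for k
      using ge[OF that] step.IH by (auto simp: cand_def min_def simp del: dp.simps)
    then have "cand p X n \<le> dp p X (Suc n) 0" "cand p X n \<le> dp p X (Suc n) 1" by blast+
    then have "cand p X n \<le> cand p X (Suc n)"
      unfolding cand_def[of _ _ "Suc n"] by linarith
    with dv step show ?case by auto
  qed
  then show ?thesis ..
qed

text \<open>Raising the top from a position with quotient \<open>p * r + d\<close> to the next one,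
  with quotient \<open>r\<close>, costs 2 and the digit left behind. For \<open>r \<ge> 3\<close>
  carry 0 is used and \<open>p * r \<ge> 2 * r\<close> repays this. For \<open>r \<le> - 3\<close>
  carry 1 is used; the estimate reduces to \<open>1 - r \<le> - 2 * r - 2\<close>, which is exactly
  \<open>r \<le> - 3\<close>. Large quotients stay large further down, so the step can be
  iterated.\<close>

lemma cand_below:
  fixes p X :: int
  assumes p: "p \<ge> 2" and "\<bar>X div p ^ m\<bar> \<ge> 3" "m' \<le> m"
  shows "cand p X m \<le> cand p X m'"
proof -
  have "\<bar>X div p ^ m'\<bar> \<ge> 3 \<and> cand p X m \<le> cand p X m'"
    using assms(3)
  proof (induction m' rule: inc_induct)
    case base
    then show ?case using assms by simp
  next
    case (step n)
    define d where "d = X div p ^ n mod p"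
    define r where "r = X div p ^ Suc n"
    have d: "0 \<le> d" "d < p" using p by (auto simp: d_def)
    have eq: "X div p ^ n = p * r + d"
      using div_power_digit[of p X n] p by (simp add: d_def r_def)
    have r: "\<bar>r\<bar> \<ge> 3" using step.IH by (simp add: r_def)
    have dp: "dp p X (Suc n) k' \<le> 2 + \<bar>p * k' - d\<bar> + dp p X n k + k - 2 * k' * k"
      if "k \<in> {0, 1}" for k k'
      using dp_upper[OF that] by (simp only: d_def)
    have cases: "r \<ge> 3 \<and> 2 * r \<le> p * r \<or> r \<le> - 3 \<and> p * (r + 1) \<le> 2 * (r + 1)"
    proof (cases "r \<ge> 3")
      case True
      then show ?thesis using p mult_right_mono[of 2 p r] by simp
    next
      case False
      then show ?thesis using p r mult_right_mono_neg[of 2 p "r + 1"] by simp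
    qed
    have "cand p X (Suc n) \<le> dp p X n k + \<bar>p * r + d + k\<bar>" if k: "k \<in> {0, 1}" for k
    proof -
      have k01: "0 \<le> k" "k \<le> 1" using k by auto
      from cases show ?thesis
      proof
        assume "r \<ge> 3 \<and> 2 * r \<le> p * r"
        moreover have "cand p X (Suc n) \<le> dp p X (Suc n) 0 + \<bar>r\<bar>"
          by (simp add: cand_def r_def del: dp.simps)
        moreover have "dp p X (Suc n) 0 \<le> 2 + d + dp p X n k + k"
          using dp[OF k, of 0] d by simp
        ultimately show ?thesis using d k01 by linarith
      next
        assume "r \<le> - 3 \<and> p * (r + 1) \<le> 2 * (r + 1)"
        then have r3: "r \<le> - 3" "p * r + p \<le> 2 * r + 2" by (simp_all add: algebra_simps)
        then have "\<bar>r + 1\<bar> = - r - 1" "\<bar>p * r + d + k\<bar> \<ge> p - 2 * r - 2 - d - k" by linarith+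
        moreover have "cand p X (Suc n) \<le> dp p X (Suc n) 1 + \<bar>r + 1\<bar>"
          by (simp add: cand_def r_def del: dp.simps)
        moreover have "dp p X (Suc n) 1 \<le> 2 + (p - d) + dp p X n k - k"
          using dp[OF k, of 1] d by simp
        ultimately show ?thesis using r3 by linarith
      qed
    qed
    from this[of 0] this[of 1] have "cand p X (Suc n) \<le> cand p X n"
      by (simp add: cand_def[of p X n] eq del: dp.simps)
    moreover have "\<bar>p * r + d\<bar> \<ge> 3"
      using cases
    proof
      assume "r \<le> - 3 \<and> p * (r + 1) \<le> 2 * (r + 1)"
      then have "r \<le> - 3" "p * r + p \<le> 2 * r + 2" by (simp_all add: algebra_simps)
      then show ?thesis using d by linarith
    qed (use d in linarith)
    ultimately show ?case using step.IH eq by simp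
  qed
  then show ?thesis ..
qed

text \<open>Whatever the range of \<open>u\<close>, its top position lies in the interval from
  \<open>m0\<close> to \<open>m1\<close> or is compared with an endpoint by
  \<open>cand_above\<close> or \<open>cand_below\<close>. In the first alternative of
  \<open>bot\<close> nothing lies below \<open>m0\<close>, because the walk has to reach both 0 and
  \<open>h\<close>.\<close>

lemma length_lower_bound:
  assumes p: "p \<ge> 2"
    and u: "ht u = h" "transl p u = of_int X * real p powi L"
    and L: "L \<le> min 0 h" "L = min 0 h \<or> \<not> int p dvd X"
    and top: "X div int p ^ m1 \<in> {0, - 1}"
    and bot: "int m0 = max 0 h - L \<or> \<bar>X div int p ^ m0\<bar> \<ge> 3"
    and B: "\<And>m. m0 \<le> m \<Longrightarrow> m \<le> m1 \<Longrightarrow> B \<le> cand (int p) X m"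
    and m01: "m0 \<le> m1"
  shows "B - \<bar>h\<bar> \<le> int (length u)"
proof -
  obtain h' lo hi D where sc: "scan u = (h', lo, hi, D)" by (metis prod_cases4)
  have p0: "p > 0" using p by simp
  note sp = scan_props[OF p0 sc]
  have h': "h' = h" using sp u by simp
  define S where "S = tail p D hi lo"
  have XS: "of_int X * real p powi L = of_int S * real p powi lo"
    using sp u tail_real[OF p0, of D lo hi] by (simp add: S_def)
  \<comment> \<open>A word that stays above \<open>L\<close> has a translation divisible by a higher
    power of p, so p would divide \<open>X\<close>; and every walk reaches
    \<open>min 0 h\<close>.\<close>
  have "lo \<le> L"
  proof (rule ccontr)
    assume "\<not> lo \<le> L"
    define e where "e = nat (lo - L)"
    have e: "lo = int e + L" "e > 0" using \<open>\<not> lo \<le> L\<close> by (auto simp: e_def)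
    have "real p powi lo = real p ^ e * real p powi L"
      unfolding e(1) using p0 by (subst power_int_add) auto
    then have "of_int X = (of_int (S * int p ^ e) :: real)" using XS p0 by simp
    then have "X = S * int p ^ e" by (simp only: of_int_eq_iff)
    then have "int p dvd X" using e(2) by simp
    moreover have "L \<noteq> min 0 h" using \<open>\<not> lo \<le> L\<close> sp h' by auto
    ultimately show False using L by simp
  qed
  define e where "e = nat (L - lo)"
  have e: "L = int e + lo" using \<open>lo \<le> L\<close> by (simp add: e_def)
  have "real p powi L = real p ^ e * real p powi lo"
    unfolding e using p0 by (subst power_int_add) auto
  then have "of_int S = (of_int (int p ^ e * X) :: real)" using XS p0 by (simp add: mult.commute)
  then have SX: "S = int p ^ e * X" by (simp only: of_int_eq_iff)
  define m where "m = nat (hi - L)"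
  have m: "hi = int m + L" using L sp by (simp add: m_def)
  define T where "T i = tail p D hi (lo + int i)" for i
  have T0: "T 0 = int p ^ e * X" using SX by (simp add: T_def S_def)
  have TN: "T (Suc (e + m)) = 0" by (simp add: T_def tail_beyond m e)
  have Tc: "T i - int p * T (Suc i) = D (lo + int i)" if "i \<le> e + m" for i
    using tail_rec[of "lo + int i" hi p D] that by (simp add: T_def m e algebra_simps)
  have "cand (int p) X m \<le> 2 * int m + (\<Sum>i\<le>e + m. \<bar>D (lo + int i)\<bar>)"
    using cand_bound[of "int p" T e X m] T0 TN p Tc by simp
  also have "(\<Sum>i\<le>e + m. \<bar>D (lo + int i)\<bar>) = (\<Sum>j=lo..hi. \<bar>D j\<bar>)"
    by (rule sum.reindex_bij_witness[of _ "\<lambda>j. nat (j - lo)" "\<lambda>i. lo + int i"])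
      (auto simp: m e)
  finally have "cand (int p) X m - \<bar>h\<bar> \<le> int (length u)"
    using sp h' m e by auto
  moreover have "B \<le> cand (int p) X m"
  proof -
    consider "m0 \<le> m \<and> m \<le> m1" | "m1 \<le> m" | "m \<le> m0" "\<bar>X div int p ^ m0\<bar> \<ge> 3"
      using bot sp h' m by fastforce
    then show ?thesis
    proof cases
      case 2
      then show ?thesis using cand_above[of "int p" X m1 m] top B[of m1] m01 p by linarith
    next
      case 3
      then show ?thesis using cand_below[of "int p" X m0 m] B[of m0] m01 p by linarith
    qed (use B in auto)
  qed
  ultimately show ?thesis by simp
qed

section \<open>A structured language for random access machines\<close>

text \<open>Register 0 is kept positive, so that \<open>Jump_if_pos 0\<close> is an unconditional jump. The guard of
  \<open>While c r b\<close> is computed by the command \<open>c\<close> into register \<open>r\<close>.\<close>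

datatype com =
    Skip
  | Do instr
  | Seq com com  (infixr \<open>;;\<close> 60)
  | If_pos nat com com
  | While com nat com
  | Test_empty nat nat nat

abbreviation "tick s \<equiv> s\<lparr>pc := Suc (pc s)\<rparr>"

fun straight :: "instr \<Rightarrow> bool" where
  "straight (Jump_if_pos _ _) = False"
| "straight (Jump_if_empty _ _ _) = False"
| "straight _ = True"

text \<open>In the big-step semantics the component \<open>pc\<close> counts the executed instructions.\<close>

inductive bigstep :: "com \<Rightarrow> config \<Rightarrow> config \<Rightarrow> bool" where
  Skip: "bigstep Skip s s"
| Do: "straight i \<Longrightarrow> bigstep (Do i) s (exec i s)"
| Seq: "bigstep a s s' \<Longrightarrow> bigstep b s' s'' \<Longrightarrow> bigstep (a ;; b) s s''"
| If_True: "reg s r > 0 \<Longrightarrow> bigstep a (tick s) s' \<Longrightarrow> bigstep (If_pos r a b) s s'"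
| If_False: "\<not> reg s r > 0 \<Longrightarrow> bigstep b (tick s) s' \<Longrightarrow> reg s' 0 > 0 \<Longrightarrow>
    bigstep (If_pos r a b) s (tick s')"
| While_False: "bigstep c s s' \<Longrightarrow> \<not> reg s' r > 0 \<Longrightarrow> reg s' 0 > 0 \<Longrightarrow>
    bigstep (While c r b) s (tick (tick s'))"
| While_True: "bigstep c s s1 \<Longrightarrow> reg s1 r > 0 \<Longrightarrow> bigstep b (tick s1) s2 \<Longrightarrow> reg s2 0 > 0 \<Longrightarrow>
    bigstep (While c r b) (tick s2) s' \<Longrightarrow> bigstep (While c r b) s s'"
| Test_empty: "i \<noteq> r \<Longrightarrow> bigstep (Test_empty r b i) s
    (s\<lparr>pc := pc s + (if arr s b (reg s i) = None then 2 else 3),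
       reg := (reg s)(r := of_bool (arr s b (reg s i) = None))\<rparr>)"

inductive_cases bigstep_SkipE: "bigstep Skip s s'"
inductive_cases bigstep_DoE: "bigstep (Do i) s s'"
inductive_cases bigstep_SeqE: "bigstep (a ;; b) s s'"
inductive_cases bigstep_IfE: "bigstep (If_pos r a b) s s'"
inductive_cases bigstep_Test_emptyE: "bigstep (Test_empty r b i) s s'"

section \<open>Compilation into jumps\<close>

fun csize :: "com \<Rightarrow> nat" where
  "csize Skip = 0"
| "csize (Do i) = 1"
| "csize (a ;; b) = csize a + csize b"
| "csize (If_pos r a b) = csize a + csize b + 2"
| "csize (While c r b) = csize c + csize b + 3"
| "csize (Test_empty r b i) = 3"

text \<open>Jumps are absolute, hence the start address \<open>k\<close>. The negative branch is
  laid out first because it is the positive test that jumps.\<close>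

fun code :: "nat \<Rightarrow> com \<Rightarrow> instr list" where
  "code k Skip = []"
| "code k (Do i) = [i]"
| "code k (a ;; b) = code k a @ code (k + csize a) b"
| "code k (If_pos r a b) =
     Jump_if_pos r (k + csize b + 2) # code (k + 1) b @
     Jump_if_pos 0 (k + csize b + 2 + csize a) # code (k + csize b + 2) a"
| "code k (While c r b) =
     code k c @ Jump_if_pos r (k + csize c + 2) # Jump_if_pos 0 (k + csize c + csize b + 3) #
     code (k + csize c + 2) b @ [Jump_if_pos 0 k]"
| "code k (Test_empty r b i) = [Const r 1, Jump_if_empty b i (k + 3), Const r 0]"

lemma length_code [simp]: "length (code k c) = csize c"
  by (induction c arbitrary: k) auto

lemma exec_straight_pc: "straight i \<Longrightarrow> pc (exec i s) = Suc (pc s)"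
  by (cases i) auto

lemma exec_straight_pc_upd: "straight i \<Longrightarrow> exec i (s\<lparr>pc := k\<rparr>) = (exec i s)\<lparr>pc := Suc k\<rparr>"
  by (cases i) auto

lemma bigstep_pc_mono: "bigstep c s s' \<Longrightarrow> pc s \<le> pc s'"
  by (induction rule: bigstep.induct) (auto simp: exec_straight_pc)

definition steps :: "instr list \<Rightarrow> nat \<Rightarrow> config \<Rightarrow> config \<Rightarrow> bool" where
  "steps P n s s' \<longleftrightarrow> (step P ^^ n) s = s'"

lemma steps_0: "steps P 0 s s"
  by (simp add: steps_def)

lemma steps_trans: "steps P m s s' \<Longrightarrow> steps P n s' s'' \<Longrightarrow> steps P (m + n) s s''"
  unfolding steps_def add.commute[of m n] by (simp add: funpow_add)

lemma steps_1:
  assumes "P = pre @ i # post" "pc s = length pre"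
  shows "steps P 1 s (exec i s)"
  using assms by (simp add: steps_def step_def halted_def)

lemma steps_cong: "steps P m s s' \<Longrightarrow> m = n \<Longrightarrow> s' = s'' \<Longrightarrow> steps P n s s''"
  by simp

text \<open>The ticks of the big-step rules are exactly the jumps inserted by \<open>code\<close>,
  so the difference of the clocks is the exact number of machine steps. As \<open>pc\<close> is a
  clock in one semantics and an address in the other, it is overwritten at both ends.\<close>

lemma code_correct:
  assumes "bigstep c s s'" "P = pre @ code (length pre) c @ post"
  shows "steps P (pc s' - pc s) (s\<lparr>pc := length pre\<rparr>) (s'\<lparr>pc := length pre + csize c\<rparr>)"
  using assms
proof (induction arbitrary: pre post rule: bigstep.induct)
  case (Skip s)
  then show ?case by (simp add: steps_0)
next
  case (Do i s)
  then show ?case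
    using steps_1[of P pre i post "s\<lparr>pc := length pre\<rparr>"]
    by (simp add: exec_straight_pc exec_straight_pc_upd)
next
  case (Seq a s s' b s'')
  have 1: "steps P (pc s' - pc s) (s\<lparr>pc := length pre\<rparr>) (s'\<lparr>pc := length pre + csize a\<rparr>)"
    using Seq.IH(1)[of pre "code (length pre + csize a) b @ post"] Seq.prems by simp
  have 2: "steps P (pc s'' - pc s') (s'\<lparr>pc := length pre + csize a\<rparr>)
      (s''\<lparr>pc := length pre + csize a + csize b\<rparr>)"
    using Seq.IH(2)[of "pre @ code (length pre) a" post] Seq.prems by simp
  show ?case
    using steps_trans[OF 1 2] bigstep_pc_mono[OF Seq.hyps(1)] bigstep_pc_mono[OF Seq.hyps(2)]
    by (simp add: add.assoc)
next
  case (If_True s r a s' b)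
  let ?k = "length pre"
  have 1: "steps P 1 (s\<lparr>pc := ?k\<rparr>) (s\<lparr>pc := ?k + csize b + 2\<rparr>)"
    using steps_1[OF If_True.prems[unfolded code.simps append_Cons], of "s\<lparr>pc := ?k\<rparr>"] If_True.hyps
    by simp
  have 2: "steps P (pc s' - Suc (pc s)) (s\<lparr>pc := ?k + csize b + 2\<rparr>)
      (s'\<lparr>pc := ?k + csize b + 2 + csize a\<rparr>)"
    using If_True.IH[of "pre @ Jump_if_pos r (?k + csize b + 2) # code (?k + 1) b @
      [Jump_if_pos 0 (?k + csize b + 2 + csize a)]" post] If_True.prems by (simp add: add_ac)
  show ?case
    using steps_trans[OF 1 2] bigstep_pc_mono[OF If_True.hyps(2)]
    by (elim steps_cong) auto
next
  case (If_False s r b s' a)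
  let ?k = "length pre"
  have 1: "steps P 1 (s\<lparr>pc := ?k\<rparr>) (s\<lparr>pc := Suc ?k\<rparr>)"
    using steps_1[OF If_False.prems[unfolded code.simps append_Cons], of "s\<lparr>pc := ?k\<rparr>"] If_False.hyps
    by simp
  have 2: "steps P (pc s' - Suc (pc s)) (s\<lparr>pc := Suc ?k\<rparr>) (s'\<lparr>pc := Suc ?k + csize b\<rparr>)"
    using If_False.IH[of "pre @ [Jump_if_pos r (?k + csize b + 2)]"
      "Jump_if_pos 0 (?k + csize b + 2 + csize a) # code (?k + csize b + 2) a @ post"]
      If_False.prems by simp
  have 3: "steps P 1 (s'\<lparr>pc := Suc ?k + csize b\<rparr>) (s'\<lparr>pc := ?k + csize b + 2 + csize a\<rparr>)"
    using steps_1[of P "pre @ Jump_if_pos r (?k + csize b + 2) # code (?k + 1) b"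
        "Jump_if_pos 0 (?k + csize b + 2 + csize a)" "code (?k + csize b + 2) a @ post"
        "s'\<lparr>pc := Suc ?k + csize b\<rparr>"] If_False.prems If_False.hyps
    by simp
  show ?case
    using steps_trans[OF steps_trans[OF 1 2] 3] bigstep_pc_mono[OF If_False.hyps(2)]
    by (elim steps_cong) auto
next
  case (While_False c s s' r b)
  let ?k = "length pre" and ?c = "code (length pre) c"
  let ?j1 = "Jump_if_pos r (?k + csize c + 2)" and ?j2 = "Jump_if_pos 0 (?k + csize c + csize b + 3)"
  let ?rest = "code (?k + csize c + 2) b @ Jump_if_pos 0 ?k # post"
  have P: "P = pre @ ?c @ ?j1 # ?j2 # ?rest" using While_False.prems by simp
  have 1: "steps P (pc s' - pc s) (s\<lparr>pc := ?k\<rparr>) (s'\<lparr>pc := ?k + csize c\<rparr>)"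
    using While_False.IH[of pre "?j1 # ?j2 # ?rest"] P by simp
  have 2: "steps P 1 (s'\<lparr>pc := ?k + csize c\<rparr>) (s'\<lparr>pc := ?k + csize c + 1\<rparr>)"
    using steps_1[of P "pre @ ?c" ?j1 "?j2 # ?rest" "s'\<lparr>pc := ?k + csize c\<rparr>"] P While_False.hyps
    by simp
  have 3: "steps P 1 (s'\<lparr>pc := ?k + csize c + 1\<rparr>) (s'\<lparr>pc := ?k + csize c + csize b + 3\<rparr>)"
    using steps_1[of P "pre @ ?c @ [?j1]" ?j2 ?rest "s'\<lparr>pc := ?k + csize c + 1\<rparr>"] P While_False.hyps
    by simp
  show ?case
    using steps_trans[OF steps_trans[OF 1 2] 3] bigstep_pc_mono[OF While_False.hyps(1)]
    by (elim steps_cong) auto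
next
  case (While_True c s s1 r b s2 s')
  let ?k = "length pre" and ?c = "code (length pre) c"
  let ?j1 = "Jump_if_pos r (?k + csize c + 2)" and ?j2 = "Jump_if_pos 0 (?k + csize c + csize b + 3)"
  let ?b = "code (?k + csize c + 2) b"
  have P: "P = pre @ ?c @ ?j1 # ?j2 # ?b @ Jump_if_pos 0 ?k # post" using While_True.prems by simp
  have 1: "steps P (pc s1 - pc s) (s\<lparr>pc := ?k\<rparr>) (s1\<lparr>pc := ?k + csize c\<rparr>)"
    using While_True.IH(1)[of pre "?j1 # ?j2 # ?b @ Jump_if_pos 0 ?k # post"] P by simp
  have 2: "steps P 1 (s1\<lparr>pc := ?k + csize c\<rparr>) (s1\<lparr>pc := ?k + csize c + 2\<rparr>)"
    using steps_1[of P "pre @ ?c" ?j1 "?j2 # ?b @ Jump_if_pos 0 ?k # post" "s1\<lparr>pc := ?k + csize c\<rparr>"]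
      P While_True.hyps by simp
  have 3: "steps P (pc s2 - Suc (pc s1)) (s1\<lparr>pc := ?k + csize c + 2\<rparr>)
      (s2\<lparr>pc := ?k + csize c + 2 + csize b\<rparr>)"
    using While_True.IH(2)[of "pre @ ?c @ [?j1, ?j2]" "Jump_if_pos 0 ?k # post"] P
    by simp
  have 4: "steps P 1 (s2\<lparr>pc := ?k + csize c + 2 + csize b\<rparr>) (s2\<lparr>pc := ?k\<rparr>)"
    using steps_1[of P "pre @ ?c @ ?j1 # ?j2 # ?b" "Jump_if_pos 0 ?k" post
        "s2\<lparr>pc := ?k + csize c + 2 + csize b\<rparr>"] P While_True.hyps by simp
  have 5: "steps P (pc s' - Suc (pc s2)) (s2\<lparr>pc := ?k\<rparr>)
      (s'\<lparr>pc := ?k + csize (While c r b)\<rparr>)"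
    using While_True.IH(3)[OF While_True.prems] by simp
  have "pc s \<le> pc s1" "Suc (pc s1) \<le> pc s2" "Suc (pc s2) \<le> pc s'"
    using While_True.hyps(1,3,5)[THEN bigstep_pc_mono] by auto
  then show ?case
    using steps_trans[OF steps_trans[OF steps_trans[OF steps_trans[OF 1 2] 3] 4] 5]
    by (elim steps_cong) auto
next
  case (Test_empty i r b s)
  let ?k = "length pre"
  have 1: "steps P 1 (s\<lparr>pc := ?k\<rparr>) (s\<lparr>pc := ?k + 1, reg := (reg s)(r := 1)\<rparr>)"
    using steps_1[OF Test_empty.prems[unfolded code.simps append_Cons], of "s\<lparr>pc := ?k\<rparr>"]
    by simp
  have 2: "steps P 1 (s\<lparr>pc := ?k + 1, reg := (reg s)(r := 1)\<rparr>)
     (s\<lparr>pc := if arr s b (reg s i) = None then ?k + 3 else ?k + 2, reg := (reg s)(r := 1)\<rparr>)"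
    by (rule steps_cong[OF steps_1[of P "pre @ [Const r 1]" "Jump_if_empty b i (?k + 3)" "Const r 0 # post"
        "s\<lparr>pc := ?k + 1, reg := (reg s)(r := 1)\<rparr>"]]) (use Test_empty in simp_all)
  show ?case
  proof (cases "arr s b (reg s i) = None")
    case True
    then show ?thesis
      using steps_trans[OF 1 2] by (elim steps_cong) auto
  next
    case False
    have 3: "steps P 1 (s\<lparr>pc := ?k + 2, reg := (reg s)(r := 1)\<rparr>)
        (s\<lparr>pc := ?k + 3, reg := (reg s)(r := 0)\<rparr>)"
      by (rule steps_cong[OF steps_1[of P "pre @ [Const r 1, Jump_if_empty b i (?k + 3)]" "Const r 0" post
          "s\<lparr>pc := ?k + 2, reg := (reg s)(r := 1)\<rparr>"]]) (use Test_empty in simp_all)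
    have 2: "steps P 1 (s\<lparr>pc := ?k + 1, reg := (reg s)(r := 1)\<rparr>) (s\<lparr>pc := ?k + 2, reg := (reg s)(r := 1)\<rparr>)"
      using 2 False by simp
    show ?thesis
      by (rule steps_cong[OF steps_trans[OF steps_trans[OF 1 2] 3]]) (use False in auto)
  qed
qed

section \<open>Weakest preconditions and frames\<close>

definition wp :: "com \<Rightarrow> (config \<Rightarrow> bool) \<Rightarrow> config \<Rightarrow> bool" where
  "wp c Q s \<longleftrightarrow> (\<exists>s'. bigstep c s s' \<and> Q s')"

lemma wp_mono: "wp c Q s \<Longrightarrow> (\<And>s'. Q s' \<Longrightarrow> R s') \<Longrightarrow> wp c R s"
  by (auto simp: wp_def)

lemma wp_Skip [simp]: "wp Skip Q s \<longleftrightarrow> Q s"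
  by (auto simp: wp_def intro: bigstep.intros elim: bigstep_SkipE)

lemma wp_Do [simp]: "wp (Do i) Q s \<longleftrightarrow> straight i \<and> Q (exec i s)"
  by (auto simp: wp_def intro: bigstep.intros elim: bigstep_DoE)

lemma wp_Seq [simp]: "wp (a ;; b) Q s \<longleftrightarrow> wp a (wp b Q) s"
  unfolding wp_def by (blast intro: bigstep.Seq elim: bigstep_SeqE)

lemma wp_If [simp]: "wp (If_pos r a b) Q s \<longleftrightarrow>
    (if reg s r > 0 then wp a Q (tick s) else wp b (\<lambda>s. reg s 0 > 0 \<and> Q (tick s)) (tick s))"
  by (auto simp: wp_def intro: bigstep.intros elim!: bigstep_IfE)

lemma wp_Test_empty [simp]: "i \<noteq> r \<Longrightarrow> wp (Test_empty r b i) Q s \<longleftrightarrow>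
    Q (s\<lparr>pc := pc s + (if arr s b (reg s i) = None then 2 else 3),
       reg := (reg s)(r := of_bool (arr s b (reg s i) = None))\<rparr>)"
  by (auto simp: wp_def intro: bigstep.intros elim!: bigstep_Test_emptyE)

fun wregs :: "com \<Rightarrow> nat set" where
  "wregs Skip = {}"
| "wregs (Do (Const r _)) = {r}"
| "wregs (Do (Add r _ _)) = {r}"
| "wregs (Do (Sub r _ _)) = {r}"
| "wregs (Do (Load r _ _)) = {r}"
| "wregs (Do _) = {}"
| "wregs (a ;; b) = wregs a \<union> wregs b"
| "wregs (If_pos r a b) = wregs a \<union> wregs b"
| "wregs (While c r b) = wregs c \<union> wregs b"
| "wregs (Test_empty r _ _) = {r}"

fun warrs :: "com \<Rightarrow> nat set" where
  "warrs (Do (Store b _ _)) = {b}"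
| "warrs (Do (Delete b _)) = {b}"
| "warrs (a ;; b) = warrs a \<union> warrs b"
| "warrs (If_pos r a b) = warrs a \<union> warrs b"
| "warrs (While c r b) = warrs c \<union> warrs b"
| "warrs _ = {}"

definition agree :: "com \<Rightarrow> config \<Rightarrow> config \<Rightarrow> bool" where
  "agree c s s' \<longleftrightarrow> (\<forall>r. r \<notin> wregs c \<longrightarrow> reg s' r = reg s r) \<and> (\<forall>b. b \<notin> warrs c \<longrightarrow> arr s' b = arr s b)"

lemma agree_refl: "agree c s s"
  by (simp add: agree_def)

lemma agree_trans: "agree c s s' \<Longrightarrow> agree c s' s'' \<Longrightarrow> agree c s s''"
  by (simp add: agree_def)

lemma agree_reg: "agree c s s' \<Longrightarrow> r \<notin> wregs c \<Longrightarrow> reg s' r = reg s r"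
  by (simp add: agree_def)

lemma agree_arr: "agree c s s' \<Longrightarrow> b \<notin> warrs c \<Longrightarrow> arr s' b = arr s b"
  by (simp add: agree_def)

lemma bigstep_agree: "bigstep c s s' \<Longrightarrow> agree c s s'"
proof (induction rule: bigstep.induct)
  case (Do i s)
  then show ?case by (cases i) (auto simp: agree_def)
qed (auto simp: agree_def)

text \<open>Allows specifications to mention only what a command changes: everything it does not
  write is recovered from its text.\<close>

lemma wp_frame:
  assumes "wp c Q s" "\<And>s'. Q s' \<Longrightarrow> agree c s s' \<Longrightarrow> pc s \<le> pc s' \<Longrightarrow> R s'"
  shows "wp c R s"
  using assms bigstep_agree bigstep_pc_mono by (fastforce simp: wp_def)

text \<open>Termination follows from the time bound \<open>T\<close> in the invariant, since each round takes time.\<close>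

lemma wp_While:
  assumes "I s0"
    and T: "\<And>s. I s \<Longrightarrow> pc s \<le> T"
    and step: "\<And>s. I s \<Longrightarrow> agree (While c r b) s0 s \<Longrightarrow>
      wp c (\<lambda>s1. reg s1 0 > 0 \<and> (if reg s1 r > 0 then wp b (\<lambda>s2. reg s2 0 > 0 \<and> I (tick s2)) (tick s1)
        else Q (tick (tick s1)))) s"
  shows "wp (While c r b) Q s0"
proof -
  have "wp (While c r b) Q s" if "I s" "agree (While c r b) s0 s" for s
    using that
  proof (induction "T - pc s" arbitrary: s rule: less_induct)
    case less
    obtain s1 where s1: "bigstep c s s1" "reg s1 0 > 0"
      "if reg s1 r > 0 then wp b (\<lambda>s2. reg s2 0 > 0 \<and> I (tick s2)) (tick s1) else Q (tick (tick s1))"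
      using step[OF less.prems] by (auto simp: wp_def)
    show ?case
    proof (cases "reg s1 r > 0")
      case True
      then obtain s2 where s2: "bigstep b (tick s1) s2" "reg s2 0 > 0" "I (tick s2)"
        using s1 by (auto simp: wp_def)
      have "pc s < pc (tick s2)"
        using bigstep_pc_mono[OF s1(1)] bigstep_pc_mono[OF s2(1)] by simp
      moreover have "pc (tick s2) \<le> T" using T[OF s2(3)] .
      moreover have "agree (While c r b) s (tick s2)"
        using bigstep_agree[OF s1(1)] bigstep_agree[OF s2(1)] by (auto simp: agree_def)
      ultimately have "wp (While c r b) Q (tick s2)"
        using less.prems s2(3) by (intro less.hyps agree_trans[OF less.prems(2)]) auto
      then show ?thesis
        using s1 s2 True by (auto simp: wp_def intro: While_True)
    next
      case False
      then show ?thesis using s1 by (auto simp: wp_def intro: While_False)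
    qed
  qed
  then show ?thesis using assms(1) agree_refl by blast
qed

section \<open>Bounds on the size of entries and on space\<close>

text \<open>The registers in \<open>K\<close> hold constants, and sums of two non-constant values may only be written to
  the registers in \<open>W\<close>, which never enter arrays or other registers. Hence values grow at most
  linearly with time.\<close>

fun tame :: "nat set \<Rightarrow> nat set \<Rightarrow> int \<Rightarrow> instr \<Rightarrow> bool" where
  "tame K W B (Const r z) \<longleftrightarrow> \<bar>z\<bar> \<le> B"
| "tame K W B (Add r x y) \<longleftrightarrow> r \<notin> K \<and> ((x \<in> K \<or> y \<in> K) \<and> x \<notin> W \<and> y \<notin> W \<or>
      r \<in> W \<and> (x \<in> K \<or> y \<in> K \<or> x \<notin> W \<and> y \<notin> W))"
| "tame K W B (Sub r x y) \<longleftrightarrow> r \<notin> K \<and> ((x \<in> K \<or> y \<in> K) \<and> x \<notin> W \<and> y \<notin> W \<or>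
      r \<in> W \<and> (x \<in> K \<or> y \<in> K \<or> x \<notin> W \<and> y \<notin> W))"
| "tame K W B (Load r b i) \<longleftrightarrow> r \<notin> K"
| "tame K W B (Store b i v) \<longleftrightarrow> v \<notin> W"
| "tame K W B _ \<longleftrightarrow> True"

fun ctame :: "nat set \<Rightarrow> nat set \<Rightarrow> int \<Rightarrow> com \<Rightarrow> bool" where
  "ctame K W B Skip \<longleftrightarrow> True"
| "ctame K W B (Do i) \<longleftrightarrow> tame K W B i"
| "ctame K W B (a ;; b) \<longleftrightarrow> ctame K W B a \<and> ctame K W B b"
| "ctame K W B (If_pos r a b) \<longleftrightarrow> ctame K W B a \<and> ctame K W B b"
| "ctame K W B (While c r b) \<longleftrightarrow> ctame K W B c \<and> ctame K W B b"
| "ctame K W B (Test_empty r b i) \<longleftrightarrow> B \<ge> 1"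

lemma ctame_code: "ctame K W B c \<Longrightarrow> i \<in> set (code k c) \<Longrightarrow> tame K W B i"
  by (induction c arbitrary: k) auto

text \<open>A register in \<open>W\<close> may receive the sum of two ordinary values, hence the
  factor 2.\<close>

definition small :: "nat set \<Rightarrow> nat set \<Rightarrow> int \<Rightarrow> int \<Rightarrow> config \<Rightarrow> bool" where
  "small K W B m s \<longleftrightarrow> B \<le> m \<and>
     (\<forall>r. \<bar>reg s r\<bar> \<le> (if r \<in> K then B else if r \<in> W then 2 * m else m)) \<and>
     (\<forall>b i z. arr s b i = Some z \<longrightarrow> \<bar>z\<bar> \<le> m)"

lemma small_mono: "small K W B m s \<Longrightarrow> m \<le> m' \<Longrightarrow> small K W B m' s"
  unfolding small_def by (smt (verit, best))

lemma small_le: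
  assumes "small K W B m s" "2 * m \<le> M" "0 \<le> B"
  shows "\<bar>reg s r\<bar> \<le> M" "arr s b i = Some z \<Longrightarrow> \<bar>z\<bar> \<le> M"
proof -
  have m: "0 \<le> m" "B \<le> m" using assms by (auto simp: small_def)
  have "\<bar>reg s r\<bar> \<le> (if r \<in> K then B else if r \<in> W then 2 * m else m)"
    using assms(1) by (simp only: small_def)
  then show "\<bar>reg s r\<bar> \<le> M" using m assms(2) by (simp split: if_splits)
  show "\<bar>z\<bar> \<le> M" if "arr s b i = Some z"
  proof -
    have "\<bar>z\<bar> \<le> m" using assms(1) that by (simp only: small_def)
    then show ?thesis using m assms(2) by simp
  qed
qed

text \<open>An ordinary register receives at most one constant on top of an ordinary value. A
  register in \<open>W\<close> receives two ordinary values, at most \<open>2 * m\<close>, or its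
  like plus a constant, at most \<open>2 * m + B\<close>. So \<open>m\<close> need only grow by
  \<open>B\<close> per step.\<close>

lemma small_exec:
  assumes "small K W B m s" "tame K W B i" "K \<inter> W = {}" "0 \<le> B"
  shows "small K W B (m + B) (exec i s)"
proof -
  have r: "\<bar>reg s r\<bar> \<le> (if r \<in> K then B else if r \<in> W then 2 * m else m)" for r
    using assms(1) by (auto simp: small_def)
  have Bm: "B \<le> m" using assms(1) by (simp add: small_def)
  have upd: "small K W B (m + B) (s\<lparr>pc := k, reg := (reg s)(r := z)\<rparr>)"
    if "\<bar>z\<bar> \<le> (if r \<in> K then B else if r \<in> W then 2 * (m + B) else m + B)" for k r z
  proof -
    have "small K W B (m + B) s" using small_mono[OF assms(1), of "m + B"] assms(4) by simp
    then have *: "B \<le> m + B" "\<And>r. \<bar>reg s r\<bar> \<le> (if r \<in> K then B else if r \<in> W then 2 * (m + B) else m + B)"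
      "\<And>b i z. arr s b i = Some z \<Longrightarrow> \<bar>z\<bar> \<le> m + B"
      unfolding small_def by blast+
    show ?thesis
      unfolding small_def
    proof (intro conjI allI impI)
      fix r'
      show "\<bar>reg (s\<lparr>pc := k, reg := (reg s)(r := z)\<rparr>) r'\<bar>
          \<le> (if r' \<in> K then B else if r' \<in> W then 2 * (m + B) else m + B)"
        using *(2)[of r'] that by (cases "r' = r") (auto split: if_splits)
    qed (use * in simp_all)
  qed
  show ?thesis
  proof (cases i)
    case (Add x1 x2 x3)
    then show ?thesis
      using assms r[of x2] r[of x3] Bm by (auto intro!: upd split: if_splits)
  next
    case (Sub x1 x2 x3)
    then show ?thesis
      using assms r[of x2] r[of x3] Bm by (auto intro!: upd split: if_splits)
  next
    case (Const x1 x2)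
    then show ?thesis
      using assms Bm by (auto intro!: upd)
  next
    case (Load x1 x2 x3)
    have "\<bar>case arr s x2 (reg s x3) of None \<Rightarrow> 0 | Some z \<Rightarrow> z\<bar> \<le> m"
      using assms by (auto simp: small_def split: option.split)
    then show ?thesis
      using assms Load Bm by (auto intro!: upd)
  next
    case (Store x1 x2 x3)
    have "\<bar>reg s x3\<bar> \<le> m" using assms r[of x3] Store by (auto simp: small_def split: if_splits)
    then show ?thesis
      using small_mono[OF assms(1), of "m + B"] assms(4) Store by (auto simp: small_def)
  next
    case (Delete x1 x2)
    then show ?thesis
      using small_mono[OF assms(1), of "m + B"] assms(4) by (auto simp: small_def)
  qed (use small_mono[OF assms(1), of "m + B"] assms(4) in \<open>auto simp: small_def\<close>)
qed

lemma small_step: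
  assumes "small K W B m s" "\<forall>i\<in>set P. tame K W B i" "K \<inter> W = {}" "0 \<le> B"
  shows "small K W B (m + B) (step P s)"
  using assms small_exec[OF assms(1) _ assms(3,4)] small_mono[OF assms(1), of "m + B"]
  by (auto simp: step_def halted_def)

lemma small_run:
  assumes "\<forall>i\<in>set P. tame K W B i" "K \<inter> W = {}" "0 \<le> B" "\<forall>xs\<in>set ins. \<forall>x\<in>set xs. \<bar>x\<bar> \<le> B"
  shows "small K W B (B * int (Suc n)) (run P ins n)"
proof (induction n)
  case 0
  have "\<bar>z\<bar> \<le> B" if "arr (init ins) b i = Some z" for b i z
  proof -
    have "1 \<le> b" "b \<le> length ins" "array_of (ins ! (b - 1)) i = Some z"
      using that by (auto simp: init_def split: if_splits)
    then have "ins ! (b - 1) \<in> set ins" "z \<in> set (ins ! (b - 1))"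
      by (auto simp: array_of_def split: if_splits)
    then show ?thesis using assms(4) by blast
  qed
  then show ?case using assms(3) by (auto simp: small_def run_def) (simp_all add: init_def)
next
  case (Suc n)
  have "B * int (Suc n) + B = B * int (Suc (Suc n))" by (simp add: algebra_simps)
  then show ?case
    using small_step[OF Suc assms(1-3)] by (simp only: run_def funpow.simps o_apply)
qed

lemma run_halted:
  assumes "halted P (run P ins j)" "j \<le> n"
  shows "run P ins n = run P ins j"
  using assms(2)
proof (induction n rule: dec_induct)
  case (step n)
  then show ?case using assms(1) by (simp add: run_def step_def[of P "(step P ^^ j) (init ins)"])
qed simp

text \<open>Bounds for all times reduce to bounds up to the halting time.\<close>

lemma run_reduce:
  assumes "halted P (run P ins j)"
  shows "\<exists>i\<le>j. run P ins n = run P ins i"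
proof (cases "j \<le> n")
  case True
  then show ?thesis using run_halted[OF assms True] by blast
next
  case False
  then show ?thesis by (intro exI[of _ n]) simp
qed

lemma entries_boundedI:
  assumes "\<forall>i\<in>set P. tame K W B i" "K \<inter> W = {}" "0 \<le> B"
    "\<forall>xs\<in>set ins. \<forall>x\<in>set xs. \<bar>x\<bar> \<le> B"
    and h: "halted P (run P ins j)" "j \<le> T" and m: "2 * B * int (Suc T) \<le> int m"
  shows "entries_bounded P ins m"
  unfolding entries_bounded_def
proof
  fix k
  obtain i where i: "i \<le> j" "run P ins k = run P ins i" using run_reduce[OF h(1)] by blast
  have "B * int (Suc i) \<le> B * int (Suc T)" using i h assms(3) by (intro mult_left_mono) auto
  then have "small K W B (B * int (Suc T)) (run P ins k)"
    using small_run[where ins = ins and n = i, OF assms(1-4)] i(2) by (simp only: small_mono)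
  moreover have "2 * (B * int (Suc T)) \<le> int m" using m by (simp only: mult.assoc)
  moreover have "B \<le> B * int (Suc T)" using assms(3) by (simp add: mult_le_cancel_left1)
  ultimately show "(\<forall>r. \<bar>reg (run P ins k) r\<bar> \<le> int m) \<and>
      (\<forall>b i z. arr (run P ins k) b i = Some z \<longrightarrow> \<bar>z\<bar> \<le> int m)"
    using small_le[of K W B "B * int (Suc T)" "run P ins k" "int m"] assms(3) by simp
qed


section \<open>Space in bits\<close>

fun instr_regs :: "instr \<Rightarrow> nat set" where
  "instr_regs (Const r _) = {r}"
| "instr_regs (Add r _ _) = {r}"
| "instr_regs (Sub r _ _) = {r}"
| "instr_regs (Load r _ _) = {r}"
| "instr_regs _ = {}"

lemma finite_instr_regs: "finite (instr_regs i)"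
  by (cases i) auto

definition cells :: "config \<Rightarrow> (nat \<times> int) set" where
  "cells s = {(b, i). arr s b i \<noteq> None}"

text \<open>At most one cell becomes occupied per step, and its index was the content of a register.
  Hence time bounds the number of cells, and the bound on entries also bounds their indices.\<close>

lemma cells_exec: "\<exists>c. cells (exec i s) \<subseteq> insert c (cells s) \<and> (\<exists>r. snd c = reg s r)"
proof (cases i)
  case (Store b j v)
  then show ?thesis by (intro exI[of _ "(b, reg s j)"]) (auto simp: cells_def split: if_splits)
next
  case (Delete b j)
  then show ?thesis by (intro exI[of _ "(b, reg s j)"]) (auto simp: cells_def split: if_splits)
qed (intro exI[of _ "(0, reg s 0)"], auto simp: cells_def)+

lemma cells_init: "finite (cells (init ins)) \<and> card (cells (init ins)) \<le> input_size ins \<and>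
  (\<forall>c\<in>cells (init ins). \<bar>snd c\<bar> \<le> int (input_size ins))"
proof -
  define S where "S = (SIGMA b:{1..length ins}. {0..<int (length (ins ! (b - 1)))})"
  have sub: "cells (init ins) \<subseteq> S"
    by (auto simp: cells_def init_def array_of_def S_def split: if_splits)
  have fin: "finite S" by (simp add: S_def)
  have "card S = (\<Sum>b=1..length ins. length (ins ! (b - 1)))" by (simp add: S_def card_SigmaI)
  also have "\<dots> = (\<Sum>b<length ins. length (ins ! b))"
    by (rule sum.reindex_bij_witness[of _ Suc "\<lambda>b. b - 1"]) auto
  also have "\<dots> = input_size ins"
    by (simp add: input_size_def sum_list_sum_nth atLeast0LessThan)
  finally have "card S = input_size ins" .
  moreover have "\<bar>snd c\<bar> \<le> int (input_size ins)" if "c \<in> S" for c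
  proof -
    have b: "fst c - 1 < length ins" "0 \<le> snd c" "snd c < int (length (ins ! (fst c - 1)))"
      using that by (auto simp: S_def)
    have "length (ins ! (fst c - 1)) \<le> input_size ins"
      unfolding input_size_def using b(1) by (intro member_le_sum_list) auto
    then show ?thesis using b by linarith
  qed
  ultimately show ?thesis using sub card_mono[OF fin sub] finite_subset[OF sub fin] by auto
qed

lemma run_space_inv:
  assumes "\<And>k r. k \<le> n \<Longrightarrow> \<bar>reg (run P ins k) r\<bar> \<le> int m"
  shows "finite (cells (run P ins n)) \<and> card (cells (run P ins n)) \<le> input_size ins + n \<and>
    (\<forall>c\<in>cells (run P ins n). \<bar>snd c\<bar> \<le> int (max (input_size ins) m)) \<and>
    {r. reg (run P ins n) r \<noteq> 0} \<subseteq> (\<Union>i\<in>set P. instr_regs i)"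
  using assms
proof (induction n)
  case 0
  have "run P ins 0 = init ins" "{r. reg (init ins) r \<noteq> 0} = {}"
    by (simp_all add: run_def) (simp add: init_def)
  then show ?case using cells_init[of ins] by (auto simp: max_def)
next
  case (Suc n)
  let ?s = "run P ins n"
  have IH: "finite (cells ?s)" "card (cells ?s) \<le> input_size ins + n"
    "\<And>c. c \<in> cells ?s \<Longrightarrow> \<bar>snd c\<bar> \<le> int (max (input_size ins) m)"
    "{r. reg ?s r \<noteq> 0} \<subseteq> (\<Union>i\<in>set P. instr_regs i)"
    using Suc.IH Suc.prems by auto
  show ?case
  proof (cases "halted P ?s")
    case True
    then have "run P ins (Suc n) = ?s" by (simp add: run_def step_def)
    then show ?thesis using IH by simp
  next
    case False
    define i where "i = P ! pc ?s"
    have i: "i \<in> set P" "run P ins (Suc n) = exec i ?s"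
      using False by (auto simp: i_def run_def step_def halted_def)
    obtain c r where c: "cells (exec i ?s) \<subseteq> insert c (cells ?s)" "snd c = reg ?s r"
      using cells_exec by blast
    have "finite (cells (exec i ?s))" using c IH finite_subset by blast
    moreover have "card (cells (exec i ?s)) \<le> Suc (card (cells ?s))"
    proof -
      have "card (cells (exec i ?s)) \<le> card (insert c (cells ?s))"
        using IH(1) c(1) by (intro card_mono) auto
      then show ?thesis using IH(1) by (simp add: card_insert_if split: if_splits)
    qed
    moreover have "\<bar>snd c\<bar> \<le> int (max (input_size ins) m)"
      using Suc.prems[of n r] c(2) by simp
    moreover have "{r. reg (exec i ?s) r \<noteq> 0} \<subseteq> {r. reg ?s r \<noteq> 0} \<union> instr_regs i"
      by (cases i) auto
    ultimately show ?thesis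
      unfolding i(2) using IH c(1) i(1) by (intro conjI ballI) (simp, simp, blast, blast)
  qed
qed

lemma bits_mono: "\<bar>x\<bar> \<le> int m \<Longrightarrow> bits x \<le> floorlog 2 m + 1"
  unfolding bits_def using floorlog_mono[of "nat \<bar>x\<bar>" m 2] by simp

lemma space_withinI:
  assumes eb: "entries_bounded P ins m" and h: "halted P (run P ins T)" and m: "input_size ins \<le> m"
  shows "space_within P ins
    ((card (\<Union>i\<in>set P. instr_regs i) + 2 * (input_size ins + T)) * (floorlog 2 m + 1))"
  unfolding space_within_def
proof
  fix k
  let ?R = "\<Union>i\<in>set P. instr_regs i" and ?b = "floorlog 2 m + 1"
  obtain i where i: "i \<le> T" "run P ins k = run P ins i" using run_reduce[OF h] by blast
  let ?s = "run P ins i"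
  have reg: "\<bar>reg ?s r\<bar> \<le> int m" and arr: "arr ?s b j = Some z \<Longrightarrow> \<bar>z\<bar> \<le> int m" for r b j z
    using eb by (auto simp: entries_bounded_def)
  have inv: "finite (cells ?s)" "card (cells ?s) \<le> input_size ins + i"
    "\<And>c. c \<in> cells ?s \<Longrightarrow> \<bar>snd c\<bar> \<le> int m" "{r. reg ?s r \<noteq> 0} \<subseteq> ?R"
    using run_space_inv[of i P ins m] eb m by (auto simp: entries_bounded_def max_def)
  have "(\<Sum>r | reg ?s r \<noteq> 0. bits (reg ?s r)) \<le> card {r. reg ?s r \<noteq> 0} * ?b"
    using sum_bounded_above[of "{r. reg ?s r \<noteq> 0}" "\<lambda>r. bits (reg ?s r)" ?b] reg bits_mono by simp
  also have "\<dots> \<le> card ?R * ?b"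
    using inv(4) finite_instr_regs by (intro mult_right_mono card_mono) auto
  finally have 1: "(\<Sum>r | reg ?s r \<noteq> 0. bits (reg ?s r)) \<le> card ?R * ?b" .
  have "(\<Sum>(b, j)\<in>cells ?s. bits j + bits (the (arr ?s b j))) \<le> card (cells ?s) * (2 * ?b)"
    using sum_bounded_above[of "cells ?s" "\<lambda>(b, j). bits j + bits (the (arr ?s b j))" "2 * ?b"]
  proof (simp, elim meta_mp, clarify)
    fix b j assume bj: "(b, j) \<in> cells ?s"
    then have "bits j \<le> ?b" using inv(3) bits_mono by fastforce
    moreover have "bits (the (arr ?s b j)) \<le> ?b"
      using bj arr by (intro bits_mono) (auto simp: cells_def)
    ultimately show "bits j + bits (the (arr ?s b j)) \<le> Suc (Suc (2 * floorlog 2 m))" by simp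
  qed
  also have "\<dots> \<le> (input_size ins + T) * (2 * ?b)"
    using inv(2) i(1) by (intro mult_right_mono) auto
  finally have 2: "(\<Sum>(b, j)\<in>cells ?s. bits j + bits (the (arr ?s b j)))
      \<le> (input_size ins + T) * (2 * ?b)" .
  show "config_space (run P ins k) \<le> (card ?R + 2 * (input_size ins + T)) * ?b"
    unfolding i(2) config_space_def using 1 2 by (simp add: cells_def algebra_simps)
qed

section \<open>The program\<close>

text \<open>
  Arrays: 0 output, 1 word, 2 integer, 3 digits, 4 and 5 the values \<open>dp p X m 0\<close> and \<open>dp p X m 1\<close>.
  Registers: 0, 2, 3, 25 hold the constants 1, 0, p, 3; 4, 5, 6 the final, minimal and maximal height;
  7 the reading position; 10 and 24 heights; 13 the top position of the digit expansion;
  14 its lowest position \<open>L\<close>; 16 is \<open>max 0 h\<close>; 19 the quotient at the height in 24; 20 to 23 the cost, the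
  top position, the top digit and the incoming carry of the best expansion found so far; 26 the
  output length; 27 to 32 symbols, direction and counters of the output phase; 37 to 39 belong to the
  reader of the binary integer. The others are temporary.
\<close>

definition val :: "int option \<Rightarrow> int" where
  "val c = (case c of None \<Rightarrow> 0 | Some z \<Rightarrow> z)"

lemma val_simps [simp]: "val None = 0" "val (Some z) = z"
  by (simp_all add: val_def)

lemma load_val [simp]: "(case c of None \<Rightarrow> 0 | Some z \<Rightarrow> z) = val c"
  by (simp add: val_def)

definition consts_ok :: "nat \<Rightarrow> config \<Rightarrow> bool" where
  "consts_ok p s \<longleftrightarrow> reg s 0 = 1 \<and> reg s 2 = 0 \<and> reg s 3 = int p \<and> reg s 25 = 3"

lemma consts_ok_agree:
  "agree c s s' \<Longrightarrow> consts_ok p s \<Longrightarrow> 0 \<notin> wregs c \<Longrightarrow> 2 \<notin> wregs c \<Longrightarrow> 3 \<notin> wregs c \<Longrightarrow> 25 \<notin> wregs c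
    \<Longrightarrow> consts_ok p s'"
  by (simp add: consts_ok_def agree_def)

section \<open>Division by repeated subtraction\<close>

lemma div_le_iff: "0 < (p :: int) \<Longrightarrow> y div p \<le> q \<longleftrightarrow> y < p * q + p"
proof
  assume p: "0 < p"
  have *: "y = p * (y div p) + y mod p" "0 \<le> y mod p" "y mod p < p" using p by auto
  show "y < p * q + p" if "y div p \<le> q"
  proof -
    have "p * (y div p) \<le> p * q" using that p by simp
    then show ?thesis using * by linarith
  qed
  show "y div p \<le> q" if "y < p * q + p"
  proof -
    have "p * (q + 1) = p * q + p" by (simp add: algebra_simps)
    then have "p * (y div p) < p * (q + 1)" using * that by linarith
    then have "y div p < q + 1" using p by (simp only: mult_less_cancel_left_pos)
    then show ?thesis by simp
  qed
qed

lemma le_div_iff: "0 < (p :: int) \<Longrightarrow> q \<le> y div p \<longleftrightarrow> p * q \<le> y"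
  using div_le_iff[of p y "q - 1"] by (auto simp: algebra_simps)

lemma div_mod_unique:
  assumes "0 \<le> y - p * q" "y - p * q < (p :: int)"
  shows "y div p = q" "y mod p = y - p * q"
proof -
  have "p > 0" using assms by linarith
  then show "y div p = q"
    using le_div_iff[of p q y] div_le_iff[of p y q] assms by simp
  then show "y mod p = y - p * q"
    using minus_mult_div_eq_mod[of y p] by simp
qed

text \<open>The machine only tests for being strictly positive; adding register 0, which holds 1,
  turns this into the test \<open>y \<ge> p\<close>. The same device recurs below.\<close>

definition reduce_down :: com where
  "reduce_down = While (Do (Sub 8 11 3) ;; Do (Add 8 8 0)) 8 (Do (Sub 11 11 3) ;; Do (Add 12 12 0))"

lemma reduce_down_wp:
  assumes p: "p \<ge> 2" and c: "consts_ok p s"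
  shows "wp reduce_down (\<lambda>s'. \<exists>q\<ge>0. reg s' 12 = reg s 12 + q \<and> reg s' 11 = reg s 11 - int p * q \<and>
      (q = 0 \<or> reg s' 11 \<ge> 0) \<and> reg s' 11 < int p \<and> int (pc s') \<le> int (pc s) + 6 * q + 4) s"
  unfolding reduce_down_def
proof (rule wp_While[where T = "nat (int (pc s) + 6 * \<bar>reg s 11 div int p\<bar>)" and
      I = "\<lambda>s'. \<exists>q\<ge>0. reg s' 12 = reg s 12 + q \<and> reg s' 11 = reg s 11 - int p * q \<and>
      (q = 0 \<or> reg s' 11 \<ge> 0) \<and> int (pc s') \<le> int (pc s) + 6 * q"], goal_cases)
  case (2 s')
  then obtain q where "q \<ge> 0" "q = 0 \<or> reg s 11 - int p * q \<ge> 0" "int (pc s') \<le> int (pc s) + 6 * q"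
    by auto
  then show ?case using le_div_iff[of "int p" q "reg s 11"] p by force
next
  case (3 s')
  then obtain q where q: "q \<ge> 0" "reg s' 12 = reg s 12 + q" "reg s' 11 = reg s 11 - int p * q"
      "q = 0 \<or> reg s' 11 \<ge> 0" "int (pc s') \<le> int (pc s) + 6 * q" by blast
  have con: "reg s' 0 = 1" "reg s' 3 = int p"
    using 3(2) c by (simp_all add: agree_def consts_ok_def)
  show ?case
  proof (cases "reg s' 11 \<ge> int p")
    case True
    then show ?thesis using q con
      by (auto intro!: exI[of _ "q + 1"] simp: algebra_simps)
  next
    case False
    then show ?thesis using q con by (auto intro!: exI[of _ q])
  qed
qed auto

definition reduce_up :: com where
  "reduce_up = While (Do (Sub 8 2 11)) 8 (Do (Add 11 11 3) ;; Do (Sub 12 12 0))"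

lemma reduce_up_wp:
  assumes p: "p \<ge> 2" and c: "consts_ok p s" and y: "reg s 11 < int p"
  shows "wp reduce_up (\<lambda>s'. \<exists>q\<ge>0. reg s' 12 = reg s 12 - q \<and> reg s' 11 = reg s 11 + int p * q \<and>
      (q = 0 \<or> reg s 11 < 0) \<and> 0 \<le> reg s' 11 \<and> reg s' 11 < int p \<and>
      int (pc s') \<le> int (pc s) + 5 * q + 3) s"
  unfolding reduce_up_def
proof (rule wp_While[where T = "nat (int (pc s) + 5 * \<bar>reg s 11 div int p\<bar>)" and
      I = "\<lambda>s'. \<exists>q\<ge>0. reg s' 12 = reg s 12 - q \<and> reg s' 11 = reg s 11 + int p * q \<and>
      (q = 0 \<or> reg s 11 < 0) \<and> reg s' 11 < int p \<and> int (pc s') \<le> int (pc s) + 5 * q"], goal_cases)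
  case (2 s')
  then obtain q where "q \<ge> 0" "reg s' 11 = reg s 11 + int p * q" "reg s' 11 < int p"
      "int (pc s') \<le> int (pc s) + 5 * q" by blast
  then show ?case using div_le_iff[of "int p" "reg s 11" "- q"] p by force
next
  case (3 s')
  then obtain q where q: "q \<ge> 0" "reg s' 12 = reg s 12 - q" "reg s' 11 = reg s 11 + int p * q"
      "q = 0 \<or> reg s 11 < 0" "reg s' 11 < int p" "int (pc s') \<le> int (pc s) + 5 * q" by blast
  have con: "reg s' 0 = 1" "reg s' 2 = 0" "reg s' 3 = int p"
    using 3(2) c by (simp_all add: agree_def consts_ok_def)
  show ?case
  proof (cases "reg s' 11 < 0")
    case True
    then show ?thesis using q con
      by (auto intro!: exI[of _ "q + 1"] simp: algebra_simps)
  next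
    case False
    then show ?thesis using q con by (auto intro!: exI[of _ q])
  qed
qed (use y in auto)

text \<open>At most one of the two loops makes any round, so the number of rounds is the absolute
  value of the floor quotient.\<close>

lemma reduce_wp:
  assumes p: "p \<ge> 2" and c: "consts_ok p s"
  shows "wp (reduce_down ;; reduce_up) (\<lambda>s'. reg s' 11 = reg s 11 mod int p \<and>
     reg s' 12 = reg s 12 + reg s 11 div int p \<and>
     int (pc s') \<le> int (pc s) + 6 * \<bar>reg s 11 div int p\<bar> + 7) s"
  unfolding wp_Seq
proof (rule wp_frame[OF reduce_down_wp[OF assms]], elim exE conjE, goal_cases)
  case (1 s1 q)
  have c1: "consts_ok p s1"
    using consts_ok_agree[OF 1(1) c] by (simp add: reduce_down_def)
  show ?case
  proof (rule wp_mono[OF reduce_up_wp[OF p c1]], goal_cases)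
    case (2 s2)
    then obtain r where r: "r \<ge> 0" "reg s2 12 = reg s1 12 - r" "reg s2 11 = reg s1 11 + int p * r"
      "r = 0 \<or> reg s1 11 < 0" "0 \<le> reg s2 11" "reg s2 11 < int p"
      "int (pc s2) \<le> int (pc s1) + 5 * r + 3" by blast
    have "reg s2 11 = reg s 11 - int p * (q - r)" using r 1 by (simp add: algebra_simps)
    then have "reg s 11 div int p = q - r" "reg s 11 mod int p = reg s2 11"
      using div_mod_unique[of "reg s 11" "int p" "q - r"] r by auto
    then show ?case using 1 r by auto
  qed (use 1 in auto)
qed


section \<open>Reading the word\<close>

definition scan_letter :: com where
  "scan_letter =
     Do (Add 7 7 0) ;; Do (Sub 8 8 0) ;;
     If_pos 8
       (Do (Sub 8 8 0) ;;
        If_pos 8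
          (Do (Sub 8 8 0) ;;
           If_pos 8
             (Do (Sub 4 4 0) ;; Do (Sub 9 5 4) ;; If_pos 9 (Do (Add 5 4 2)) Skip)
             (Do (Add 4 4 0) ;; Do (Sub 9 4 6) ;; If_pos 9 (Do (Add 6 4 2)) Skip))
          (Do (Load 11 3 4) ;; Do (Sub 11 11 0) ;; Do (Store 3 4 11)))
       (Do (Load 11 3 4) ;; Do (Add 11 11 0) ;; Do (Store 3 4 11))"

definition scan_state :: "config \<Rightarrow> int \<times> int \<times> int \<times> (int \<Rightarrow> int)" where
  "scan_state s = (reg s 4, reg s 5, reg s 6, \<lambda>j. val (arr s 3 j))"

lemma scan_letter_wp:
  assumes c: "consts_ok p s" and x: "reg s 8 = letter_code x"
  shows "wp scan_letter (\<lambda>s'. reg s' 7 = reg s 7 + 1 \<and> scan_state s' = scan1 x (scan_state s) \<and>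
    pc s' \<le> pc s + 14) s"
proof -
  have upd: "(\<lambda>j. val (if j = h then Some z else arr s 3 j)) = (\<lambda>j. val (arr s 3 j))(h := z)" for h z
    by auto
  show ?thesis
    using c x by (cases x) (auto simp: scan_letter_def scan_state_def consts_ok_def upd)
qed

text \<open>Letter codes are positive and an empty cell is read as 0, so the load itself detects the
  end of the input.\<close>

definition scan_phase :: "nat \<Rightarrow> com" where
  "scan_phase p = Do (Const 0 1) ;; Do (Const 3 (int p)) ;; Do (Const 25 3) ;;
     While (Do (Load 8 1 7)) 8 scan_letter"

lemma scan_phase_wp:
  assumes r: "\<And>r. reg s r = 0" and a: "arr s 1 = array_of (word_code w)" "arr s 3 = (\<lambda>_. None)"
  shows "wp (scan_phase p) (\<lambda>s'. consts_ok p s' \<and> scan_state s' = scan w \<and>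
    pc s' \<le> pc s + 20 * length w + 10) s"
proof -
  let ?s = "s\<lparr>pc := Suc (Suc (Suc (pc s))), reg := (reg s)(0 := 1, 3 := int p, 25 := 3)\<rparr>"
  have "wp (While (Do (Load 8 1 7)) 8 scan_letter) (\<lambda>s'. consts_ok p s' \<and> scan_state s' = scan w \<and>
    pc s' \<le> pc s + 20 * length w + 10) ?s"
  proof (rule wp_While[where T = "pc s + 20 * length w + 5" and
      I = "\<lambda>s'. \<exists>i\<le>length w. reg s' 7 = int i \<and> scan_state s' = scan (take i w) \<and>
        pc s' \<le> pc s + 20 * i + 5"], goal_cases)
    case (3 s1)
    then obtain i where i: "i \<le> length w" "reg s1 7 = int i" "scan_state s1 = scan (take i w)"
        "pc s1 \<le> pc s + 20 * i + 5" by blast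
    have c1: "consts_ok p s1" "arr s1 (Suc 0) = array_of (word_code w)"
      using 3(2) r a by (simp_all add: consts_ok_def agree_def scan_letter_def)
    show ?case
    proof (cases "i < length w")
      case True
      have code: "array_of (word_code w) (int i) = Some (letter_code (w ! i))"
        using True by (simp add: array_of_def word_code_def)
      have pos: "letter_code (w ! i) > 0" by (cases "w ! i") auto
      let ?s1 = "tick (exec (Load 8 1 7) s1)"
      have "wp scan_letter (\<lambda>s2. 0 < reg s2 0 \<and> (\<exists>i\<le>length w. reg (tick s2) 7 = int i \<and>
          scan_state (tick s2) = scan (take i w) \<and> pc (tick s2) \<le> pc s + 20 * i + 5)) ?s1"
      proof (rule wp_frame[OF scan_letter_wp[of p _ "w ! i"]], goal_cases)
        case (3 s2)
        have "scan (take (Suc i) w) = scan1 (w ! i) (scan (take i w))"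
          using True by (simp add: take_Suc_conv_app_nth)
        moreover have "scan_state ?s1 = scan_state s1" by (simp add: scan_state_def)
        moreover have "scan_state (tick s2) = scan_state s2" by (simp add: scan_state_def)
        moreover have "reg s2 0 = 1"
          using agree_reg[OF 3(2), of 0] c1 by (simp add: scan_letter_def consts_ok_def)
        ultimately show ?case using 3 i True by (auto intro!: exI[of _ "Suc i"])
      qed (use c1 i code in \<open>simp_all add: consts_ok_def\<close>)
      then show ?thesis using c1 i code pos by (simp add: consts_ok_def)
    next
      case False
      have code: "array_of (word_code w) (int i) = None"
        using False by (simp add: array_of_def word_code_def)
      show ?thesis
        using False c1 i code by (simp add: consts_ok_def scan_state_def)
    qed
  qed (use r a in \<open>auto simp: scan_state_def\<close>)
  then show ?thesis by (simp add: scan_phase_def add.commute)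
qed

section \<open>Normalisation to standard digits\<close>

definition norm_guard :: com where
  "norm_guard = Do (Add 8 6 0) ;; Do (Sub 9 8 10) ;;
     If_pos 9 (Do (Const 8 1))
       (Do (Load 11 3 10) ;; If_pos 11 (Do (Const 8 1)) (Do (Sub 8 2 11) ;; Do (Sub 8 8 0)))"

text \<open>Like 0, the number -1 is fixed under floor division by p, so the loop has to stop there
  too: for negative \<open>X\<close> the quotients end in -1.\<close>

lemma norm_guard_wp:
  assumes "consts_ok p s"
  shows "wp norm_guard (\<lambda>s'. (reg s' 8 > 0 \<longleftrightarrow>
      reg s 10 \<le> reg s 6 \<or> val (arr s 3 (reg s 10)) \<notin> {0, - 1}) \<and> pc s' \<le> pc s + 9) s"
  using assms by (auto simp: norm_guard_def consts_ok_def)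

definition norm_step :: com where
  "norm_step =
     Do (Load 11 3 10) ;; Do (Add 10 10 0) ;; Do (Load 12 3 10) ;; (reduce_down ;; reduce_up) ;;
     Do (Store 3 10 12) ;; Do (Sub 10 10 0) ;; Do (Store 3 10 11) ;; Do (Add 10 10 0)"

lemma norm_step_wp:
  assumes p: "p \<ge> 2" and c: "consts_ok p s" and y: "y = val (arr s 3 (reg s 10))"
  shows "wp norm_step (\<lambda>s'. reg s' 10 = reg s 10 + 1 \<and>
      arr s' 3 = (arr s 3)(reg s 10 + 1 := Some (val (arr s 3 (reg s 10 + 1)) + y div int p),
         reg s 10 := Some (y mod int p)) \<and>
      int (pc s') \<le> int (pc s) + 6 * \<bar>y div int p\<bar> + 14) s"
proof -
  have "wp (reduce_down ;; reduce_up) Q s2"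
    if s2: "consts_ok p s2" "reg s2 11 = y" and Q: "\<And>s3. agree (reduce_down ;; reduce_up) s2 s3 \<Longrightarrow>
        reg s3 11 = y mod int p \<Longrightarrow> reg s3 12 = reg s2 12 + y div int p \<Longrightarrow>
        int (pc s3) \<le> int (pc s2) + 6 * \<bar>y div int p\<bar> + 7 \<Longrightarrow> Q s3" for s2 Q
    by (rule wp_frame[OF reduce_wp[OF p s2(1)]]) (use s2 Q in auto)
  note red = this
  show ?thesis
    unfolding norm_step_def wp_Seq[of "Do _"] wp_Seq[of "reduce_down ;; reduce_up"]
    apply (simp del: wp_Seq)
    apply (rule red)
      apply (use c in \<open>simp add: consts_ok_def\<close>)
     apply (simp add: y)
    apply (use c in \<open>auto simp: agree_def reduce_down_def reduce_up_def consts_ok_def\<close>)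
    done
qed

definition norm_phase :: com where
  "norm_phase = Do (Add 10 5 2) ;; While norm_guard 8 norm_step ;; Do (Add 13 10 2)"

text \<open>The summand 1 is due to rounding down for negative \<open>y\<close>. The third claim
  fails at 0 and -1, the two fixed points of the division.\<close>

lemma quotient_abs_bound:
  fixes y p :: int
  assumes "p \<ge> 2"
  shows "\<bar>y div p\<bar> \<le> \<bar>y\<bar>" "2 * \<bar>y div p\<bar> \<le> \<bar>y\<bar> + 1"
    "y \<notin> {0, - 1} \<Longrightarrow> \<bar>y div p\<bar> < \<bar>y\<bar>"
proof -
  have *: "y = p * (y div p) + y mod p" "0 \<le> y mod p" "y mod p < p" using assms by auto
  have "2 * \<bar>y div p\<bar> \<le> \<bar>y\<bar> + 1"
  proof (cases "y div p \<ge> 0")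
    case True
    then have "2 * (y div p) \<le> p * (y div p)" using assms by (intro mult_right_mono) auto
    then show ?thesis using True * by linarith
  next
    case False
    then have "p * (y div p + 1) \<le> 2 * (y div p + 1)"
      using assms by (intro mult_right_mono_neg) auto
    then have "p * (y div p) + p \<le> 2 * (y div p) + 2" by (simp add: algebra_simps)
    then show ?thesis using False * by linarith
  qed
  then show 2: "2 * \<bar>y div p\<bar> \<le> \<bar>y\<bar> + 1" and "\<bar>y div p\<bar> \<le> \<bar>y\<bar>" by linarith+
  show "\<bar>y div p\<bar> < \<bar>y\<bar>" if "y \<notin> {0, - 1}"
  proof (cases "y = 1")
    case False
    then have "\<bar>y\<bar> \<ge> 2" using that by auto
    then show ?thesis using 2 by linarith
  qed (use assms in simp)
qed

definition abs_sum :: "(int \<Rightarrow> int) \<Rightarrow> int \<Rightarrow> int \<Rightarrow> int" where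
  "abs_sum D hi j = (\<Sum>i=j..hi. \<bar>D i\<bar>)"

lemma abs_sum_rec: "j \<le> hi \<Longrightarrow> abs_sum D hi j = \<bar>D j\<bar> + abs_sum D hi (j + 1)"
proof -
  assume "j \<le> hi"
  then have split: "{j..hi} = insert j {j+1..hi}" by auto
  show ?thesis unfolding abs_sum_def split by simp
qed

lemma abs_sum_beyond: "j > hi \<Longrightarrow> abs_sum D hi j = 0"
  by (simp add: abs_sum_def)

lemma abs_sum_nonneg: "abs_sum D hi j \<ge> 0"
  by (simp add: abs_sum_def sum_nonneg)

text \<open>One round takes up to \<open>6 * a + 25\<close> instructions, where \<open>a\<close> is
  the absolute value of the carry. The potential drops by \<open>Y - a\<close>, and by one more
  while a position up to \<open>hi\<close> is left; in total this is at least 1 and at least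
  \<open>a - 1\<close>. The factor 40 suffices for both cases.\<close>

lemma pot_step:
  fixes a Y u M M' t t' d R x :: int
  assumes "c \<or> a < Y" "a \<le> Y" "2 * a \<le> Y + 1" "c \<longrightarrow> M' = M - 1" "M' \<le> M" "u = d + u'"
    "t + 40 * (Y + u + M) \<le> R" "x \<le> d + a" "t' \<le> t + 6 * a + 24"
  shows "t' + 1 + 40 * (x + u' + M') \<le> R"
  using assms by (cases c) simp_all

lemma norm_phase_wp:
  assumes p: "p \<ge> 2" and c: "consts_ok p s" and sc: "scan_state s = (h, lo, hi, D)"
    and D: "\<And>j. j > hi \<Longrightarrow> D j = 0" and lohi: "lo \<le> hi" and X: "X = tail p D hi lo"
    and N: "N = 40 * (abs_sum D hi lo + (hi - lo + 1)) + 20"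
  shows "wp norm_phase (\<lambda>s'. \<exists>m. reg s' 13 = lo + int m \<and> hi < lo + int m \<and>
      X div int p ^ m \<in> {0, - 1} \<and> val (arr s' 3 (lo + int m)) = X div int p ^ m \<and>
      (\<forall>i<m. val (arr s' 3 (lo + int i)) = X div int p ^ i mod int p) \<and>
      int (pc s') \<le> int (pc s) + N \<and> int m \<le> N) s"
proof -
  \<comment> \<open>The potential consists of the current cell, the untouched cells above it and the
    number of positions up to \<open>hi\<close> still to be passed.\<close>
  define pot where "pot s' m = \<bar>val (arr s' 3 (lo + int m))\<bar> + abs_sum D hi (lo + int m + 1) +
          max 0 (hi + 1 - (lo + int m))" for s' :: config and m
  \<comment> \<open>The cell at \<open>lo + m\<close> holds its own exponent sum and the carry from
    below, that is, the quotient of \<open>X\<close> less the share of the untouched cells above. By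
    the last conjunct every round takes time, so the time bound also limits the number of digits,
    and no estimate of the size of \<open>X\<close> is needed.\<close>
  let ?I = "\<lambda>m (s' :: config). reg s' 10 = lo + int m \<and>
        (\<forall>i<m. val (arr s' 3 (lo + int i)) = X div int p ^ i mod int p) \<and>
        val (arr s' 3 (lo + int m)) = X div int p ^ m - int p * tail p D hi (lo + int m + 1) \<and>
        (\<forall>j>lo + int m. val (arr s' 3 j) = D j) \<and>
        int (pc s') + 40 * pot s' m \<le> int (pc s) + N - 19 \<and> pc s + m \<le> pc s'"
  let ?s = "s\<lparr>pc := Suc (pc s), reg := (reg s)(10 := reg s 5)\<rparr>"
  have "wp (While norm_guard 8 norm_step ;; Do (Add 13 10 2)) (\<lambda>s'. \<exists>m. reg s' 13 = lo + int m \<and> hi < lo + int m \<and>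
      X div int p ^ m \<in> {0, - 1} \<and> val (arr s' 3 (lo + int m)) = X div int p ^ m \<and>
      (\<forall>i<m. val (arr s' 3 (lo + int i)) = X div int p ^ i mod int p) \<and>
      int (pc s') \<le> int (pc s) + N \<and> int m \<le> N) ?s" (is "wp _ ?Q _")
    unfolding wp_Seq
  proof (rule wp_While[where T = "nat (int (pc s) + N)" and I = "\<lambda>s'. \<exists>m. ?I m s'"], goal_cases)
    case 1
    have "X = D lo + int p * tail p D hi (lo + 1)" "abs_sum D hi lo = \<bar>D lo\<bar> + abs_sum D hi (lo + 1)"
      using lohi X by (simp_all add: tail_rec abs_sum_rec)
    then show ?case
      using c sc lohi N by (intro exI[of _ 0]) (auto simp: scan_state_def consts_ok_def pot_def)
  next
    case (2 s1)
    then obtain m where "int (pc s1) + 40 * pot s1 m \<le> int (pc s) + N - 19" by blast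
    moreover have "pot s1 m \<ge> 0" using abs_sum_nonneg[of D hi "lo + int m + 1"] by (simp add: pot_def)
    ultimately have "int (pc s1) \<le> int (pc s) + N" by linarith
    then show ?case by simp
  next
    case (3 s1)
    then obtain m where m: "?I m s1" by blast
    then have mp: "int (pc s1) + 40 * pot s1 m \<le> int (pc s) + N - 19" by blast
    define y where "y = val (arr s1 3 (lo + int m))"
    define q where "q = y div int p"
    define J where "J = lo + int m + 1"
    have J: "lo + int (Suc m) = J" "lo + int m = J - 1" by (simp_all add: J_def)
    have ag: "agree (While norm_guard 8 norm_step) s s1"
      using 3(2) by (simp add: agree_def norm_step_def)
    have c1: "consts_ok p s1" "reg s1 6 = hi"
      using consts_ok_agree[OF ag c] agree_reg[OF ag, of 6] sc
      by (simp_all add: norm_guard_def norm_step_def reduce_down_def reduce_up_def scan_state_def)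
    show ?case
    proof (rule wp_frame[OF norm_guard_wp[OF c1(1)]], goal_cases)
      case (1 s2)
      have s2: "consts_ok p s2" "arr s2 = arr s1" "reg s2 10 = reg s1 10" "reg s2 0 = 1" "reg s2 2 = 0"
        using consts_ok_agree[OF 1(2) c1(1)] 1(2)
        by (auto simp: agree_def norm_guard_def consts_ok_def)
      have pc2: "pc s1 \<le> pc s2" "pc s2 \<le> pc s1 + 9" using 1 by auto
      have guard: "reg s2 8 > 0 \<longleftrightarrow> J - 1 \<le> hi \<or> y \<notin> {0, - 1}"
        using 1(1) m c1(2) by (simp add: y_def J_def)
      show ?case
      proof (cases "reg s2 8 > 0")
        case True
        have c2: "consts_ok p (tick s2)" using s2 by (simp add: consts_ok_def)
        have y2: "y = val (arr (tick s2) 3 (reg (tick s2) 10))" using m s2 by (simp add: y_def)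
        have "wp norm_step (\<lambda>s3. 0 < reg s3 0 \<and> (\<exists>m. ?I m (tick s3))) (tick s2)"
        proof (rule wp_frame[OF norm_step_wp[OF p c2 y2]], goal_cases)
          case (1 s3)
          have r0: "reg s3 0 = 1"
            using agree_reg[OF 1(2), of 0] s2 by (simp add: norm_step_def reduce_down_def reduce_up_def)
          have Dj: "val (arr s1 3 J) = D J" using m by (simp add: J_def)
          have a3: "arr s3 3 = (arr s1 3)(J := Some (D J + q), J - 1 := Some (y mod int p))"
            using 1(1) m s2 Dj by (simp add: J_def q_def)
          have pc3: "Suc (pc s2) \<le> pc s3" using 1(3) by simp
          have t: "int (pc s3) \<le> int (pc s1) + 6 * \<bar>q\<bar> + 24" "pc s1 < pc s3"
            using 1(1) pc3 pc2 by (simp_all add: q_def)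
          have I: "?I (Suc m) (tick s3)"
          proof (intro conjI allI impI)
            show "reg (tick s3) 10 = lo + int (Suc m)"
              using 1(1) m s2 by simp
          next
            fix i assume "i < Suc m"
            moreover have "y mod int p = X div int p ^ m mod int p"
              using m mod_mult_self2[of "X div int p ^ m" "int p" "- tail p D hi (lo + int m + 1)"]
              by (simp add: y_def)
            ultimately show "val (arr (tick s3) 3 (lo + int i)) = X div int p ^ i mod int p"
              using m by (auto simp: a3 J_def less_Suc_eq)
          next
            have "tail p D hi J = D J + int p * tail p D hi (J + 1)"
              using tail_rec[of J hi p D] tail_beyond[of hi _ p D] D[of J]
              by (cases "J \<le> hi") auto
            moreover have "q = X div int p ^ Suc m - tail p D hi J"
              using m p div_mult_self2[of "int p" "X div int p ^ m" "- tail p D hi J"]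
              by (simp add: q_def y_def J_def div_power_Suc del: power_Suc)
            ultimately show "val (arr (tick s3) 3 (lo + int (Suc m)))
                = X div int p ^ Suc m - int p * tail p D hi (lo + int (Suc m) + 1)"
              unfolding J by (simp add: a3)
          next
            show "val (arr (tick s3) 3 j) = D j" if "j > lo + int (Suc m)" for j
              using that m by (simp add: a3 J_def)
          next
            have "abs_sum D hi J = \<bar>D J\<bar> + abs_sum D hi (J + 1)"
              using abs_sum_rec[of J hi D] abs_sum_beyond[of hi _ D] D[of J]
              by (cases "J \<le> hi") auto
            moreover have "\<bar>q\<bar> \<le> \<bar>y\<bar>" "2 * \<bar>q\<bar> \<le> \<bar>y\<bar> + 1"
              using quotient_abs_bound[of "int p" y] p by (simp_all add: q_def)
            moreover have "J - 1 \<le> hi \<or> \<bar>q\<bar> < \<bar>y\<bar>"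
              using True guard quotient_abs_bound[of "int p" y] p by (auto simp: q_def)
            moreover have "int (pc s1) + 40 * (\<bar>y\<bar> + abs_sum D hi J + max 0 (hi + 1 - (J - 1)))
                \<le> int (pc s) + N - 19"
              using mp by (simp add: y_def J_def pot_def)
            moreover have "\<bar>D J + q\<bar> \<le> \<bar>D J\<bar> + \<bar>q\<bar>" by simp
            moreover have "max 0 (hi + 1 - J) \<le> max 0 (hi + 1 - (J - 1))"
              "J - 1 \<le> hi \<longrightarrow> max 0 (hi + 1 - J) = max 0 (hi + 1 - (J - 1)) - 1" by auto
            ultimately have "int (pc s3) + 1 + 40 * (\<bar>D J + q\<bar> + abs_sum D hi (J + 1) + max 0 (hi + 1 - J))
                \<le> int (pc s) + N - 19"
              using t(1)
              by (intro pot_step[of "J - 1 \<le> hi" "\<bar>q\<bar>" "\<bar>y\<bar>" _ "max 0 (hi + 1 - (J - 1))"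
                    "abs_sum D hi J" "\<bar>D J\<bar>" _ "int (pc s1)"])
            then show "int (pc (tick s3)) + 40 * pot (tick s3) (Suc m) \<le> int (pc s) + N - 19"
              unfolding pot_def J by (simp add: a3)
          next
            show "pc s + Suc m \<le> pc (tick s3)" using m t(2) by simp
          qed
          show ?case by (rule conjI, simp add: r0, rule exI, rule I)
        qed
        then show ?thesis using True s2 by simp
      next
        case False
        then have ex: "hi < lo + int m" "y \<in> {0, - 1}" using guard by (auto simp: J_def)
        then have yX: "y = X div int p ^ m" using m by (simp add: y_def tail_beyond)
        have "pot s1 m \<ge> 0" using abs_sum_nonneg[of D hi J] by (simp add: pot_def J_def)
        then have t: "int (pc s1) \<le> int (pc s) + N - 19" "int m \<le> N" using m by linarith+
        have "?Q (exec (Add 13 10 2) (tick (tick s2)))"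
        proof (intro exI[of _ m] conjI)
          show "X div int p ^ m \<in> {0, - 1}" using ex yX by simp
          show "int (pc (exec (Add 13 10 2) (tick (tick s2)))) \<le> int (pc s) + N"
            using t pc2 by simp
          show "val (arr (exec (Add 13 10 2) (tick (tick s2))) 3 (lo + int m)) = X div int p ^ m"
            using yX s2 by (simp add: y_def)
        qed (use m ex s2 t in simp_all)
        then show ?thesis using False s2 by simp
      qed
    qed
  qed
  then show ?thesis
    using c by (simp add: norm_phase_def consts_ok_def)
qed

section \<open>The lowest position\<close>

definition low_loop :: com where
  "low_loop = While (Do (Load 11 3 14) ;; If_pos 11 (Do (Const 9 0)) (Do (Sub 9 15 14))) 9 (Do (Add 14 14 0))"

text \<open>The cells searched contain standard digits, so a test for positive values finds the
  first nonzero one.\<close>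

lemma low_loop_wp:
  assumes c: "consts_ok p s" and r: "reg s 14 = lo" "reg s 15 = mn" "lo \<le> mn"
    and nonneg: "\<forall>j. lo \<le> j \<and> j < mn \<longrightarrow> 0 \<le> val (arr s 3 j)"
  shows "wp low_loop (\<lambda>s'. \<exists>e. reg s' 14 = lo + int e \<and> lo + int e \<le> mn \<and>
      (\<forall>i<e. val (arr s 3 (lo + int i)) = 0) \<and>
      (lo + int e = mn \<or> val (arr s 3 (lo + int e)) \<noteq> 0) \<and>
      int (pc s') \<le> int (pc s) + 8 * (mn - lo) + 8) s"
  unfolding low_loop_def
proof (rule wp_While[where T = "nat (int (pc s) + 8 * (mn - lo))" and
      I = "\<lambda>s'. \<exists>e. reg s' 14 = lo + int e \<and> lo + int e \<le> mn \<and>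
      (\<forall>i<e. val (arr s 3 (lo + int i)) = 0) \<and> int (pc s') \<le> int (pc s) + 8 * int e"], goal_cases)
  case 1
  then show ?case using r by (intro exI[of _ 0]) simp
next
  case (2 s1)
  then obtain e where "lo + int e \<le> mn" "int (pc s1) \<le> int (pc s) + 8 * int e" by blast
  then have "int (pc s1) \<le> int (pc s) + 8 * (mn - lo)" by simp
  then show ?case by simp
next
  case (3 s1)
  then obtain e where e: "reg s1 14 = lo + int e" "lo + int e \<le> mn"
    "\<forall>i<e. val (arr s 3 (lo + int i)) = 0" "int (pc s1) \<le> int (pc s) + 8 * int e" by blast
  have con: "reg s1 0 = 1" "reg s1 15 = mn" "arr s1 3 = arr s 3"
    using 3(2) c r by (simp_all add: agree_def consts_ok_def)
  let ?v = "val (arr s 3 (lo + int e))"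
  show ?case
  proof (cases "?v > 0 \<or> lo + int e = mn")
    case True
    then show ?thesis using e con by (auto intro!: exI[of _ e])
  next
    case False
    then have lt: "lo + int e < mn" using e(2) by simp
    moreover have "lo \<le> lo + int e" by simp
    ultimately have "?v \<ge> 0" using nonneg by blast
    then have v: "?v = 0" "lo + int e < mn" using lt False by simp_all
    then have "\<forall>i<Suc e. val (arr s 3 (lo + int i)) = 0" using e(3) by (simp add: less_Suc_eq)
    then show ?thesis using v e con by (auto intro!: exI[of _ "Suc e"])
  qed
qed

definition low_phase :: com where
  "low_phase =
     If_pos 4 (Do (Add 15 2 2) ;; Do (Add 16 4 2)) (Do (Add 15 4 2) ;; Do (Add 16 2 2)) ;;
     Do (Add 14 5 2) ;; low_loop"

lemma low_phase_wp:
  assumes c: "consts_ok p s" and r: "reg s 4 = h" "reg s 5 = lo" "lo \<le> min 0 h"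
    and nonneg: "\<forall>j. lo \<le> j \<and> j < min 0 h \<longrightarrow> 0 \<le> val (arr s 3 j)"
  shows "wp low_phase (\<lambda>s'. \<exists>e. reg s' 14 = lo + int e \<and> reg s' 16 = max 0 h \<and> lo + int e \<le> min 0 h \<and>
      (\<forall>i<e. val (arr s 3 (lo + int i)) = 0) \<and>
      (lo + int e = min 0 h \<or> val (arr s 3 (lo + int e)) \<noteq> 0) \<and>
      int (pc s') \<le> int (pc s) + 8 * (min 0 h - lo) + 14) s"
proof -
  have "wp low_loop (\<lambda>s'. \<exists>e. reg s' 14 = lo + int e \<and> reg s' 16 = max 0 h \<and> lo + int e \<le> min 0 h \<and>
      (\<forall>i<e. val (arr s 3 (lo + int i)) = 0) \<and>
      (lo + int e = min 0 h \<or> val (arr s 3 (lo + int e)) \<noteq> 0) \<and>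
      int (pc s') \<le> int (pc s) + 8 * (min 0 h - lo) + 14) s1"
    if s1: "consts_ok p s1" "reg s1 14 = lo" "reg s1 15 = min 0 h" "reg s1 16 = max 0 h"
      "pc s1 \<le> pc s + 6" "arr s1 = arr s" for s1
  proof (rule wp_frame[OF low_loop_wp[OF s1(1-3)]], goal_cases)
    case (3 s2)
    have "reg s2 16 = max 0 h" using agree_reg[OF 3(2), of 16] s1 by (simp add: low_loop_def)
    then show ?case using 3(1) s1(5,6) by fastforce
  qed (use r nonneg s1 in auto)
  then show ?thesis
    unfolding low_phase_def using c r by (auto simp: consts_ok_def min_def max_def)
qed

section \<open>Tabulating the dynamic program\<close>

definition spread :: com where
  "spread = While Skip 11 (Do (Sub 11 11 0) ;; Do (Add 17 17 0) ;; Do (Sub 18 18 0))"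

text \<open>Adding register 11 at once would be a sum of two variable registers, which
  \<open>tame\<close> forbids here. In unit steps only the constant 1 is added, and since a digit is
  below p the time per position stays constant.\<close>

lemma spread_wp:
  assumes c: "reg s 0 = 1" and y: "reg s 11 \<ge> 0"
  shows "wp spread (\<lambda>s'. reg s' 17 = reg s 17 + reg s 11 \<and> reg s' 18 = reg s 18 - reg s 11 \<and>
     int (pc s') \<le> int (pc s) + 5 * reg s 11 + 2) s"
  unfolding spread_def
proof (rule wp_While[where T = "nat (int (pc s) + 5 * reg s 11)" and
      I = "\<lambda>s'. \<exists>i\<ge>0. reg s' 11 = reg s 11 - i \<and> i \<le> reg s 11 \<and> reg s' 17 = reg s 17 + i \<and>
        reg s' 18 = reg s 18 - i \<and> int (pc s') \<le> int (pc s) + 5 * i"], goal_cases)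
  case (3 s1)
  then obtain i where i: "i \<ge> 0" "reg s1 11 = reg s 11 - i" "i \<le> reg s 11" "reg s1 17 = reg s 17 + i"
    "reg s1 18 = reg s 18 - i" "int (pc s1) \<le> int (pc s) + 5 * i" by blast
  have con: "reg s1 0 = 1" using 3(2) c by (simp add: agree_def)
  show ?case
  proof (cases "i < reg s 11")
    case True
    then show ?thesis using i con by (auto intro!: exI[of _ "i + 1"])
  next
    case False
    then show ?thesis using i con by auto
  qed
qed (use y in auto)

lemma wregs_spread: "wregs spread = {11, 17, 18}"
  by (auto simp: spread_def)

lemma warrs_spread: "warrs spread = {}"
  by (simp add: spread_def)

text \<open>The cost \<open>\<bar>p * k - d\<bar>\<close> is \<open>d\<close> for carry 0 and
  \<open>p - d\<close> for carry 1, so \<open>spread\<close> can add the digit to one state while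
  subtracting it from the other. Register 9 receives differences of variable values and is used for
  tests only.\<close>

definition dp_body :: com where
  "dp_body =
     Do (Add 8 18 0) ;; Do (Sub 9 17 8) ;; If_pos 9 Skip (Do (Add 8 17 2)) ;;
     Do (Sub 12 18 0) ;; Do (Sub 9 17 12) ;; If_pos 9 Skip (Do (Add 12 17 2)) ;;
     Do (Add 17 8 0) ;; Do (Add 17 17 0) ;; Do (Add 18 12 0) ;; Do (Add 18 18 0) ;; Do (Add 18 18 3) ;;
     Do (Load 11 3 10) ;; spread ;; Do (Add 10 10 0) ;; Do (Store 4 10 17) ;; Do (Store 5 10 18)"

lemma dp_body_wp:
  assumes c: "consts_ok p s" and d: "val (arr s 3 (reg s 10)) = d" "0 \<le> d" "d < int p"
  shows "wp dp_body (\<lambda>s'. reg s' 10 = reg s 10 + 1 \<and>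
     reg s' 17 = 2 + d + min (reg s 17) (reg s 18 + 1) \<and>
     reg s' 18 = 2 + (int p - d) + min (reg s 17) (reg s 18 - 1) \<and>
     arr s' 4 = (arr s 4)(reg s 10 + 1 := Some (reg s' 17)) \<and>
     arr s' 5 = (arr s 5)(reg s 10 + 1 := Some (reg s' 18)) \<and>
     int (pc s') \<le> int (pc s) + 5 * int p + 25) s"
proof -
  have sp: "wp spread Q s1"
    if "reg s1 0 = 1" "reg s1 11 = d" and Q: "\<And>s2. agree spread s1 s2 \<Longrightarrow>
        reg s2 17 = reg s1 17 + d \<Longrightarrow> reg s2 18 = reg s1 18 - d \<Longrightarrow>
        int (pc s2) \<le> int (pc s1) + 5 * d + 2 \<Longrightarrow> Q s2" for s1 Q
    by (rule wp_frame[OF spread_wp]) (use that d in auto)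
  define f0 f1 where "f0 = reg s 17" and "f1 = reg s 18"
  have con: "reg s 0 = 1" "reg s 2 = 0" "reg s 3 = int p" using c by (auto simp: consts_ok_def)
  show ?thesis
    unfolding dp_body_def wp_Seq[of "Do _"] wp_Seq[of "If_pos _ _ _"] wp_Seq[of spread]
    using con d
    by (cases "f0 > f1 + 1"; cases "f0 > f1 - 1")
      (auto simp: agree_def f0_def f1_def wregs_spread warrs_spread min_def intro!: sp)
qed

definition dp_loop :: com where
  "dp_loop = While (Do (Sub 9 13 10)) 9 dp_body"

lemma dp_loop_wp:
  assumes p: "p \<ge> 2" and c: "consts_ok p s" and r: "reg s 13 = L + int N" "reg s 10 = L" "reg s 17 = 0" "reg s 18 = 2"
    and a: "val (arr s 4 L) = 0" "val (arr s 5 L) = 2"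
    and d: "\<forall>i<N. val (arr s 3 (L + int i)) = X div int p ^ i mod int p"
  shows "wp dp_loop (\<lambda>s'. (\<forall>i\<le>N. val (arr s' 4 (L + int i)) = dp (int p) X i 0 \<and>
      val (arr s' 5 (L + int i)) = dp (int p) X i 1) \<and>
      int (pc s') \<le> int (pc s) + (5 * int p + 30) * int N + 3) s"
  unfolding dp_loop_def
proof (rule wp_While[where T = "nat (int (pc s) + (5 * int p + 30) * int N)" and
      I = "\<lambda>s'. \<exists>m\<le>N. reg s' 10 = L + int m \<and> reg s' 17 = dp (int p) X m 0 \<and> reg s' 18 = dp (int p) X m 1 \<and>
        (\<forall>i\<le>m. val (arr s' 4 (L + int i)) = dp (int p) X i 0 \<and> val (arr s' 5 (L + int i)) = dp (int p) X i 1) \<and>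
        int (pc s') \<le> int (pc s) + (5 * int p + 30) * int m"], goal_cases)
  case 1
  then show ?case using r a by (intro exI[of _ 0]) simp
next
  case (2 s1)
  then obtain m where m: "m \<le> N" "int (pc s1) \<le> int (pc s) + (5 * int p + 30) * int m" by blast
  have "(5 * int p + 30) * int m \<le> (5 * int p + 30) * int N"
    using m(1) by (intro mult_left_mono) auto
  then show ?case using m(2) by linarith
next
  case (3 s1)
  then obtain m where m: "m \<le> N" "reg s1 10 = L + int m" "reg s1 17 = dp (int p) X m 0"
    "reg s1 18 = dp (int p) X m 1"
    "\<forall>i\<le>m. val (arr s1 4 (L + int i)) = dp (int p) X i 0 \<and> val (arr s1 5 (L + int i)) = dp (int p) X i 1"
    "int (pc s1) \<le> int (pc s) + (5 * int p + 30) * int m" by blast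
  have ag: "agree (While (Do (Sub 9 13 10)) 9 dp_body) s s1" by (rule 3(2))
  have con: "consts_ok p s1" "reg s1 13 = L + int N" "arr s1 3 = arr s 3" "reg s1 0 = 1"
    using consts_ok_agree[OF ag c] agree_reg[OF ag] agree_arr[OF ag] r c
    by (simp_all add: dp_body_def spread_def consts_ok_def)
  show ?case
  proof (cases "m < N")
    case True
    define d where "d = X div int p ^ m mod int p"
    let ?s1 = "tick (exec (Sub 9 13 10) s1)"
    have "wp dp_body (\<lambda>s2. 0 < reg s2 0 \<and> (\<exists>m\<le>N. reg (tick s2) 10 = L + int m \<and>
        reg (tick s2) 17 = dp (int p) X m 0 \<and> reg (tick s2) 18 = dp (int p) X m 1 \<and>
        (\<forall>i\<le>m. val (arr (tick s2) 4 (L + int i)) = dp (int p) X i 0 \<and>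
           val (arr (tick s2) 5 (L + int i)) = dp (int p) X i 1) \<and>
        int (pc (tick s2)) \<le> int (pc s) + (5 * int p + 30) * int m)) ?s1"
    proof (rule wp_frame[OF dp_body_wp[of p _ d]], goal_cases)
      case 1
      show ?case using con by (simp add: consts_ok_def)
    next
      case 2
      show ?case using con m True assms(9) by (simp add: d_def)
    next
      case 3
      show ?case using p by (simp add: d_def)
    next
      case 4
      show ?case using p by (simp add: d_def)
    next
      case (5 s2)
      have r0: "reg s2 0 = 1" using agree_reg[OF 5(2), of 0] con by (simp add: dp_body_def spread_def)
      have d: "0 \<le> d" "d < int p" using p by (simp_all add: d_def)
      have f: "reg s2 17 = dp (int p) X (Suc m) 0" "reg s2 18 = dp (int p) X (Suc m) 1"
        using 5(1) m d by (simp_all add: d_def[symmetric])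
      have "int (pc s2) + 1 \<le> int (pc s) + (5 * int p + 30) * int (Suc m)"
        using 5(1) m(6) by (simp add: algebra_simps)
      then show ?case
        using r0 f 5(1) m True
        by (intro conjI exI[of _ "Suc m"]) (auto simp: le_Suc_eq simp del: dp.simps)
    qed
    then show ?thesis using con m True by (simp del: dp.simps)
  next
    case False
    then show ?thesis using con m by (simp del: dp.simps)
  qed
qed

definition dp_phase :: com where
  "dp_phase = Do (Add 10 14 2) ;; Do (Const 17 0) ;; Do (Const 18 2) ;; Do (Store 4 10 17) ;;
     Do (Store 5 10 18) ;; dp_loop"

lemma dp_phase_wp:
  assumes p: "p \<ge> 2" and c: "consts_ok p s" and r: "reg s 13 = L + int N" "reg s 14 = L"
    and d: "\<forall>i<N. val (arr s 3 (L + int i)) = X div int p ^ i mod int p"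
  shows "wp dp_phase (\<lambda>s'. (\<forall>i\<le>N. val (arr s' 4 (L + int i)) = dp (int p) X i 0 \<and>
      val (arr s' 5 (L + int i)) = dp (int p) X i 1) \<and>
      int (pc s') \<le> int (pc s) + (5 * int p + 30) * int N + 8) s"
proof -
  have "wp dp_loop (\<lambda>s'. (\<forall>i\<le>N. val (arr s' 4 (L + int i)) = dp (int p) X i 0 \<and>
      val (arr s' 5 (L + int i)) = dp (int p) X i 1) \<and>
      int (pc s') \<le> int (pc s) + (5 * int p + 30) * int N + 8) s1"
    if s1: "consts_ok p s1" "reg s1 13 = L + int N" "reg s1 10 = L" "reg s1 17 = 0" "reg s1 18 = 2"
      "val (arr s1 4 L) = 0" "val (arr s1 5 L) = 2" "arr s1 3 = arr s 3" "pc s1 = pc s + 5" for s1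
    by (rule wp_mono[OF dp_loop_wp[OF p s1(1-7), of X]]) (use s1 d in auto)
  then show ?thesis
    unfolding dp_phase_def wp_Seq wp_Do exec.simps using c r
    by (simp add: consts_ok_def)
qed

section \<open>Products in unit steps\<close>

definition drain_pos :: "(nat \<Rightarrow> nat \<Rightarrow> nat \<Rightarrow> instr) \<Rightarrow> nat \<Rightarrow> nat \<Rightarrow> nat \<Rightarrow> com" where
  "drain_pos f x y z = While Skip x (Do (Sub x x 0) ;; Do (f y y z))"

definition drain_neg :: "(nat \<Rightarrow> nat \<Rightarrow> nat \<Rightarrow> instr) \<Rightarrow> nat \<Rightarrow> nat \<Rightarrow> nat \<Rightarrow> nat \<Rightarrow> com" where
  "drain_neg f t x y z = While (Do (Sub t 2 x)) t (Do (Add x x 0) ;; Do (f y y z))"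

lemma wregs_drain [simp]:
  "wregs (drain_pos Add x y z) = {x, y}" "wregs (drain_pos Sub x y z) = {x, y}"
  "wregs (drain_neg Add t x y z) = {t, x, y}" "wregs (drain_neg Sub t x y z) = {t, x, y}"
  by (auto simp: drain_pos_def drain_neg_def)

lemma warrs_drain [simp]:
  "warrs (drain_pos Add x y z) = {}" "warrs (drain_pos Sub x y z) = {}"
  "warrs (drain_neg Add t x y z) = {}" "warrs (drain_neg Sub t x y z) = {}"
  by (auto simp: drain_pos_def drain_neg_def)

lemma drain_pos_wp:
  assumes c: "reg s 0 = 1" and f: "f = Add \<and> \<sigma> = 1 \<or> f = Sub \<and> \<sigma> = - 1"
    and d: "x \<noteq> y" "x \<noteq> z" "y \<noteq> z" "x \<noteq> 0" "y \<noteq> 0"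
  shows "wp (drain_pos f x y z) (\<lambda>s'. reg s' x = min 0 (reg s x) \<and>
     reg s' y = reg s y + \<sigma> * (max 0 (reg s x) * reg s z) \<and>
     int (pc s') \<le> int (pc s) + 4 * max 0 (reg s x) + 2) s"
  unfolding drain_pos_def
proof (rule wp_While[where T = "nat (int (pc s) + 4 * max 0 (reg s x))" and
      I = "\<lambda>s'. \<exists>i\<ge>0. reg s' x = reg s x - i \<and> i \<le> max 0 (reg s x) \<and>
        reg s' y = reg s y + \<sigma> * (i * reg s z) \<and> int (pc s') \<le> int (pc s) + 4 * i"], goal_cases)
  case 1
  then show ?case by (intro exI[of _ 0]) simp
next
  case (2 s1)
  then show ?case by force
next
  case (3 s1)
  then obtain i where i: "i \<ge> 0" "reg s1 x = reg s x - i" "i \<le> max 0 (reg s x)"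
    "reg s1 y = reg s y + \<sigma> * (i * reg s z)" "int (pc s1) \<le> int (pc s) + 4 * i" by blast
  have con: "reg s1 0 = 1" "reg s1 z = reg s z"
    using 3(2) c d f by (auto simp: agree_def)
  show ?case
  proof (cases "i < reg s x")
    case True
    then show ?thesis using i con f d
      by (auto intro!: exI[of _ "i + 1"] simp: algebra_simps)
  next
    case False
    then have "i = max 0 (reg s x)" using i by auto
    then show ?thesis using i con f d False by (auto simp: max_def min_def)
  qed
qed

lemma drain_neg_wp:
  assumes c: "reg s 0 = 1" "reg s 2 = 0" and f: "f = Add \<and> \<sigma> = 1 \<or> f = Sub \<and> \<sigma> = - 1"
    and d: "x \<noteq> y" "x \<noteq> z" "y \<noteq> z" "x \<noteq> 0" "y \<noteq> 0" "x \<noteq> 2" "y \<noteq> 2" "t \<notin> {x, y, z, 0, 2}"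
  shows "wp (drain_neg f t x y z) (\<lambda>s'. 
     reg s' y = reg s y + \<sigma> * (max 0 (- reg s x) * reg s z) \<and>
     int (pc s') \<le> int (pc s) + 5 * max 0 (- reg s x) + 3) s"
  unfolding drain_neg_def
proof (rule wp_While[where T = "nat (int (pc s) + 5 * max 0 (- reg s x))" and
      I = "\<lambda>s'. \<exists>i\<ge>0. reg s' x = reg s x + i \<and> i \<le> max 0 (- reg s x) \<and>
        reg s' y = reg s y + \<sigma> * (i * reg s z) \<and> int (pc s') \<le> int (pc s) + 5 * i"], goal_cases)
  case 1
  then show ?case by (intro exI[of _ 0]) simp
next
  case (2 s1)
  then show ?case by force
next
  case (3 s1)
  then obtain i where i: "i \<ge> 0" "reg s1 x = reg s x + i" "i \<le> max 0 (- reg s x)"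
    "reg s1 y = reg s y + \<sigma> * (i * reg s z)" "int (pc s1) \<le> int (pc s) + 5 * i" by blast
  have con: "reg s1 0 = 1" "reg s1 2 = 0" "reg s1 z = reg s z"
    using 3(2) c d f by (auto simp: agree_def)
  show ?case
  proof (cases "i < - reg s x")
    case True
    then show ?thesis using i con f d
      by (auto intro!: exI[of _ "i + 1"] simp: algebra_simps)
  next
    case False
    then have "i = max 0 (- reg s x)" using i by auto
    then show ?thesis using i con f d False by (auto simp: max_def)
  qed
qed

text \<open>Equal signs \<open>\<sigma>\<close> and \<open>\<tau>\<close> add a multiple of
  \<open>\<bar>x\<bar>\<close>, opposite signs a multiple of \<open>x\<close>. The first form serves
  the cost of a top digit, with register 0 as the factor 1, the second the multiplication by
  p.\<close>

lemma drain_wp: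
  assumes c: "reg s 0 = 1" "reg s 2 = 0" and f: "f = Add \<and> \<sigma> = 1 \<or> f = Sub \<and> \<sigma> = - 1"
    and g: "g = Add \<and> \<tau> = 1 \<or> g = Sub \<and> \<tau> = - 1"
    and d: "x \<noteq> y" "x \<noteq> z" "y \<noteq> z" "x \<noteq> 0" "y \<noteq> 0" "x \<noteq> 2" "y \<noteq> 2" "t \<notin> {x, y, z, 0, 2}"
  shows "wp (drain_pos f x y z ;; drain_neg g t x y z) (\<lambda>s'.
     reg s' y = reg s y + \<sigma> * (max 0 (reg s x) * reg s z) + \<tau> * (max 0 (- reg s x) * reg s z) \<and>
     int (pc s') \<le> int (pc s) + 5 * \<bar>reg s x\<bar> + 5) s"
  unfolding wp_Seq
proof (rule wp_frame[OF drain_pos_wp[of s f \<sigma> x y z]], goal_cases)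
  case (8 s1)
  have w: "wregs (drain_pos f x y z) = {x, y}" using f by auto
  have r: "reg s1 0 = 1" "reg s1 2 = 0" "reg s1 z = reg s z"
    using agree_reg[OF 8(2), unfolded w] c d by simp_all
  show ?case
  proof (rule wp_mono[OF drain_neg_wp[of s1 g \<tau> x y z t]], goal_cases)
    case (12 s2)
    have m: "max 0 (- min 0 (reg s x)) = max 0 (- reg s x)" by simp
    have t: "4 * max 0 (reg s x) + 5 * max 0 (- reg s x) \<le> 5 * \<bar>reg s x\<bar>" by (simp add: max_def)
    have e1: "reg s1 x = min 0 (reg s x)" "reg s1 y = reg s y + \<sigma> * (max 0 (reg s x) * reg s z)"
      "int (pc s1) \<le> int (pc s) + 4 * max 0 (reg s x) + 2" using 8(1) by blast+
    have e2: "reg s2 y = reg s1 y + \<tau> * (max 0 (- reg s1 x) * reg s1 z)"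
      "int (pc s2) \<le> int (pc s1) + 5 * max 0 (- reg s1 x) + 3" using 12 by blast+
    show ?case
      using t e1(3) e2(2) unfolding e2(1) e1(1,2) r(3) m by simp
  qed (use r g d in auto)
qed (use c f d in auto)

section \<open>Search for the top position\<close>

definition cand_com :: "nat \<Rightarrow> nat \<Rightarrow> com" where
  "cand_com a k =
     Do (Load 8 a 24) ;; Do (Add 11 19 k) ;; Do (Add 12 11 2) ;;
     (drain_pos Add 12 8 0 ;; drain_neg Add 34 12 8 0) ;;
     Do (Sub 9 20 8) ;;
     If_pos 9 (Do (Add 20 8 2) ;; Do (Add 21 24 2) ;; Do (Add 22 11 2) ;; Do (Add 23 k 2)) Skip"

text \<open>\<open>k\<close> names the register whose content is the carry: register 2 holds 0 and
  register 0 holds 1. The comparison is strict, so among equal candidates the one inspected first is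
  kept.\<close>

lemma cand_com_wp:
  assumes c: "consts_ok p s" and k: "k = 2 \<or> k = 0"
    and y: "y = reg s 19 + reg s k" and v: "v = val (arr s a (reg s 24)) + \<bar>y\<bar>"
  shows "wp (cand_com a k) (\<lambda>s'. (if v < reg s 20
      then reg s' 20 = v \<and> reg s' 21 = reg s 24 \<and> reg s' 22 = y \<and> reg s' 23 = reg s k
      else reg s' 20 = reg s 20 \<and> reg s' 21 = reg s 21 \<and> reg s' 22 = reg s 22 \<and> reg s' 23 = reg s 23) \<and>
      int (pc s') \<le> int (pc s) + 5 * \<bar>y\<bar> + 16) s"
proof -
  have con: "reg s 0 = 1" "reg s 2 = 0" using c by (auto simp: consts_ok_def)
  have dr: "wp (drain_pos Add 12 8 0 ;; drain_neg Add 34 12 8 0) Q s1"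
    if s1: "reg s1 0 = 1" "reg s1 2 = 0" "reg s1 12 = y"
      and Q: "\<And>s2. agree (drain_pos Add 12 8 0 ;; drain_neg Add 34 12 8 0) s1 s2 \<Longrightarrow>
        reg s2 8 = reg s1 8 + \<bar>y\<bar> \<Longrightarrow> int (pc s2) \<le> int (pc s1) + 5 * \<bar>y\<bar> + 5 \<Longrightarrow> Q s2" for s1 Q
  proof (rule wp_frame[OF drain_wp[of s1 Add 1 Add 1 12 8 0 34]], goal_cases)
    case (13 s2)
    have "max 0 y + max 0 (- y) = \<bar>y\<bar>" by simp
    then show ?case using 13 s1 by (intro Q) auto
  qed (use s1 in auto)
  show ?thesis
    unfolding cand_com_def wp_Seq[of "Do _"] wp_Seq[of "drain_pos _ _ _ _ ;; drain_neg _ _ _ _ _"]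
    using con k y v
    by (cases "v < reg s 20") (auto simp: agree_def intro!: dr simp del: wp_Seq simp: wp_Seq[of "Do _"])
qed

text \<open>With 3 in register 25, the condition that the quotient has absolute value at most 2
  becomes two tests for being positive, of \<open>3 - q\<close> and of \<open>q + 3\<close>.\<close>

definition fold_guard :: com where
  "fold_guard = Do (Sub 9 24 16) ;;
     If_pos 9 (Do (Sub 8 25 19) ;; If_pos 8 (Do (Add 8 19 25)) Skip ;; If_pos 8 Skip (Do (Const 9 0))) Skip"

lemma fold_guard_wp:
  assumes c: "consts_ok p s"
  shows "wp fold_guard (\<lambda>s'. (reg s' 9 > 0 \<longleftrightarrow> reg s 24 > reg s 16 \<and> \<bar>reg s 19\<bar> \<le> 2) \<and>
     pc s' \<le> pc s + 10) s"
  using c by (auto simp: fold_guard_def consts_ok_def)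

definition fold_step :: com where
  "fold_step = Do (Sub 24 24 0) ;; Do (Load 11 3 24) ;;
     (drain_pos Add 19 11 3 ;; drain_neg Sub 8 19 11 3) ;; Do (Add 19 11 2)"

lemma fold_step_wp:
  assumes c: "consts_ok p s" and p: "p \<ge> 2"
  shows "wp fold_step (\<lambda>s'. reg s' 24 = reg s 24 - 1 \<and>
     reg s' 19 = val (arr s 3 (reg s 24 - 1)) + int p * reg s 19 \<and>
     int (pc s') \<le> int (pc s) + 5 * \<bar>reg s 19\<bar> + 8) s"
proof -
  have con: "reg s 0 = 1" "reg s 2 = 0" "reg s 3 = int p" using c by (auto simp: consts_ok_def)
  have dr: "wp (drain_pos Add 19 11 3 ;; drain_neg Sub 8 19 11 3) Q s1"
    if s1: "reg s1 0 = 1" "reg s1 2 = 0" "reg s1 3 = int p"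
      and Q: "\<And>s2. agree (drain_pos Add 19 11 3 ;; drain_neg Sub 8 19 11 3) s1 s2 \<Longrightarrow>
        reg s2 11 = reg s1 11 + int p * reg s1 19 \<Longrightarrow>
        int (pc s2) \<le> int (pc s1) + 5 * \<bar>reg s1 19\<bar> + 5 \<Longrightarrow> Q s2" for s1 Q
  proof (rule wp_frame[OF drain_wp[of s1 Add 1 Sub "- 1" 19 11 3 8]], goal_cases)
    case (13 s2)
    have "max 0 y * int p - max 0 (- y) * int p = int p * y" for y by (simp add: max_def)
    then show ?case using 13 s1 by (intro Q) auto
  qed (use s1 in auto)
  show ?thesis
    unfolding fold_step_def wp_Seq[of "Do _"] wp_Seq[of "drain_pos _ _ _ _ ;; drain_neg _ _ _ _ _"]
    using con
    by (auto simp: agree_def intro!: dr simp del: wp_Seq simp: wp_Seq[of "Do _"])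
qed

definition fold_loop :: com where
  "fold_loop = While (cand_com 4 2 ;; cand_com 5 0 ;; fold_guard) 9 fold_step"

text \<open>What is known about the best candidate found so far, when all positions from \<open>m\<close> to \<open>N\<close>
  have been inspected.\<close>

definition best_cand :: "int \<Rightarrow> int \<Rightarrow> int \<Rightarrow> nat \<Rightarrow> nat \<Rightarrow> config \<Rightarrow> bool" where
  "best_cand p X L N m s \<longleftrightarrow> (\<forall>i. m \<le> i \<and> i \<le> N \<longrightarrow> reg s 20 \<le> cand p X i) \<and>
     (\<exists>mb k. m \<le> mb \<and> mb \<le> N \<and> (k = 0 \<or> k = 1) \<and> reg s 21 = L + int mb \<and> reg s 23 = k \<and>
        reg s 22 = X div p ^ mb + k \<and> \<bar>reg s 22\<bar> \<le> 3 * p + 1 \<and> reg s 20 = dp p X mb k + \<bar>reg s 22\<bar>)"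

lemma best_cand_cong: "reg s' 20 = reg s 20 \<Longrightarrow> reg s' 21 = reg s 21 \<Longrightarrow> reg s' 22 = reg s 22 \<Longrightarrow>
    reg s' 23 = reg s 23 \<Longrightarrow> best_cand p X L N m s' = best_cand p X L N m s"
  by (simp add: best_cand_def)

text \<open>The second alternative of \<open>old\<close> describes the start of the search: nothing
  has been recorded, but register 20 is so large that the first candidate is certain to replace
  it.\<close>

lemma best_cand_step:
  assumes old: "best_cand p X L N (Suc m) s \<or> m = N \<and> reg s 20 > dp p X N 0 + \<bar>X div p ^ N\<bar>"
    and m: "m \<le> N" and R: "\<bar>X div p ^ m\<bar> \<le> 3 * p"
    and r: "r = X div p ^ m" "v0 = dp p X m 0 + \<bar>r\<bar>" "v1 = dp p X m 1 + \<bar>r + 1\<bar>"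
    and s1: "if v0 < reg s 20
      then reg s1 20 = v0 \<and> reg s1 21 = L + int m \<and> reg s1 22 = r \<and> reg s1 23 = 0
      else reg s1 20 = reg s 20 \<and> reg s1 21 = reg s 21 \<and> reg s1 22 = reg s 22 \<and> reg s1 23 = reg s 23"
    and s2: "if v1 < reg s1 20
      then reg s2 20 = v1 \<and> reg s2 21 = L + int m \<and> reg s2 22 = r + 1 \<and> reg s2 23 = 1
      else reg s2 20 = reg s1 20 \<and> reg s2 21 = reg s1 21 \<and> reg s2 22 = reg s1 22 \<and> reg s2 23 = reg s1 23"
  shows "best_cand p X L N m s2"
proof -
  have cm: "cand p X m = min v0 v1" by (simp add: cand_def r)
  have le: "reg s2 20 \<le> reg s 20" "reg s2 20 \<le> v0" "reg s2 20 \<le> v1"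
    using s1 s2 by (auto split: if_splits)
  have 1: "reg s2 20 \<le> cand p X i" if "m \<le> i" "i \<le> N" for i
  proof (cases "i = m")
    case True
    then show ?thesis using le cm by simp
  next
    case False
    then have "best_cand p X L N (Suc m) s" using old that by auto
    then have "reg s 20 \<le> cand p X i" using False that by (simp add: best_cand_def)
    then show ?thesis using le by simp
  qed
  consider "v1 < reg s1 20" | "\<not> v1 < reg s1 20" "v0 < reg s 20"
    | "\<not> v1 < reg s1 20" "\<not> v0 < reg s 20" by blast
  then have "\<exists>mb k. m \<le> mb \<and> mb \<le> N \<and> (k = 0 \<or> k = 1) \<and> reg s2 21 = L + int mb \<and> reg s2 23 = k \<and>
        reg s2 22 = X div p ^ mb + k \<and> \<bar>reg s2 22\<bar> \<le> 3 * p + 1 \<and> reg s2 20 = dp p X mb k + \<bar>reg s2 22\<bar>"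
  proof cases
    case 1
    then have "reg s2 20 = v1" "reg s2 21 = L + int m" "reg s2 22 = r + 1" "reg s2 23 = 1" using s2 by simp_all
    moreover have "\<bar>r + 1\<bar> \<le> 3 * p + 1" using R unfolding r by linarith
    ultimately show ?thesis using r m by (intro exI[of _ m] exI[of _ 1]) simp
  next
    case 2
    then have "reg s2 20 = v0" "reg s2 21 = L + int m" "reg s2 22 = r" "reg s2 23 = 0" using s1 s2 by simp_all
    then show ?thesis using r m R by (intro exI[of _ m] exI[of _ 0]) simp
  next
    case 3
    then have "\<not> (m = N \<and> reg s 20 > dp p X N 0 + \<bar>X div p ^ N\<bar>)" using r by auto
    then have "best_cand p X L N (Suc m) s" using old by blast
    then obtain mb k where "Suc m \<le> mb \<and> mb \<le> N \<and> (k = 0 \<or> k = 1) \<and> reg s 21 = L + int mb \<and> reg s 23 = k \<and>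
        reg s 22 = X div p ^ mb + k \<and> \<bar>reg s 22\<bar> \<le> 3 * p + 1 \<and> reg s 20 = dp p X mb k + \<bar>reg s 22\<bar>"
      unfolding best_cand_def by blast
    moreover have "reg s2 20 = reg s 20" "reg s2 21 = reg s 21" "reg s2 22 = reg s 22" "reg s2 23 = reg s 23"
      using 3 s1 s2 by simp_all
    ultimately show ?thesis by (intro exI[of _ mb] exI[of _ k]) (elim conjE, simp)
  qed
  with 1 show ?thesis unfolding best_cand_def by blast
qed

lemma fold_inspect_wp:
  assumes c: "consts_ok p s" and m: "m \<le> N" "reg s 24 = L + int m" "reg s 19 = X div int p ^ m"
      "\<bar>reg s 19\<bar> \<le> 3 * int p"
    and a: "val (arr s 4 (L + int m)) = dp (int p) X m 0" "val (arr s 5 (L + int m)) = dp (int p) X m 1"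
    and old: "best_cand (int p) X L N (Suc m) s \<or>
      m = N \<and> reg s 20 > dp (int p) X N 0 + \<bar>X div int p ^ N\<bar>"
  shows "wp (cand_com 4 2 ;; cand_com 5 0 ;; fold_guard) (\<lambda>s'. best_cand (int p) X L N m s' \<and>
     (reg s' 9 > 0 \<longleftrightarrow> reg s 24 > reg s 16 \<and> \<bar>reg s 19\<bar> \<le> 2) \<and>
     int (pc s') \<le> int (pc s) + 30 * int p + 50) s"
proof -
  have con: "reg s 0 = 1" "reg s 2 = 0" using c by (auto simp: consts_ok_def)
  show ?thesis
    unfolding wp_Seq
  proof (rule wp_frame[OF cand_com_wp[OF c, of 2 "reg s 19" "dp (int p) X m 0 + \<bar>reg s 19\<bar>" 4]], goal_cases)
    case (4 s1)
    have c1: "consts_ok p s1"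
      using consts_ok_agree[OF 4(2) c] by (simp add: cand_com_def)
    have s1: "reg s1 19 = reg s 19" "reg s1 24 = reg s 24" "reg s1 16 = reg s 16" "arr s1 = arr s" "reg s1 0 = 1"
      using 4(2) con by (simp_all add: agree_def cand_com_def fun_eq_iff)
    show ?case
    proof (rule wp_frame[OF cand_com_wp[OF c1, of 0 "reg s 19 + 1" "dp (int p) X m 1 + \<bar>reg s 19 + 1\<bar>" 5]],
        goal_cases)
      case (4 s2)
      have c2: "consts_ok p s2"
        using consts_ok_agree[OF 4(2) c1] by (simp add: cand_com_def)
      have s2: "reg s2 19 = reg s 19" "reg s2 24 = reg s 24" "reg s2 16 = reg s 16"
        using 4(2) s1 by (simp_all add: agree_def cand_com_def fun_eq_iff)
      have R: "\<bar>X div int p ^ m\<bar> \<le> 3 * int p" using m by simp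
      have bc: "best_cand (int p) X L N m s2"
        by (rule best_cand_step[OF old m(1) R m(3) HOL.refl HOL.refl, of s1])
          (use 4(1) \<open>(if _ then _ else _) \<and> int (pc s1) \<le> _\<close> s1 con m in auto)
      show ?case
      proof (rule wp_frame[OF fold_guard_wp[OF c2]], goal_cases)
        case (1 s3)
        have "reg s3 20 = reg s2 20" "reg s3 21 = reg s2 21" "reg s3 22 = reg s2 22" "reg s3 23 = reg s2 23"
          using 1(2) by (auto simp: agree_def fold_guard_def)
        then have "best_cand (int p) X L N m s3" using bc best_cand_cong by blast
        moreover have "int (pc s2) \<le> int (pc s) + 30 * int p + 40"
        proof -
          have "\<bar>reg s 19 + 1\<bar> \<le> 3 * int p + 1" using m(4) by simp
          moreover have "int (pc s2) \<le> int (pc s1) + 5 * \<bar>reg s 19 + 1\<bar> + 16" using 4(1) by blast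
          moreover have "int (pc s1) \<le> int (pc s) + 5 * \<bar>reg s 19\<bar> + 16"
            using \<open>(if _ then _ else _) \<and> int (pc s1) \<le> _\<close> by blast
          moreover have "x \<le> z + 10 * P + 40"
            if "a \<le> P + 1" "x \<le> y + 5 * a + 16" "y \<le> z + 5 * b + 16" "b \<le> P" for a b x y z P :: int
            using that by linarith
          ultimately have "int (pc s2) \<le> int (pc s) + 10 * (3 * int p) + 40" using m(4) by blast
          then show ?thesis by simp
        qed
        ultimately show ?case using 1(1) s2 by auto
      qed
    qed (use s1 m a in auto)
  qed (use con m a in auto)
qed


lemma fold_loop_wp:
  assumes p: "p \<ge> 2" and c: "consts_ok p s"
    and r: "reg s 24 = L + int N" "reg s 19 = X div int p ^ N" "reg s 16 = mx"
    and mx: "L \<le> mx" "mx \<le> L + int N" and X: "X div int p ^ N \<in> {0, - 1}"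
    and best: "reg s 20 > dp (int p) X N 0 + \<bar>X div int p ^ N\<bar>"
    and a: "\<forall>i\<le>N. val (arr s 4 (L + int i)) = dp (int p) X i 0 \<and> val (arr s 5 (L + int i)) = dp (int p) X i 1"
    and d: "\<forall>i<N. val (arr s 3 (L + int i)) = X div int p ^ i mod int p"
  shows "wp fold_loop (\<lambda>s'. \<exists>m\<le>N. mx \<le> L + int m \<and> (L + int m = mx \<or> 3 \<le> \<bar>X div int p ^ m\<bar>) \<and>
      best_cand (int p) X L N m s' \<and> int (pc s') \<le> int (pc s) + (30 * int p + 70) * (int N + 1)) s"
  unfolding fold_loop_def
proof (rule wp_While[where T = "nat (int (pc s) + (30 * int p + 70) * int N)" and
    I = "\<lambda>s'. \<exists>m\<le>N. mx \<le> L + int m \<and> reg s' 24 = L + int m \<and> reg s' 19 = X div int p ^ m \<and>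
      \<bar>reg s' 19\<bar> \<le> 3 * int p \<and> (best_cand (int p) X L N (Suc m) s' \<or>
      m = N \<and> reg s' 20 > dp (int p) X N 0 + \<bar>X div int p ^ N\<bar>) \<and>
      int (pc s') \<le> int (pc s) + (30 * int p + 70) * int (N - m)"], goal_cases)
  case 1
  have "\<bar>reg s 19\<bar> \<le> 3 * int p" using X r p by auto
  then show ?case using r mx best by (intro exI[of _ N]) simp
next
  case (2 s1)
  then obtain m where m: "m \<le> N" "int (pc s1) \<le> int (pc s) + (30 * int p + 70) * int (N - m)" by blast
  have "(30 * int p + 70) * int (N - m) \<le> (30 * int p + 70) * int N"
    by (intro mult_left_mono) auto
  then show ?case using m(2) by linarith
next
  case (3 s1)
  then obtain m where m: "m \<le> N" "mx \<le> L + int m" "reg s1 24 = L + int m" "reg s1 19 = X div int p ^ m"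
      "\<bar>reg s1 19\<bar> \<le> 3 * int p" and b: "best_cand (int p) X L N (Suc m) s1 \<or>
      m = N \<and> reg s1 20 > dp (int p) X N 0 + \<bar>X div int p ^ N\<bar>"
      and t: "int (pc s1) \<le> int (pc s) + (30 * int p + 70) * int (N - m)" by blast
  note ag = 3(2)
  have c1: "consts_ok p s1"
    using consts_ok_agree[OF ag c] by (simp add: cand_com_def fold_guard_def fold_step_def)
  have s1: "reg s1 16 = mx" "arr s1 3 = arr s 3" "arr s1 4 = arr s 4" "arr s1 5 = arr s 5"
    using agree_reg[OF ag, of 16] agree_arr[OF ag] r(3)
    by (simp_all add: cand_com_def fold_guard_def fold_step_def)
  have a1: "val (arr s1 4 (L + int m)) = dp (int p) X m 0" "val (arr s1 5 (L + int m)) = dp (int p) X m 1"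
    using a m(1) s1 by auto
  show ?case
  proof (rule wp_frame[OF fold_inspect_wp[OF c1 m(1,3,4,5) a1 b]], goal_cases)
    case (1 s2)
    have bc: "best_cand (int p) X L N m s2"
      and g: "reg s2 9 > 0 \<longleftrightarrow> reg s1 24 > reg s1 16 \<and> \<bar>reg s1 19\<bar> \<le> 2"
      and t2: "int (pc s2) \<le> int (pc s1) + 30 * int p + 50" using 1(1) by blast+
    have c2: "consts_ok p s2"
      using consts_ok_agree[OF 1(2) c1] by (simp add: cand_com_def fold_guard_def)
    have s2: "reg s2 24 = L + int m" "reg s2 19 = X div int p ^ m" "arr s2 3 = arr s 3" "reg s2 0 = 1"
      using agree_reg[OF 1(2)] agree_arr[OF 1(2), of 3] m s1 c1
      by (simp_all add: cand_com_def fold_guard_def consts_ok_def)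
    show ?case
    proof (cases "reg s2 9 > 0")
      case True
      then have gt: "mx < L + int m" "\<bar>X div int p ^ m\<bar> \<le> 2" using g m s1 by simp_all
      then obtain m' where m': "m = Suc m'" using mx(1) by (cases m) auto
      have "consts_ok p (tick s2)" using c2 by (simp add: consts_ok_def)
      then have "wp fold_step (\<lambda>s3. reg s3 0 > 0 \<and> (\<exists>m\<le>N. mx \<le> L + int m \<and> reg (tick s3) 24 = L + int m \<and>
        reg (tick s3) 19 = X div int p ^ m \<and> \<bar>reg (tick s3) 19\<bar> \<le> 3 * int p \<and>
        (best_cand (int p) X L N (Suc m) (tick s3) \<or>
          m = N \<and> reg (tick s3) 20 > dp (int p) X N 0 + \<bar>X div int p ^ N\<bar>) \<and>
        int (pc (tick s3)) \<le> int (pc s) + (30 * int p + 70) * int (N - m))) (tick s2)"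
      proof (rule wp_frame[OF fold_step_wp[OF _ p]], goal_cases)
        case (1 s3)
        have r0: "reg s3 0 = 1" using agree_reg[OF 1(2), of 0] s2 by (simp add: fold_step_def)
        have bc3: "best_cand (int p) X L N (Suc m') (tick s3)"
          using bc agree_reg[OF 1(2)] unfolding m' 
          by (subst best_cand_cong[of _ s2]) (simp_all add: fold_step_def)
        have r24: "reg s3 24 = L + int m'" using 1(1) s2 m' by simp
        have dig: "val (arr s 3 (L + int m')) = X div int p ^ m' mod int p" using d m(1) m' by simp
        have "reg s3 19 = val (arr s 3 (L + int m')) + int p * (X div int p ^ Suc m')"
          using 1(1) s2 m' by simp
        then have r19: "reg s3 19 = X div int p ^ m'"
          using div_power_digit[of "int p" X m'] p dig by simp
        \<comment> \<open>The loop goes on only from a quotient of absolute value at most 2, so the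
          next one is at most 2 p plus a digit. This keeps the unit-step arithmetic at constant cost
          per position.\<close>
        have bd: "\<bar>reg s3 19\<bar> \<le> 3 * int p"
        proof -
          have "reg s3 19 = int p * (X div int p ^ m) + X div int p ^ m' mod int p"
            using r19 div_power_digit[of "int p" X m'] p m' by simp
          moreover have "\<bar>int p * (X div int p ^ m)\<bar> \<le> int p * 2"
            using gt(2) p by (simp add: abs_mult)
          moreover have "0 \<le> X div int p ^ m' mod int p" "X div int p ^ m' mod int p < int p"
            using p by simp_all
          ultimately show ?thesis by linarith
        qed
        have "int (pc s3) \<le> int (pc s2) + 1 + 5 * 2 + 8" using 1(1) s2 gt(2) by simp
        then have "int (pc s3) + 1 \<le> int (pc s) + (30 * int p + 70) * int (N - m) + (30 * int p + 70)"
          using t2 t by linarith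
        also have "\<dots> = int (pc s) + (30 * int p + 70) * int (N - m')"
          using m(1) m' by (simp add: of_nat_diff algebra_simps)
        finally have t3: "int (pc (tick s3)) \<le> int (pc s) + (30 * int p + 70) * int (N - m')" by simp
        show ?case
        proof (intro conjI exI[of _ m'])
          show "0 < reg s3 0" using r0 by simp
        qed (use bc3 r24 r19 bd t3 m' m(1) gt(1) in simp_all)
      qed
      then show ?thesis using True s2 by simp
    next
      case False
      then have "L + int m = mx \<or> 3 \<le> \<bar>X div int p ^ m\<bar>" using g m s1 by auto
      moreover have "best_cand (int p) X L N m (tick (tick s2))"
        using bc by (subst best_cand_cong[of _ s2]) simp_all
      moreover have "int (pc (tick (tick s2))) \<le> int (pc s) + (30 * int p + 70) * (int N + 1)"
      proof -
        have "int (pc s2) + 2 \<le> int (pc s1) + (30 * int p + 70)" using t2 by simp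
        also have "\<dots> \<le> int (pc s) + (30 * int p + 70) * int (N - m) + (30 * int p + 70)"
          by (intro add_right_mono t)
        also have "\<dots> \<le> int (pc s) + (30 * int p + 70) * int N + (30 * int p + 70)"
          by (intro add_mono mult_left_mono order.refl) auto
        finally show ?thesis by (simp add: algebra_simps)
      qed
      ultimately have "\<exists>m\<le>N. mx \<le> L + int m \<and> (L + int m = mx \<or> 3 \<le> \<bar>X div int p ^ m\<bar>) \<and>
        best_cand (int p) X L N m (tick (tick s2)) \<and>
        int (pc (tick (tick s2))) \<le> int (pc s) + (30 * int p + 70) * (int N + 1)"
        using m(1,2) by (intro exI[of _ m] conjI) simp_all
      then show ?thesis using False s2 by simp
    qed
  qed
qed

text \<open>The topmost quotient is 0 or -1, so the initial value, 2 above the \<open>dp\<close>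
  entry, exceeds the first candidate.\<close>

definition fold_phase :: com where
  "fold_phase = Do (Add 24 13 2) ;; Do (Load 19 3 24) ;; Do (Load 20 4 24) ;; Do (Add 20 20 0) ;;
     Do (Add 20 20 0) ;; fold_loop"

lemma fold_phase_wp:
  assumes p: "p \<ge> 2" and c: "consts_ok p s"
    and r: "reg s 13 = L + int N" "reg s 16 = mx"
    and mx: "L \<le> mx" "mx \<le> L + int N" and X: "X div int p ^ N \<in> {0, - 1}"
    and a: "\<forall>i\<le>N. val (arr s 4 (L + int i)) = dp (int p) X i 0 \<and> val (arr s 5 (L + int i)) = dp (int p) X i 1"
    and d: "\<forall>i<N. val (arr s 3 (L + int i)) = X div int p ^ i mod int p"
      "val (arr s 3 (L + int N)) = X div int p ^ N"
  shows "wp fold_phase (\<lambda>s'. \<exists>m\<le>N. mx \<le> L + int m \<and> (L + int m = mx \<or> 3 \<le> \<bar>X div int p ^ m\<bar>) \<and>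
      best_cand (int p) X L N m s' \<and> int (pc s') \<le> int (pc s) + (30 * int p + 70) * (int N + 1) + 5) s"
proof -
  have "wp fold_loop (\<lambda>s'. \<exists>m\<le>N. mx \<le> L + int m \<and> (L + int m = mx \<or> 3 \<le> \<bar>X div int p ^ m\<bar>) \<and>
      best_cand (int p) X L N m s' \<and> int (pc s') \<le> int (pc s) + (30 * int p + 70) * (int N + 1) + 5) s1"
    if s1: "consts_ok p s1" "reg s1 24 = L + int N" "reg s1 19 = X div int p ^ N" "reg s1 16 = mx"
      "reg s1 20 = dp (int p) X N 0 + 2" "arr s1 = arr s" "pc s1 = pc s + 5" for s1
  proof (rule wp_mono[OF fold_loop_wp[OF p s1(1-4) mx X]], goal_cases)
    case 1
    show ?case using s1(5) X by auto
  next
    case (4 s')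
    then obtain m where "m \<le> N" "mx \<le> L + int m" "L + int m = mx \<or> 3 \<le> \<bar>X div int p ^ m\<bar>"
      "best_cand (int p) X L N m s'" "int (pc s') \<le> int (pc s1) + (30 * int p + 70) * (int N + 1)" by blast
    then show ?case using s1(7) by (intro exI[of _ m]) simp
  qed (use s1 a d in simp_all)
  then show ?thesis
    unfolding fold_phase_def wp_Seq wp_Do exec.simps using c r a d
    by (simp add: consts_ok_def del: dp.simps)
qed

section \<open>Tracing the carries back\<close>

definition back_body :: com where
  "back_body = Do (Sub 10 10 0) ;; Do (Load 17 4 10) ;; Do (Load 18 5 10) ;; Do (Load 11 3 10) ;;
     Do (Add 8 18 0) ;; If_pos 23 (Do (Sub 8 8 0) ;; Do (Sub 8 8 0) ;; Do (Sub 11 11 3)) Skip ;;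
     Do (Sub 9 17 8) ;; If_pos 9 (Do (Const 23 1) ;; Do (Add 11 11 0)) (Do (Const 23 0)) ;;
     Do (Store 3 10 11)"

text \<open>The incoming carry is not stored with the table but recovered by repeating the
  comparison inside \<open>dp\<close>; a tie yields carry 0.\<close>

lemma back_body_wp:
  assumes c: "consts_ok p s" and k: "reg s 23 = k" "k = 0 \<or> k = 1"
    and j: "j = reg s 10 - 1" and v: "val (arr s 4 j) = f0" "val (arr s 5 j) = f1" "val (arr s 3 j) = d"
    and k': "k' = (if f1 + 1 - 2 * k < f0 then 1 else 0)"
  shows "wp back_body (\<lambda>s'. reg s' 10 = j \<and> reg s' 23 = k' \<and>
     arr s' 3 = (arr s 3)(j := Some (d + k' - int p * k)) \<and> int (pc s') \<le> int (pc s) + 18) s"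
  using c k(2) j v k' k(1) unfolding back_body_def consts_ok_def
  by (cases "f1 + 1 - 2 * k < f0"; elim disjE) auto

lemma tail_cong:
  assumes "\<And>i. j \<le> i \<Longrightarrow> i \<le> hi \<Longrightarrow> D i = D' i"
  shows "tail p D hi j = tail p D' hi j"
  unfolding tail_def using assms by (intro sum.cong) auto

lemma abs_sum_cong:
  assumes "\<And>i. j \<le> i \<Longrightarrow> i \<le> hi \<Longrightarrow> D i = D' i"
  shows "abs_sum D hi j = abs_sum D' hi j"
  unfolding abs_sum_def using assms by (intro sum.cong) auto

definition back_loop :: com where
  "back_loop = While (Do (Sub 9 10 14)) 9 back_body"

text \<open>Going down, the digits already written, 2 for each position passed and the
  \<open>dp\<close> entry for the rest always add up to the cost of the chosen candidate. At the
  bottom that entry is 0. The digits overwrite the standard ones, which are no longer needed above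
  the current position.\<close>

lemma back_loop_wp:
  assumes p: "p \<ge> 2" and c: "consts_ok p s"
    and r: "reg s 10 = L + int N" "reg s 14 = L" "reg s 23 = k" "k = 0 \<or> k = 1" "N = 0 \<Longrightarrow> k = 0"
    and top: "val (arr s 3 (L + int N)) = X div int p ^ N + k" "\<bar>X div int p ^ N + k\<bar> \<le> 3 * int p + 1"
    and a: "\<forall>i<N. val (arr s 4 (L + int i)) = dp (int p) X i 0 \<and> val (arr s 5 (L + int i)) = dp (int p) X i 1"
    and d: "\<forall>i<N. val (arr s 3 (L + int i)) = X div int p ^ i mod int p"
  shows "wp back_loop (\<lambda>s'. tail p (\<lambda>j. val (arr s' 3 j)) (L + int N) L = X \<and>
      abs_sum (\<lambda>j. val (arr s' 3 j)) (L + int N) L + 2 * int N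
        = dp (int p) X N k + \<bar>X div int p ^ N + k\<bar> \<and>
      (\<forall>j. L \<le> j \<and> j \<le> L + int N \<longrightarrow> \<bar>val (arr s' 3 j)\<bar> \<le> 3 * int p + 1) \<and>
      int (pc s') \<le> int (pc s) + 21 * int N + 3) s"
  unfolding back_loop_def
proof (rule wp_While[where T = "nat (int (pc s) + 21 * int N)" and
    I = "\<lambda>s'. \<exists>m\<le>N. \<exists>k'. reg s' 10 = L + int m \<and> reg s' 23 = k' \<and> (k' = 0 \<or> k' = 1) \<and> (m = 0 \<longrightarrow> k' = 0) \<and>
      (\<forall>i<m. val (arr s' 3 (L + int i)) = X div int p ^ i mod int p) \<and>
      tail p (\<lambda>j. val (arr s' 3 j)) (L + int N) (L + int m) = X div int p ^ m + k' \<and>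
      abs_sum (\<lambda>j. val (arr s' 3 j)) (L + int N) (L + int m) + 2 * int (N - m) + dp (int p) X m k'
        = dp (int p) X N k + \<bar>X div int p ^ N + k\<bar> \<and>
      (\<forall>j. L + int m \<le> j \<and> j \<le> L + int N \<longrightarrow> \<bar>val (arr s' 3 j)\<bar> \<le> 3 * int p + 1) \<and>
      int (pc s') \<le> int (pc s) + 21 * int (N - m)"], goal_cases)
  case 1
  have "tail p (\<lambda>j. val (arr s 3 j)) (L + int N) (L + int N) = X div int p ^ N + k"
    "abs_sum (\<lambda>j. val (arr s 3 j)) (L + int N) (L + int N) = \<bar>X div int p ^ N + k\<bar>"
    using top by (simp_all add: tail_def abs_sum_def)
  moreover have "\<bar>val (arr s 3 j)\<bar> \<le> 3 * int p + 1" if "L + int N \<le> j \<and> j \<le> L + int N" for j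
  proof -
    have "j = L + int N" using that by simp
    then show ?thesis using top by simp
  qed
  ultimately show ?case
    using r top d by (intro exI[of _ N] exI[of _ k] conjI allI impI) (simp_all del: dp.simps)
next
  case (2 s1)
  then obtain m where m: "m \<le> N" "int (pc s1) \<le> int (pc s) + 21 * int (N - m)" by blast
  then have "int (pc s1) \<le> int (pc s) + 21 * int N" by (simp add: of_nat_diff)
  then show ?case by simp
next
  case (3 s1)
  then obtain m k' where m: "m \<le> N" "reg s1 10 = L + int m" "reg s1 23 = k'" and k': "k' = 0 \<or> k' = 1" "m = 0 \<longrightarrow> k' = 0"
    and dig: "\<forall>i<m. val (arr s1 3 (L + int i)) = X div int p ^ i mod int p"
    and tl: "tail p (\<lambda>j. val (arr s1 3 j)) (L + int N) (L + int m) = X div int p ^ m + k'"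
    and sm: "abs_sum (\<lambda>j. val (arr s1 3 j)) (L + int N) (L + int m) + 2 * int (N - m) + dp (int p) X m k'
        = dp (int p) X N k + \<bar>X div int p ^ N + k\<bar>"
    and bd: "\<forall>j. L + int m \<le> j \<and> j \<le> L + int N \<longrightarrow> \<bar>val (arr s1 3 j)\<bar> \<le> 3 * int p + 1"
    and t: "int (pc s1) \<le> int (pc s) + 21 * int (N - m)" by blast
  note ag = 3(2)
  have c1: "consts_ok p s1" using consts_ok_agree[OF ag c] by (simp add: back_body_def)
  have s1: "reg s1 14 = L" "arr s1 4 = arr s 4" "arr s1 5 = arr s 5" "reg s1 0 = 1"
    using agree_reg[OF ag, of 14] agree_arr[OF ag] r c1 by (simp_all add: back_body_def consts_ok_def)
  show ?case
  proof (cases m)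
    case 0
    have "k' = 0" using k' 0 by simp
    moreover have "int (pc (tick (tick (exec (Sub 9 10 14) s1)))) \<le> int (pc s) + 21 * int N + 3"
      using t 0 by simp
    ultimately show ?thesis using 0 m s1 tl sm bd by simp
  next
    case (Suc n)
    define d where "d = X div int p ^ n mod int p"
    define f0 f1 where "f0 = dp (int p) X n 0" and "f1 = dp (int p) X n 1"
    define k2 where "k2 = (if f1 + 1 - 2 * k' < f0 then 1 else 0 :: int)"
    define cc where "cc = d + k2 - int p * k'"
    have dd: "0 \<le> d" "d < int p" using p by (simp_all add: d_def)
    let ?s = "tick (exec (Sub 9 10 14) s1)"
    have "wp back_body (\<lambda>s2. reg s2 0 > 0 \<and> (\<exists>m\<le>N. \<exists>k'. reg (tick s2) 10 = L + int m \<and>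
      reg (tick s2) 23 = k' \<and> (k' = 0 \<or> k' = 1) \<and> (m = 0 \<longrightarrow> k' = 0) \<and>
      (\<forall>i<m. val (arr (tick s2) 3 (L + int i)) = X div int p ^ i mod int p) \<and>
      tail p (\<lambda>j. val (arr (tick s2) 3 j)) (L + int N) (L + int m) = X div int p ^ m + k' \<and>
      abs_sum (\<lambda>j. val (arr (tick s2) 3 j)) (L + int N) (L + int m) + 2 * int (N - m) + dp (int p) X m k'
        = dp (int p) X N k + \<bar>X div int p ^ N + k\<bar> \<and>
      (\<forall>j. L + int m \<le> j \<and> j \<le> L + int N \<longrightarrow> \<bar>val (arr (tick s2) 3 j)\<bar> \<le> 3 * int p + 1) \<and>
      int (pc (tick s2)) \<le> int (pc s) + 21 * int (N - m))) ?s"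
    proof (rule wp_frame[OF back_body_wp[of p _ k' "L + int n" f0 f1 d k2]], goal_cases)
      case (9 s2)
      have r0: "reg s2 0 = 1" using agree_reg[OF 9(2), of 0] s1 by (simp add: back_body_def)
      have a3: "arr s2 3 = (arr s1 3)(L + int n := Some cc)" using 9(1) by (simp add: cc_def)
      have above: "val (arr s2 3 j) = val (arr s1 3 j)" if "j \<ge> L + int m" for j
        using that Suc by (simp add: a3)
      have tl2: "tail p (\<lambda>j. val (arr s2 3 j)) (L + int N) (L + int n) = X div int p ^ n + k2"
      proof -
        have "tail p (\<lambda>j. val (arr s2 3 j)) (L + int N) (L + int n)
          = cc + int p * tail p (\<lambda>j. val (arr s2 3 j)) (L + int N) (L + int m)"
          using tail_rec[of "L + int n" "L + int N" p "\<lambda>j. val (arr s2 3 j)"] m(1) Suc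
          by (simp add: a3 algebra_simps)
        also have "tail p (\<lambda>j. val (arr s2 3 j)) (L + int N) (L + int m) = X div int p ^ m + k'"
          using tail_cong[of "L + int m" "L + int N" "\<lambda>j. val (arr s2 3 j)" "\<lambda>j. val (arr s1 3 j)" p] above tl
          by simp
        finally show ?thesis
          using div_power_digit[of "int p" X n] p Suc by (simp add: cc_def d_def algebra_simps del: power_Suc)
      qed
      have sm2: "abs_sum (\<lambda>j. val (arr s2 3 j)) (L + int N) (L + int n) + 2 * int (N - n) + dp (int p) X n k2
        = dp (int p) X N k + \<bar>X div int p ^ N + k\<bar>"
      proof -
        have "abs_sum (\<lambda>j. val (arr s2 3 j)) (L + int N) (L + int n)
          = \<bar>cc\<bar> + abs_sum (\<lambda>j. val (arr s2 3 j)) (L + int N) (L + int m)"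
          using abs_sum_rec[of "L + int n" "L + int N" "\<lambda>j. val (arr s2 3 j)"] m(1) Suc
          by (simp add: a3 algebra_simps)
        moreover have "abs_sum (\<lambda>j. val (arr s2 3 j)) (L + int N) (L + int m)
            = abs_sum (\<lambda>j. val (arr s1 3 j)) (L + int N) (L + int m)"
          using above by (intro abs_sum_cong) simp
        moreover have "int (N - n) = int (N - m) + 1" using m(1) Suc by simp
        \<comment> \<open>For \<open>0 \<le> d < p\<close> a carry coming in changes
          \<open>\<bar>p * k' - d\<bar>\<close> by exactly \<open>1 - 2 * k'\<close>, so the minimum
          in \<open>dp\<close> is the cost of the digit actually written.\<close>
        moreover have "dp (int p) X m k' = 2 + \<bar>cc\<bar> + dp (int p) X n k2"
        proof -
          have "dp (int p) X m k' = 2 + \<bar>int p * k' - d\<bar> + min f0 (f1 + 1 - 2 * k')"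
            by (simp add: Suc d_def f0_def f1_def)
          then show ?thesis
            using k'(1) dd by (elim disjE) (auto simp: k2_def cc_def f0_def[symmetric] f1_def[symmetric])
        qed
        ultimately show ?thesis using sm by simp
      qed
      have bd2: "\<bar>val (arr s2 3 j)\<bar> \<le> 3 * int p + 1" if "L + int n \<le> j" "j \<le> L + int N" for j
      proof (cases "j = L + int n")
        case True
        have "\<bar>cc\<bar> \<le> 3 * int p + 1" using k'(1) dd by (elim disjE) (auto simp: cc_def k2_def)
        then show ?thesis using True by (simp add: a3)
      next
        case False
        then show ?thesis using bd above[of j] that Suc by simp
      qed
      \<comment> \<open>At position 0 the table holds 0 and 2, and \<open>2 + 1 - 2 * k' < 0\<close>
        is false for both carries.\<close>
      have k20: "n = 0 \<longrightarrow> k2 = 0" using k'(1) by (auto simp: k2_def f0_def f1_def)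
      have t2: "int (pc (tick s2)) \<le> int (pc s) + 21 * int (N - n)"
        using 9(1) t m(1) Suc by (simp add: of_nat_diff)
      show ?case
      proof (intro conjI exI[of _ n] exI[of _ k2] allI impI)
        show "val (arr (tick s2) 3 (L + int i)) = X div int p ^ i mod int p" if "i < n" for i
          using that dig Suc by (simp add: a3)
        show "\<bar>val (arr (tick s2) 3 j)\<bar> \<le> 3 * int p + 1" if "L + int n \<le> j \<and> j \<le> L + int N" for j
          using bd2 that by simp
      qed (use r0 9(1) tl2 sm2 t2 k20 m(1) Suc in \<open>simp_all add: k2_def del: dp.simps\<close>)
    next
      case 5
      show ?case using s1 a m(1) Suc by (simp add: f0_def)
    next
      case 6
      show ?case using s1 a m(1) Suc by (simp add: f1_def)
    next
      case 7
      show ?case using dig Suc by (simp add: d_def)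
    next
      case 8
      show ?case by (simp add: k2_def)
    qed (use c1 m k' Suc in \<open>simp_all add: consts_ok_def\<close>)
    then show ?thesis using Suc m s1 by (simp del: dp.simps)
  qed
qed

definition back_phase :: com where
  "back_phase = Do (Add 10 21 2) ;; Do (Store 3 10 22) ;; back_loop"

lemma back_phase_wp:
  assumes p: "p \<ge> 2" and c: "consts_ok p s"
    and r: "reg s 21 = L + int N" "reg s 14 = L" "reg s 23 = k" "k = 0 \<or> k = 1" "N = 0 \<Longrightarrow> k = 0"
    and top: "reg s 22 = X div int p ^ N + k" "\<bar>reg s 22\<bar> \<le> 3 * int p + 1"
    and a: "\<forall>i<N. val (arr s 4 (L + int i)) = dp (int p) X i 0 \<and> val (arr s 5 (L + int i)) = dp (int p) X i 1"
    and d: "\<forall>i<N. val (arr s 3 (L + int i)) = X div int p ^ i mod int p"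
  shows "wp back_phase (\<lambda>s'. tail p (\<lambda>j. val (arr s' 3 j)) (L + int N) L = X \<and>
      abs_sum (\<lambda>j. val (arr s' 3 j)) (L + int N) L + 2 * int N = dp (int p) X N k + \<bar>reg s 22\<bar> \<and>
      (\<forall>j. L \<le> j \<and> j \<le> L + int N \<longrightarrow> \<bar>val (arr s' 3 j)\<bar> \<le> 3 * int p + 1) \<and>
      int (pc s') \<le> int (pc s) + 21 * int N + 5) s"
proof -
  have "wp back_loop (\<lambda>s'. tail p (\<lambda>j. val (arr s' 3 j)) (L + int N) L = X \<and>
      abs_sum (\<lambda>j. val (arr s' 3 j)) (L + int N) L + 2 * int N = dp (int p) X N k + \<bar>reg s 22\<bar> \<and>
      (\<forall>j. L \<le> j \<and> j \<le> L + int N \<longrightarrow> \<bar>val (arr s' 3 j)\<bar> \<le> 3 * int p + 1) \<and>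
      int (pc s') \<le> int (pc s) + 21 * int N + 5) s1"
    if s1: "consts_ok p s1" "reg s1 10 = L + int N" "reg s1 14 = L" "reg s1 23 = k"
      "arr s1 3 = (arr s 3)(L + int N := Some (reg s 22))" "arr s1 4 = arr s 4" "arr s1 5 = arr s 5"
      "pc s1 = pc s + 2" for s1
    by (rule wp_mono[OF back_loop_wp[OF p s1(1-4) r(4,5), of X]])
      (use s1 a d top in \<open>simp_all del: dp.simps\<close>)
  then show ?thesis
    unfolding back_phase_def wp_Seq wp_Do exec.simps using c r
    by (simp add: consts_ok_def del: dp.simps)
qed

section \<open>Writing the geodesic word\<close>

definition out_ok :: "config \<Rightarrow> word \<Rightarrow> bool" where
  "out_ok s w \<longleftrightarrow> arr s 0 = array_of (word_code w) \<and> reg s 26 = int (length w)"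

lemma array_of_snoc: "(array_of xs)(int (length xs) := Some v) = array_of (xs @ [v])"
  by (auto simp: array_of_def fun_eq_iff nth_append)

lemma out_ok_snoc:
  assumes "out_ok s w" "arr s' 0 = (arr s 0)(reg s 26 := Some (letter_code x))" "reg s' 26 = reg s 26 + 1"
  shows "out_ok s' (w @ [x])"
  using assms array_of_snoc[of "word_code w" "letter_code x"]
  by (simp add: out_ok_def word_code_def)

definition emit :: "nat \<Rightarrow> nat \<Rightarrow> com" where
  "emit x c = While Skip x (Do (Store 0 26 c) ;; Do (Add 26 26 0) ;; Do (Sub x x 0))"

lemma emit_wp:
  assumes "reg s 0 = 1" "out_ok s w" "reg s c = letter_code a" "x \<notin> {0, 26, c}" "c \<noteq> 26"
  shows "wp (emit x c) (\<lambda>s'. out_ok s' (w @ replicate (nat (reg s x)) a) \<and>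
     int (pc s') \<le> int (pc s) + 5 * max 0 (reg s x) + 2) s"
  unfolding emit_def
proof (rule wp_While[where T = "nat (int (pc s) + 5 * max 0 (reg s x))" and
    I = "\<lambda>s'. \<exists>i. i \<le> nat (reg s x) \<and> reg s' x = reg s x - int i \<and> out_ok s' (w @ replicate i a) \<and>
      int (pc s') \<le> int (pc s) + 5 * int i"], goal_cases)
  case 1
  then show ?case using assms by (intro exI[of _ 0]) simp
next
  case (2 s1)
  then obtain i where i: "i \<le> nat (reg s x)" "int (pc s1) \<le> int (pc s) + 5 * int i" by blast
  then have "int i \<le> max 0 (reg s x)" by simp
  then have "int (pc s1) \<le> int (pc s) + 5 * max 0 (reg s x)" using i(2) by linarith
  then show ?case by simp
next
  case (3 s1)
  then obtain i where i: "i \<le> nat (reg s x)" "reg s1 x = reg s x - int i" "out_ok s1 (w @ replicate i a)"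
      "int (pc s1) \<le> int (pc s) + 5 * int i" by blast
  have s1: "reg s1 0 = 1" "reg s1 c = letter_code a" using 3(2) assms by (simp_all add: agree_def)
  show ?case
  proof (cases "int i < reg s x")
    case True
    have "out_ok (tick (exec (Sub x x 0) (exec (Add 26 26 0) (exec (Store 0 26 c) (tick s1)))))
        ((w @ replicate i a) @ [a])"
      by (rule out_ok_snoc[OF i(3)]) (use s1 assms in auto)
    then have "out_ok (tick (exec (Sub x x 0) (exec (Add 26 26 0) (exec (Store 0 26 c) (tick s1)))))
        (w @ replicate (Suc i) a)"
      by (simp only: append_assoc replicate_append_same replicate_Suc)
    then show ?thesis using True i s1 assms by (auto intro!: exI[of _ "Suc i"] simp del: replicate_Suc)
  next
    case False
    then have ii: "nat (reg s x) = i" and im: "int i = max 0 (reg s x)" using i(1) by simp_all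
    then have "int (pc s1) \<le> int (pc s) + 5 * max 0 (reg s x)" using i(4) by simp
    then show ?thesis using False i(2,3) s1 unfolding ii by (simp add: out_ok_def)
  qed
qed

lemma wregs_emit [simp]: "wregs (emit x c) = {26, x}" "warrs (emit x c) = {0}"
  by (auto simp: emit_def)

text \<open>\<open>emit\<close> uses up its counter, so the digit is loaded again for the opposite
  sign. At most one of the two loops writes anything.\<close>

definition digit_emit :: com where
  "digit_emit = Do (Const 35 1) ;; Do (Const 36 2) ;; Do (Load 11 3 10) ;; emit 11 35 ;;
     Do (Load 11 3 10) ;; Do (Sub 11 2 11) ;; emit 11 36"

lemma digit_emit_wp:
  assumes c: "consts_ok p s" and w: "out_ok s w" and y: "val (arr s 3 (reg s 10)) = y"
  shows "wp digit_emit (\<lambda>s'. out_ok s' (w @ apow y) \<and> int (pc s') \<le> int (pc s) + 5 * \<bar>y\<bar> + 9) s"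
proof -
  have con: "reg s 0 = 1" "reg s 2 = 0" using c by (simp_all add: consts_ok_def)
  have ap: "(w @ replicate (nat y) A_pos) @ replicate (nat (- y)) A_neg = w @ apow y"
    by (simp add: apow_def)
  have e2: "wp (emit 11 36) (\<lambda>s'. out_ok s' (w @ apow y) \<and> int (pc s') \<le> int (pc s) + 5 * \<bar>y\<bar> + 9) s1"
    if s1: "reg s1 0 = 1" "out_ok s1 (w @ replicate (nat y) A_pos)" "reg s1 36 = 2" "reg s1 11 = - y"
      "int (pc s1) \<le> int (pc s) + 5 * max 0 y + 7" for s1
  proof (rule wp_mono[OF emit_wp[OF s1(1,2), of 36 A_neg 11]], goal_cases)
    case (4 s2)
    have "out_ok s2 (w @ apow y)" using 4 s1(4) ap by simp
    moreover have "int (pc s2) \<le> int (pc s1) + 5 * max 0 (- y) + 2" using 4 s1(4) by simp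
    then have "int (pc s2) \<le> int (pc s) + 5 * max 0 y + 5 * max 0 (- y) + 9" using s1(5) by simp
    moreover have "5 * max 0 y + 5 * max 0 (- y) = 5 * \<bar>y\<bar>" by (simp add: max_def)
    ultimately show ?case by simp
  qed (use s1 in simp_all)
  have e1: "wp (emit 11 35 ;; Do (Load 11 3 10) ;; Do (Sub 11 2 11) ;; emit 11 36)
      (\<lambda>s'. out_ok s' (w @ apow y) \<and> int (pc s') \<le> int (pc s) + 5 * \<bar>y\<bar> + 9) s1"
    if s1: "reg s1 0 = 1" "out_ok s1 w" "reg s1 35 = 1" "reg s1 36 = 2" "reg s1 11 = y" "reg s1 10 = reg s 10"
      "arr s1 3 = arr s 3" "reg s1 2 = 0" "pc s1 = pc s + 3" for s1
    unfolding wp_Seq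
  proof (rule wp_frame[OF emit_wp[OF s1(1,2), of 35 A_pos 11]], goal_cases)
    case (4 s2)
    have s2: "reg s2 0 = 1" "reg s2 2 = 0" "reg s2 10 = reg s 10" "reg s2 36 = 2" "arr s2 3 = arr s 3"
      using 4(2) s1 by (simp_all add: agree_def)
    show ?case
      unfolding wp_Do exec.simps straight.simps
      by (intro conjI TrueI e2) (use 4(1) s1 s2 y in \<open>simp_all add: out_ok_def\<close>)
  qed (use s1 in simp_all)
  show ?thesis
    unfolding digit_emit_def wp_Seq[of "Do (Const _ _)"]
      wp_Seq[of "Do (Load 11 3 10)" "emit 11 35 ;; Do (Load 11 3 10) ;; Do (Sub 11 2 11) ;; emit 11 36"]
      wp_Do exec.simps straight.simps
    by (intro conjI TrueI e1) (use con w y in \<open>simp_all add: out_ok_def\<close>)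
qed


text \<open>The recursion appends on the right, in the order in which the loop writes; the digit at
  the starting position \<open>j\<close> is left out and written beforehand.\<close>

primrec trav :: "(int \<Rightarrow> int) \<Rightarrow> letter \<Rightarrow> int \<Rightarrow> int \<Rightarrow> nat \<Rightarrow> word" where
  "trav c x j st 0 = []"
| "trav c x j st (Suc n) = trav c x j st n @ x # apow (c (j + st * int (Suc n)))"

definition trav_body :: com where
  "trav_body = Do (Sub 30 30 0) ;; Do (Store 0 26 28) ;; Do (Add 26 26 0) ;; Do (Add 10 10 29) ;; digit_emit"

definition trav_loop :: com where
  "trav_loop = While Skip 30 trav_body"

lemma wregs_digit_emit [simp]: "wregs digit_emit = {11, 26, 35, 36}" "warrs digit_emit = {0}"
  by (auto simp: digit_emit_def)

lemma trav_body_wp: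
  assumes c: "consts_ok p s" and w: "out_ok s w" and x: "reg s 28 = letter_code x"
    and y: "val (arr s 3 (reg s 10 + reg s 29)) = y"
  shows "wp trav_body (\<lambda>s'. out_ok s' (w @ x # apow y) \<and> reg s' 30 = reg s 30 - 1 \<and>
    reg s' 10 = reg s 10 + reg s 29 \<and> int (pc s') \<le> int (pc s) + 5 * \<bar>y\<bar> + 13) s"
proof -
  have con: "reg s 0 = 1" using c by (simp add: consts_ok_def)
  let ?s = "exec (Add 10 10 29) (exec (Add 26 26 0) (exec (Store 0 26 28) (exec (Sub 30 30 0) s)))"
  have "wp digit_emit (\<lambda>s'. out_ok s' (w @ x # apow y) \<and> reg s' 30 = reg s 30 - 1 \<and>
    reg s' 10 = reg s 10 + reg s 29 \<and> int (pc s') \<le> int (pc s) + 5 * \<bar>y\<bar> + 13) ?s"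
  proof (rule wp_frame[OF digit_emit_wp[of p _ "w @ [x]" y]], goal_cases)
    case 1
    show ?case using c by (simp add: consts_ok_def)
  next
    case 2
    show ?case by (rule out_ok_snoc[OF w]) (use x con in simp_all)
  next
    case 3
    show ?case using y by simp
  next
    case (4 s2)
    then show ?case using agree_reg[OF 4(2), of 30] agree_reg[OF 4(2), of 10] con by simp
  qed
  then show ?thesis by (simp add: trav_body_def)
qed

lemma trav_loop_wp:
  assumes c: "consts_ok p s" and w: "out_ok s w" and x: "reg s 28 = letter_code x"
    and r: "reg s 29 = st" "reg s 10 = j" "reg s 30 = int n"
    and D: "D = (\<lambda>j. val (arr s 3 j))" "\<forall>i\<le>n. \<bar>D (j + st * int i)\<bar> \<le> C"
  shows "wp trav_loop (\<lambda>s'. out_ok s' (w @ trav D x j st n) \<and>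
     int (pc s') \<le> int (pc s) + (5 * C + 15) * int n + 2) s"
  unfolding trav_loop_def
proof (rule wp_While[where T = "nat (int (pc s) + (5 * C + 15) * int n)" and
    I = "\<lambda>s'. \<exists>i\<le>n. reg s' 30 = int (n - i) \<and> reg s' 10 = j + st * int i \<and>
      out_ok s' (w @ trav D x j st i) \<and> int (pc s') \<le> int (pc s) + (5 * C + 15) * int i"], goal_cases)
  case 1
  then show ?case using w r by (intro exI[of _ 0]) simp
next
  case (2 s1)
  then obtain i where i: "i \<le> n" "int (pc s1) \<le> int (pc s) + (5 * C + 15) * int i" by blast
  have "0 \<le> C" using D(2) abs_ge_zero by (meson le0 order_trans)
  then have "(5 * C + 15) * int i \<le> (5 * C + 15) * int n"
    using i(1) by (intro mult_left_mono) auto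
  then show ?case using i(2) by linarith
next
  case (3 s1)
  then obtain i where i: "i \<le> n" "reg s1 30 = int (n - i)" "reg s1 10 = j + st * int i"
      "out_ok s1 (w @ trav D x j st i)" "int (pc s1) \<le> int (pc s) + (5 * C + 15) * int i" by blast
  note ag = 3(2)
  have c1: "consts_ok p s1" using consts_ok_agree[OF ag c] by (simp add: trav_body_def)
  have s1: "reg s1 28 = letter_code x" "reg s1 29 = st" "arr s1 3 = arr s 3" "reg s1 0 = 1"
    using agree_reg[OF ag] agree_arr[OF ag, of 3] x r c1 by (simp_all add: trav_body_def consts_ok_def)
  show ?case
  proof (cases "i < n")
    case True
    let ?y = "D (j + st * int (Suc i))"
    have "wp trav_body (\<lambda>s2. reg s2 0 > 0 \<and> (\<exists>i\<le>n. reg (tick s2) 30 = int (n - i) \<and>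
      reg (tick s2) 10 = j + st * int i \<and> out_ok (tick s2) (w @ trav D x j st i) \<and>
      int (pc (tick s2)) \<le> int (pc s) + (5 * C + 15) * int i)) (tick s1)"
    proof (rule wp_frame[OF trav_body_wp[of p _ "w @ trav D x j st i" x ?y]], goal_cases)
      case 1
      show ?case using c1 by (simp add: consts_ok_def)
    next
      case 2
      show ?case using i(4) by (simp add: out_ok_def)
    next
      case 3
      show ?case using s1 by simp
    next
      case 4
      show ?case using s1 i(3) D(1) by (simp add: algebra_simps)
    next
      case (5 s2)
      have r0: "reg s2 0 = 1" using agree_reg[OF 5(2), of 0] s1 by (simp add: trav_body_def)
      have "\<bar>?y\<bar> \<le> C" using D(2) True Suc_leI by blast
      then have "int (pc s2) + 1 \<le> int (pc s) + (5 * C + 15) * int i + (5 * C + 15)"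
        using 5(1) i(5) by simp
      then have t: "int (pc (tick s2)) \<le> int (pc s) + (5 * C + 15) * int (Suc i)"
        by (simp add: algebra_simps)
      have o: "out_ok (tick s2) (w @ trav D x j st (Suc i))"
        using 5(1) by (simp add: out_ok_def)
      show ?case
        using r0 5(1) i True s1 t o
        by (intro conjI exI[of _ "Suc i"]) (simp_all add: algebra_simps of_nat_diff del: trav.simps)
    qed
    then show ?thesis using True i s1 by simp
  next
    case False
    then have "i = n" using i(1) by simp
    then show ?thesis using i s1 by (simp add: out_ok_def)
  qed
qed

lemma length_trav_up:
  "int (length (apow (c j) @ trav c x j 1 n)) = int n + abs_sum c (j + int n) j"
proof (induction n)
  case (Suc n)
  have split: "{j..j + int (Suc n)} = insert (j + int (Suc n)) {j..j + int n}" by auto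
  show ?case using Suc unfolding abs_sum_def split by simp
qed (simp add: abs_sum_def)

lemma length_trav_down:
  "int (length (apow (c j) @ trav c x j (- 1) n)) = int n + abs_sum c j (j - int n)"
proof (induction n)
  case (Suc n)
  have split: "{j - int (Suc n)..j} = insert (j - int (Suc n)) {j - int n..j}" by auto
  have idx: "j + - 1 * int (Suc n) = j - int (Suc n)" by simp
  show ?case using Suc unfolding abs_sum_def split trav.simps idx by simp
qed (simp add: abs_sum_def)

lemma trav_up:
  assumes "p > 0"
  shows "ht (apow (c j) @ trav c T_pos j 1 n) = int n \<and>
    real p powi j * transl p (apow (c j) @ trav c T_pos j 1 n) = (\<Sum>i=j..j + int n. of_int (c i) * real p powi i)"
proof (induction n)
  case (Suc n)
  let ?w = "apow (c j) @ trav c T_pos j 1 n"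
  have split: "{j..j + int (Suc n)} = insert (j + int (Suc n)) {j..j + int n}" by auto
  have w: "apow (c j) @ trav c T_pos j 1 (Suc n) = ?w @ T_pos # apow (c (j + int (Suc n)))" by simp
  have h: "ht ?w = int n" using Suc by blast
  have "real p powi j * (real p powi int n * real p) = real p powi (j + int (Suc n))"
    using assms by (simp add: power_int_add)
  then have "real p powi j * transl p (?w @ T_pos # apow (c (j + int (Suc n))))
      = real p powi j * transl p ?w + of_int (c (j + int (Suc n))) * real p powi (j + int (Suc n))"
    unfolding transl_append[OF assms, of ?w] h by (simp add: algebra_simps)
  moreover have "ht (?w @ T_pos # apow (c (j + int (Suc n)))) = int (Suc n)"
    unfolding ht_append[of ?w] h by simp
  ultimately show ?case using Suc unfolding w split by simp
qed (simp add: ht_append)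

lemma trav_down:
  assumes "p > 0"
  shows "ht (apow (c j) @ trav c T_neg j (- 1) n) = - int n \<and>
    real p powi j * transl p (apow (c j) @ trav c T_neg j (- 1) n) = (\<Sum>i=j - int n..j. of_int (c i) * real p powi i)"
proof (induction n)
  case (Suc n)
  let ?w = "apow (c j) @ trav c T_neg j (- 1) n"
  have split: "{j - int (Suc n)..j} = insert (j - int (Suc n)) {j - int n..j}" by auto
  have idx: "j + - 1 * int (Suc n) = j - int (Suc n)" by simp
  have w: "apow (c j) @ trav c T_neg j (- 1) (Suc n) = ?w @ T_neg # apow (c (j - int (Suc n)))"
    unfolding trav.simps idx by simp
  have h: "ht ?w = - int n" using Suc by blast
  have "real p powi (- int n + - 1) = real p powi (- int n) * real p powi (- 1)"
    using assms by (intro power_int_add) simp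
  moreover have "real p powi (j + (- int n + - 1)) = real p powi j * real p powi (- int n + - 1)"
    using assms by (intro power_int_add) simp
  moreover have "real p powi (- 1) = inverse (real p)" by (simp add: power_int_minus)
  moreover have "j - int (Suc n) = j + (- int n + - 1)" by simp
  ultimately have "real p powi (j - int (Suc n)) = real p powi j * (real p powi (- int n) * inverse (real p))"
    by (simp only:)
  then have "real p powi j * transl p (?w @ T_neg # apow (c (j - int (Suc n))))
      = real p powi j * transl p ?w + of_int (c (j - int (Suc n))) * real p powi (j - int (Suc n))"
    unfolding transl_append[OF assms, of ?w] h by (simp add: algebra_simps divide_inverse)
  moreover have "ht (?w @ T_neg # apow (c (j - int (Suc n)))) = - int (Suc n)"
    unfolding ht_append[of ?w] h by simp
  ultimately show ?case using Suc unfolding w split by simp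
qed (simp add: ht_append)

text \<open>All digits are written during the one sweep through the whole range. Its direction is
  opposite to the two outer legs and agrees with the sign of \<open>h\<close>, which makes the
  number of letters t and inverse t exactly \<open>2 * N - \<bar>h\<bar>\<close>.\<close>

definition geo_word :: "(int \<Rightarrow> int) \<Rightarrow> int \<Rightarrow> int \<Rightarrow> nat \<Rightarrow> word" where
  "geo_word c h L N = (if h < 0
     then replicate (nat (L + int N)) T_pos @ (apow (c (L + int N)) @ trav c T_neg (L + int N) (- 1) N) @
       replicate (nat (h - L)) T_pos
     else replicate (nat (- L)) T_neg @ (apow (c L) @ trav c T_pos L 1 N) @
       replicate (nat (L + int N - h)) T_neg)"

lemma geo_word_props:
  assumes p: "p > 0" and L: "L \<le> min 0 h" "max 0 h \<le> L + int N"
  shows "ht (geo_word c h L N) = h"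
    and "transl p (geo_word c h L N) = of_int (tail p c (L + int N) L) * real p powi L"
    and "int (length (geo_word c h L N)) = 2 * int N - \<bar>h\<bar> + abs_sum c (L + int N) L"
proof -
  let ?u = "apow (c L) @ trav c T_pos L 1 N" and ?d = "apow (c (L + int N)) @ trav c T_neg (L + int N) (- 1) N"
  have u: "ht ?u = int N" "real p powi L * transl p ?u = of_int (tail p c (L + int N) L) * real p powi L"
    using trav_up[OF p, of c L N] tail_real[OF p, of c L "L + int N"] by simp_all
  have d: "ht ?d = - int N" "real p powi (L + int N) * transl p ?d = of_int (tail p c (L + int N) L) * real p powi L"
    using trav_down[OF p, of c "L + int N" N] tail_real[OF p, of c L "L + int N"] by simp_all
  show "ht (geo_word c h L N) = h"
    using L u(1) d(1) unfolding geo_word_def ht_append by (auto simp: ht_append)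
  show "transl p (geo_word c h L N) = of_int (tail p c (L + int N) L) * real p powi L"
  proof (cases "h < 0")
    case True
    have "transl p (replicate a T_pos @ m @ replicate b T_pos) = real p powi (int a) * transl p m" for a b m
      by (simp add: transl_append[OF p])
    then have "transl p (geo_word c h L N) = real p powi (int (nat (L + int N))) * transl p ?d"
      by (simp only: geo_word_def True if_True)
    moreover have "int (nat (L + int N)) = L + int N" using L by simp
    ultimately show ?thesis using d(2) by (simp only:)
  next
    case False
    have "transl p (replicate a T_neg @ m @ replicate b T_neg) = real p powi (- int a) * transl p m" for a b m
      by (simp add: transl_append[OF p])
    then have "transl p (geo_word c h L N) = real p powi (- int (nat (- L))) * transl p ?u"
      by (simp only: geo_word_def False if_False)
    moreover have "- int (nat (- L)) = L" using L by simp
    ultimately show ?thesis using u(2) by (simp only:)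
  qed
  show "int (length (geo_word c h L N)) = 2 * int N - \<bar>h\<bar> + abs_sum c (L + int N) L"
    using L length_trav_up[of c L T_pos N] length_trav_down[of c "L + int N" T_neg N]
    by (auto simp: geo_word_def)
qed

definition output_phase :: com where
  "output_phase =
     Do (Sub 8 2 4) ;; Do (Sub 30 21 14) ;;
     If_pos 8
       (Do (Add 10 21 2) ;; Do (Add 31 21 2) ;; Do (Sub 32 4 14) ;;
        Do (Const 27 3) ;; Do (Const 28 4) ;; Do (Const 29 (- 1)))
       (Do (Add 10 14 2) ;; Do (Sub 31 2 14) ;; Do (Sub 32 21 4) ;;
        Do (Const 27 4) ;; Do (Const 28 3) ;; Do (Const 29 1)) ;;
     emit 31 27 ;; (digit_emit ;; trav_loop) ;; emit 32 27"

lemma wregs_trav_loop [simp]: "wregs trav_loop = {10, 11, 26, 30, 35, 36}" "warrs trav_loop = {0}"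
  by (auto simp: trav_loop_def trav_body_def)

lemma emit_trav_emit_wp:
  assumes c: "consts_ok p s" and w: "out_ok s []" and x: "reg s 28 = letter_code x" "reg s 27 = letter_code y"
    and r: "reg s 29 = st" "reg s 10 = j" "reg s 30 = int n" "reg s 31 = n1" "reg s 32 = n3"
    and D: "D = (\<lambda>j. val (arr s 3 j))" "\<forall>i\<le>n. \<bar>D (j + st * int i)\<bar> \<le> C"
    and n: "n1 \<le> int n" "n3 \<le> int n"
  shows "wp (emit 31 27 ;; (digit_emit ;; trav_loop) ;; emit 32 27) (\<lambda>s'.
     out_ok s' (replicate (nat n1) y @ (apow (D j) @ trav D x j st n) @ replicate (nat n3) y) \<and>
     int (pc s') \<le> int (pc s) + (5 * C + 25) * (int n + 1)) s"
  unfolding wp_Seq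
proof (rule wp_frame[OF emit_wp[OF _ w x(2)]], goal_cases)
  case (4 s1)
  have c1: "consts_ok p s1" using consts_ok_agree[OF 4(2) c] by simp
  have s1: "reg s1 28 = letter_code x" "reg s1 27 = letter_code y" "reg s1 29 = st" "reg s1 10 = j" "reg s1 30 = int n"
     "reg s1 32 = n3" "arr s1 3 = arr s 3"
    using agree_reg[OF 4(2)] agree_arr[OF 4(2), of 3] x r by simp_all
  have o1: "out_ok s1 (replicate (nat n1) y)" "int (pc s1) \<le> int (pc s) + 5 * max 0 n1 + 2"
    using 4(1) r by simp_all
  show ?case
  proof (rule wp_frame[OF digit_emit_wp[OF c1 o1(1), of "D j"]], goal_cases)
    case 1
    show ?case using s1 D by simp
  next
    case (2 s2)
    have c2: "consts_ok p s2" using consts_ok_agree[OF 2(2) c1] by simp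
    have s2: "reg s2 28 = letter_code x" "reg s2 27 = letter_code y" "reg s2 29 = st" "reg s2 10 = j"
      "reg s2 30 = int n" "reg s2 32 = n3" "arr s2 3 = arr s 3"
      using agree_reg[OF 2(2)] agree_arr[OF 2(2), of 3] s1 by simp_all
    have o2: "out_ok s2 (replicate (nat n1) y @ apow (D j))" "int (pc s2) \<le> int (pc s1) + 5 * \<bar>D j\<bar> + 9"
      using 2(1) by simp_all
    show ?case
    proof (rule wp_frame[OF trav_loop_wp[OF c2 o2(1) s2(1,3,4,5), of D C]], goal_cases)
      case 1
      show ?case using s2 D by simp
    next
      case 2
      show ?case by (rule D(2))
    next
      case (3 s3)
      have s3: "reg s3 0 = 1" "reg s3 27 = letter_code y" "reg s3 32 = n3"
        using agree_reg[OF 3(2)] s2 c2 by (simp_all add: consts_ok_def)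
      show ?case
      proof (rule wp_mono[OF emit_wp[OF s3(1) conjunct1[OF 3(1)] s3(2)]], goal_cases)
        case (3 s4)
        have "int (pc s3) \<le> int (pc s2) + (5 * C + 15) * int n + 2"
          using \<open>_ \<and> int (pc s3) \<le> _\<close> by blast
        moreover have "int (pc s4) \<le> int (pc s3) + 5 * max 0 n3 + 2" using 3 s3 by simp
        moreover have "\<bar>D j\<bar> \<le> C" using D(2) by (metis le0 mult_zero_right add.right_neutral of_nat_0)
        moreover have "max 0 n1 \<le> int n" "max 0 n3 \<le> int n" using n by simp_all
        moreover have "(5 * C + 25) * (int n + 1) = (5 * C + 15) * int n + 10 * int n + 5 * C + 25"
          by (simp add: algebra_simps)
        ultimately have "int (pc s4) \<le> int (pc s) + (5 * C + 25) * (int n + 1)"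
          using o1(2) o2(2) by simp
        then show ?case using 3 s3 by simp
      qed simp_all
    qed
  qed
qed (use c in \<open>simp_all add: consts_ok_def\<close>)

lemma output_phase_wp:
  assumes c: "consts_ok p s" and w: "out_ok s []"
    and r: "reg s 4 = h" "reg s 14 = L" "reg s 21 = L + int N"
    and L: "L \<le> min 0 h" "max 0 h \<le> L + int N"
    and D: "D = (\<lambda>j. val (arr s 3 j))" "\<forall>j. L \<le> j \<and> j \<le> L + int N \<longrightarrow> \<bar>D j\<bar> \<le> C"
  shows "wp output_phase (\<lambda>s'. out_ok s' (geo_word D h L N) \<and>
    int (pc s') \<le> int (pc s) + (5 * C + 25) * (int N + 1) + 12) s"
proof -
  have con: "reg s 0 = 1" "reg s 2 = 0" using c by (simp_all add: consts_ok_def)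
  have up: "\<forall>i\<le>N. \<bar>D (L + 1 * int i)\<bar> \<le> C"
    using D(2) by simp
  have down: "\<forall>i\<le>N. \<bar>D (L + int N + - 1 * int i)\<bar> \<le> C"
    using D(2) by simp
  show ?thesis
  proof (cases "h < 0")
    case True
    have e: "wp (emit 31 27 ;; (digit_emit ;; trav_loop) ;; emit 32 27) (\<lambda>s'. out_ok s' (geo_word D h L N) \<and>
      int (pc s') \<le> int (pc s) + (5 * C + 25) * (int N + 1) + 12) s1"
      if s1: "consts_ok p s1" "out_ok s1 []" "reg s1 28 = 4" "reg s1 27 = 3" "reg s1 29 = - 1"
        "reg s1 10 = L + int N" "reg s1 30 = int N" "reg s1 31 = L + int N" "reg s1 32 = h - L"
        "arr s1 = arr s" "pc s1 \<le> pc s + 12" for s1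
    proof (rule wp_mono[OF emit_trav_emit_wp[OF s1(1,2) _ _ s1(5-9) _ down, of T_neg T_pos]], goal_cases)
      case 3
      show ?case using D(1) s1(10) by simp
    next
      case (6 s')
      then show ?case using True L s1(11) by (simp add: geo_word_def)
    qed (use s1(3,4) L True in simp_all)
    show ?thesis
      using True con r
      by (simp del: wp_Seq add: output_phase_def wp_Seq[of "Do _"] wp_Seq[of "If_pos _ _ _"], intro e)
        (use w c in \<open>simp_all add: consts_ok_def out_ok_def\<close>)
  next
    case False
    have e: "wp (emit 31 27 ;; (digit_emit ;; trav_loop) ;; emit 32 27) (\<lambda>s'. out_ok s' (geo_word D h L N) \<and>
      int (pc s') \<le> int (pc s) + (5 * C + 25) * (int N + 1) + 12) s1"
      if s1: "consts_ok p s1" "out_ok s1 []" "reg s1 28 = 3" "reg s1 27 = 4" "reg s1 29 = 1"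
        "reg s1 10 = L" "reg s1 30 = int N" "reg s1 31 = - L" "reg s1 32 = L + int N - h"
        "arr s1 = arr s" "pc s1 \<le> pc s + 12" for s1
    proof (rule wp_mono[OF emit_trav_emit_wp[OF s1(1,2) _ _ s1(5-9) _ up, of T_pos T_neg]], goal_cases)
      case 3
      show ?case using D(1) s1(10) by simp
    next
      case (6 s')
      then show ?case using False L s1(11) by (simp add: geo_word_def)
    qed (use s1(3,4) L False in simp_all)
    show ?thesis
      using False con r
      by (simp del: wp_Seq add: output_phase_def wp_Seq[of "Do _"] wp_Seq[of "If_pos _ _ _"], intro e)
        (use w c in \<open>simp_all add: consts_ok_def out_ok_def\<close>)
  qed
qed

section \<open>The complete program and its correctness\<close>

definition main_com :: "nat \<Rightarrow> com" where
  "main_com p = scan_phase p ;; norm_phase ;; low_phase ;; dp_phase ;; fold_phase ;; back_phase ;; output_phase"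

lemma wregs_phases:
  "wregs norm_phase = {8, 9, 10, 11, 12, 13}" "wregs low_phase = {9, 11, 14, 15, 16}"
  "wregs dp_phase = {8, 9, 10, 11, 12, 17, 18}"
  "wregs fold_phase = {8, 9, 11, 12, 19, 20, 21, 22, 23, 24, 34}"
  "wregs back_phase = {8, 9, 10, 11, 17, 18, 23}"
  "wregs output_phase = {8, 10, 11, 26, 27, 28, 29, 30, 31, 32, 35, 36}"
  "wregs (scan_phase p) = {0, 3, 4, 5, 6, 7, 8, 9, 11, 25}"
  by (auto simp: norm_phase_def norm_guard_def norm_step_def reduce_down_def reduce_up_def low_phase_def
      low_loop_def dp_phase_def dp_loop_def dp_body_def wregs_spread fold_phase_def fold_loop_def
      cand_com_def fold_guard_def fold_step_def back_phase_def back_loop_def back_body_def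
      output_phase_def scan_phase_def scan_letter_def)

lemma warrs_phases:
  "warrs norm_phase = {3}" "warrs low_phase = {}" "warrs dp_phase = {4, 5}" "warrs fold_phase = {}"
  "warrs back_phase = {3}" "warrs output_phase = {0}" "warrs (scan_phase p) = {3}"
  by (auto simp: norm_phase_def norm_guard_def norm_step_def reduce_down_def reduce_up_def low_phase_def
      low_loop_def dp_phase_def dp_loop_def dp_body_def warrs_spread fold_phase_def fold_loop_def
      cand_com_def fold_guard_def fold_step_def back_phase_def back_loop_def back_body_def
      output_phase_def scan_phase_def scan_letter_def)

lemma low_digits_zero:
  assumes p: "p > 0" and z: "\<forall>i<e. (X :: int) div p ^ i mod p = 0"
  shows "X = p ^ e * (X div p ^ e)"
  using z
proof (induction e)
  case (Suc e)
  then have "X = p ^ e * (X div p ^ e)" "X div p ^ e mod p = 0" by simp_all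
  then have "X div p ^ e = p * (X div p ^ Suc e)"
    using div_power_digit[OF p, of X e] by simp
  then have "p ^ e * (X div p ^ e) = p ^ e * (p * (X div p ^ Suc e))" by (rule arg_cong)
  also have "\<dots> = p ^ Suc e * (X div p ^ Suc e)" by (simp add: mult_ac)
  finally have "p ^ e * (X div p ^ e) = p ^ Suc e * (X div p ^ Suc e)" .
  with \<open>X = p ^ e * (X div p ^ e)\<close> show ?case by (rule HOL.trans)
qed simp

lemma div_power_add: "(X :: int) div p ^ e div p ^ m = X div p ^ (e + m)" if "p > 0"
  using that by (simp add: zdiv_zmult2_eq power_add)

definition found :: "nat \<Rightarrow> word \<Rightarrow> config \<Rightarrow> bool" where
  "found p w s \<longleftrightarrow> (\<exists>v. out_ok s v \<and> geodesic p v \<and> eq_BS p v w) \<and> consts_ok p s"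

text \<open>By its explicit form the word has length \<open>reg s 20 - \<bar>h\<bar>\<close>.
  Register 20 is below every candidate between \<open>m\<close> and \<open>N\<close>, so the same
  number is a lower bound for every word of the class.\<close>

lemma geodesicI:
  assumes p: "p \<ge> 2" and w: "ht w = h" "transl p w = of_int X * real p powi L"
    and L: "L \<le> min 0 h" "L = min 0 h \<or> \<not> int p dvd X"
    and top: "X div int p ^ N \<in> {0, - 1}" and m: "m \<le> N" "max 0 h \<le> L + int m"
      "L + int m = max 0 h \<or> 3 \<le> \<bar>X div int p ^ m\<bar>"
    and bc: "best_cand (int p) X L N m s" and mb: "m \<le> mb" "reg s 21 = L + int mb"
    and t: "tail p D (L + int mb) L = X" "abs_sum D (L + int mb) L + 2 * int mb = reg s 20"
  shows "geodesic p (geo_word D h L mb) \<and> eq_BS p (geo_word D h L mb) w"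
proof -
  have p0: "p > 0" using p by simp
  have mx: "max 0 h \<le> L + int mb" using m(2) mb by simp
  note g = geo_word_props[OF p0 L(1) mx, of D]
  have eq: "eq_BS p (geo_word D h L mb) w"
    using g(1,2) w t(1) by (simp add: eq_BS_iff[OF p0])
  have "length (geo_word D h L mb) \<le> length u" if "eq_BS p u (geo_word D h L mb)" for u
  proof -
    have u: "ht u = h" "transl p u = of_int X * real p powi L"
      using that g(1,2) t(1) by (simp_all add: eq_BS_iff[OF p0])
    have "int m = max 0 h - L \<or> 3 \<le> \<bar>X div int p ^ m\<bar>" using m(3) by auto
    moreover have "\<And>i. m \<le> i \<Longrightarrow> i \<le> N \<Longrightarrow> reg s 20 \<le> cand (int p) X i"
      using bc by (simp add: best_cand_def)
    ultimately have "reg s 20 - \<bar>h\<bar> \<le> int (length u)"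
      by (intro length_lower_bound[OF p u L top _ _ m(1)])
    then show ?thesis using g(3) t(2) by simp
  qed
  then show ?thesis using eq by (simp add: geodesic_def)
qed

lemma main_tail_wp:
  assumes p: "p \<ge> 2" and c: "consts_ok p s"
    and w: "ht w = h" "transl p w = of_int X * real p powi L"
    and L: "L \<le> min 0 h" "L = min 0 h \<or> \<not> int p dvd X"
    and r: "reg s 4 = h" "reg s 13 = L + int N" "reg s 14 = L" "reg s 16 = max 0 h" "max 0 h \<le> L + int N"
    and top: "X div int p ^ N \<in> {0, - 1}" "val (arr s 3 (L + int N)) = X div int p ^ N"
    and d: "\<forall>i<N. val (arr s 3 (L + int i)) = X div int p ^ i mod int p"
    and o: "out_ok s []"
  shows "wp (dp_phase ;; fold_phase ;; back_phase ;; output_phase) (\<lambda>s'. found p w s' \<and>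
    int (pc s') \<le> int (pc s) + (50 * int p + 151) * (int N + 1) + 30) s"
  unfolding wp_Seq
proof (rule wp_frame[OF dp_phase_wp[OF p c r(2,3) d]], goal_cases)
  case (1 s1)
  have c1: "consts_ok p s1" using consts_ok_agree[OF 1(2) c] by (simp add: wregs_phases)
  have s1: "reg s1 4 = h" "reg s1 13 = L + int N" "reg s1 14 = L" "reg s1 16 = max 0 h" "arr s1 3 = arr s 3"
    "arr s1 0 = arr s 0" "reg s1 26 = reg s 26"
    using agree_reg[OF 1(2)] agree_arr[OF 1(2)] r by (simp_all add: wregs_phases warrs_phases)
  have a1: "\<forall>i\<le>N. val (arr s1 4 (L + int i)) = dp (int p) X i 0 \<and> val (arr s1 5 (L + int i)) = dp (int p) X i 1"
    and t1: "int (pc s1) \<le> int (pc s) + (5 * int p + 30) * int N + 8" using 1(1) by blast+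
  have d1: "\<forall>i<N. val (arr s1 3 (L + int i)) = X div int p ^ i mod int p"
    "val (arr s1 3 (L + int N)) = X div int p ^ N" using d top s1 by simp_all
  have Lm: "L \<le> max 0 h" using L(1) by (simp add: le_max_iff_disj)
  show ?case
  proof (rule wp_frame[OF fold_phase_wp[OF p c1 s1(2,4) Lm r(5) top(1) a1 d1]], goal_cases)
    case (1 s2)
    obtain m where m: "m \<le> N" "max 0 h \<le> L + int m" "L + int m = max 0 h \<or> 3 \<le> \<bar>X div int p ^ m\<bar>"
      and bc: "best_cand (int p) X L N m s2"
      and t2: "int (pc s2) \<le> int (pc s1) + (30 * int p + 70) * (int N + 1) + 5" using 1(1) by blast
    have c2: "consts_ok p s2" using consts_ok_agree[OF 1(2) c1] by (simp add: wregs_phases)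
    have s2: "reg s2 4 = h" "reg s2 14 = L" "arr s2 = arr s1" "reg s2 26 = reg s 26"
      using agree_reg[OF 1(2)] agree_arr[OF 1(2)] s1 by (simp_all add: wregs_phases warrs_phases fun_eq_iff)
    obtain mb k where mb: "m \<le> mb" "mb \<le> N" "k = 0 \<or> k = 1" "reg s2 21 = L + int mb" "reg s2 23 = k"
        "reg s2 22 = X div int p ^ mb + k" "\<bar>reg s2 22\<bar> \<le> 3 * int p + 1"
        "reg s2 20 = dp (int p) X mb k + \<bar>reg s2 22\<bar>"
      using bc unfolding best_cand_def by blast
    \<comment> \<open>This is where charging 2 for a carry into position 0 suffices:
      \<open>2 + \<bar>X + 1\<bar>\<close> is strictly larger than
      \<open>\<bar>X\<bar>\<close>.\<close>
    have k0: "k = 0" if "mb = 0"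
    proof (rule ccontr)
      assume "k \<noteq> 0"
      then have "reg s2 20 = 2 + \<bar>X + 1\<bar>" using mb that by simp
      moreover have "reg s2 20 \<le> cand (int p) X 0"
        using bc mb that unfolding best_cand_def by blast
      then have "reg s2 20 \<le> \<bar>X\<bar>" by (simp add: cand_def)
      ultimately show False by simp
    qed
    have a2: "\<forall>i<mb. val (arr s2 4 (L + int i)) = dp (int p) X i 0 \<and> val (arr s2 5 (L + int i)) = dp (int p) X i 1"
      "\<forall>i<mb. val (arr s2 3 (L + int i)) = X div int p ^ i mod int p"
      using a1 d1 mb(2) s2 by simp_all
    show ?case
    proof (rule wp_frame[OF back_phase_wp[OF p c2 mb(4) s2(2) mb(5,3) k0 mb(6,7) a2]], goal_cases)
      case (2 s3)
      define D where "D = (\<lambda>j. val (arr s3 3 j))"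
      have c3: "consts_ok p s3" using consts_ok_agree[OF 2(2) c2] by (simp add: wregs_phases)
      have s3: "reg s3 4 = h" "reg s3 14 = L" "reg s3 21 = L + int mb" "reg s3 26 = reg s 26" "arr s3 0 = arr s 0"
        using agree_reg[OF 2(2)] agree_arr[OF 2(2)] s1 s2 mb(4) by (simp_all add: wregs_phases warrs_phases)
      have o3: "out_ok s3 []" using o s3 by (simp add: out_ok_def)
      have mx: "max 0 h \<le> L + int mb" using m(2) mb(1) by simp
      have D3: "\<forall>j. L \<le> j \<and> j \<le> L + int mb \<longrightarrow> \<bar>D j\<bar> \<le> 3 * int p + 1"
        and T3: "tail p D (L + int mb) L = X" "abs_sum D (L + int mb) L + 2 * int mb = reg s2 20"
        and t3: "int (pc s3) \<le> int (pc s2) + 21 * int mb + 5"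
        using 2(1) mb(8) unfolding D_def by simp_all
      note geo = geodesicI[OF p w L top(1) m bc mb(1,4) T3]
      show ?case
      proof (rule wp_frame[OF output_phase_wp[OF c3 o3 s3(1-3) L(1) mx D_def D3]], goal_cases)
        case (1 s4)
        have "consts_ok p s4" using consts_ok_agree[OF 1(2) c3] by (simp add: wregs_phases)
        then have "found p w s4" using geo 1(1) unfolding found_def by blast
        \<comment> \<open>The coefficient adds up the four phases: \<open>5 * p + 30\<close>,
          \<open>30 * p + 70\<close>, 21 and \<open>15 * p + 30\<close>.\<close>
        moreover have "int (pc s4) \<le> int (pc s) + (50 * int p + 151) * (int N + 1) + 30"
        proof -
          have C: "5 * (3 * int p + 1) + 25 = 15 * int p + 30" by simp
          have "int (pc s4) \<le> int (pc s3) + (5 * (3 * int p + 1) + 25) * (int mb + 1) + 12"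
            using 1(1) by blast
          then have "int (pc s4) \<le> int (pc s3) + (15 * int p + 30) * (int mb + 1) + 12"
            unfolding C .
          also have "\<dots> \<le> int (pc s3) + (15 * int p + 30) * (int N + 1) + 12"
            using mb(2) by (intro add_mono mult_left_mono order.refl) auto
          finally have t4: "int (pc s4) \<le> int (pc s3) + (15 * int p + 30) * (int N + 1) + 12" .
          have "int (pc s3) \<le> int (pc s2) + 21 * int N + 5" using t3 mb(2) by simp
          then show ?thesis using t1 t2 t4 by (simp add: algebra_simps)
        qed
        ultimately show ?case by blast
      qed
    qed simp
  qed
qed

lemma main_com_wp:
  assumes p: "p \<ge> 2" and r: "\<And>r. reg s r = 0" and a: "arr s 1 = array_of (word_code w)"
    "arr s 3 = (\<lambda>_. None)" "arr s 0 = (\<lambda>_. None)"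
  shows "wp (main_com p) (\<lambda>s'. found p w s' \<and>
    int (pc s') \<le> int (pc s) + (3050 * int p + 9500) * (int (length w) + 1)) s"
  unfolding main_com_def wp_Seq[of "scan_phase p"] wp_Seq[of norm_phase] wp_Seq[of low_phase]
proof (rule wp_frame[OF scan_phase_wp[OF r a(1,2), of p]], goal_cases)
  case (1 s1)
  obtain h lo hi D where sc: "scan w = (h, lo, hi, D)" by (metis prod_cases4)
  have p0: "p > 0" using p by simp
  note props = scan_props[OF p0 sc]
  then have sp: "lo \<le> 0" "0 \<le> hi" "lo \<le> h" "h \<le> hi" "\<forall>j. j < lo \<or> j > hi \<longrightarrow> D j = 0" by blast+
  define X where "X = tail p D hi lo"
  define n where "n = int (length w)"
  have c1: "consts_ok p s1" and sc1: "scan_state s1 = (h, lo, hi, D)" and t1: "int (pc s1) \<le> int (pc s) + 20 * n + 10"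
    using 1(1) sc by (simp_all add: n_def)
  have s1: "reg s1 26 = 0" "arr s1 0 = (\<lambda>_. None)"
    using agree_reg[OF 1(2), of 26] agree_arr[OF 1(2), of 0] r a by (simp_all add: wregs_phases warrs_phases)
  have Dhi: "\<And>j. j > hi \<Longrightarrow> D j = 0" and lohi: "lo \<le> hi" using sp by auto
  \<comment> \<open>Since \<open>\<bar>h\<bar> \<le> hi - lo\<close>, one of the two copies of
    \<open>hi - lo\<close> in the lower bound for the length absorbs
    \<open>\<bar>h\<bar>\<close>.\<close>
  have size: "abs_sum D hi lo + (hi - lo + 1) \<le> n + 1" "hi - lo \<le> n"
  proof -
    have "\<bar>h\<bar> \<le> hi - lo" using sp by auto
    moreover have "2 * (hi - lo) - \<bar>h\<bar> + abs_sum D hi lo \<le> n" unfolding abs_sum_def n_def using props by blast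
    moreover have "abs_sum D hi lo \<ge> 0" by (rule abs_sum_nonneg)
    ultimately show "abs_sum D hi lo + (hi - lo + 1) \<le> n + 1" "hi - lo \<le> n" by simp_all
  qed
  have X: "transl p w = of_int X * real p powi lo"
    unfolding X_def tail_real[OF p0, of D lo hi, symmetric] using props by blast
  show ?case
  proof (rule wp_frame[OF norm_phase_wp[OF p c1 sc1 Dhi lohi X_def HOL.refl]], goal_cases)
    case (2 s2)
    obtain m where m: "reg s2 13 = lo + int m" "hi < lo + int m" "X div int p ^ m \<in> {0, - 1}"
      "val (arr s2 3 (lo + int m)) = X div int p ^ m"
      "\<forall>i<m. val (arr s2 3 (lo + int i)) = X div int p ^ i mod int p"
      and t2: "int (pc s2) \<le> int (pc s1) + (40 * (abs_sum D hi lo + (hi - lo + 1)) + 20)"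
      and m': "int m \<le> 40 * (abs_sum D hi lo + (hi - lo + 1)) + 20" using 2(1) by blast
    have t2': "int (pc s2) \<le> int (pc s1) + 40 * (n + 1) + 20" and mn: "int m \<le> 40 * (n + 1) + 20"
      using t2 m' size(1) by simp_all
    have c2: "consts_ok p s2" using consts_ok_agree[OF 2(2) c1] by (simp add: wregs_phases)
    have s2: "reg s2 4 = h" "reg s2 5 = lo" "reg s2 26 = 0" "arr s2 0 = (\<lambda>_. None)"
      using agree_reg[OF 2(2)] agree_arr[OF 2(2), of 0] s1 sc1
      by (simp_all add: wregs_phases warrs_phases scan_state_def)
    have lo: "lo \<le> min 0 h" using sp by simp
    have dig: "val (arr s2 3 j) = X div int p ^ nat (j - lo) mod int p" if "lo \<le> j" "j < lo + int m" for j
    proof -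
      have "nat (j - lo) < m" "lo + int (nat (j - lo)) = j" using that by auto
      then show ?thesis using m(5) by metis
    qed
    have nn: "\<forall>j. lo \<le> j \<and> j < min 0 h \<longrightarrow> 0 \<le> val (arr s2 3 j)"
    proof (intro allI impI)
      fix j assume j: "lo \<le> j \<and> j < min 0 h"
      then have "j < lo + int m" using m(2) sp by auto
      then show "0 \<le> val (arr s2 3 j)" using dig j p by simp
    qed
    show ?case
    proof (rule wp_frame[OF low_phase_wp[OF c2 s2(1,2) lo nn]], goal_cases)
      case (1 s3)
      obtain e where e: "reg s3 14 = lo + int e" "reg s3 16 = max 0 h" "lo + int e \<le> min 0 h"
        "\<forall>i<e. val (arr s2 3 (lo + int i)) = 0"
        "lo + int e = min 0 h \<or> val (arr s2 3 (lo + int e)) \<noteq> 0"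
        "int (pc s3) \<le> int (pc s2) + 8 * (min 0 h - lo) + 14" using 1(1) by blast
      have c3: "consts_ok p s3" using consts_ok_agree[OF 1(2) c2] by (simp add: wregs_phases)
      have s3: "reg s3 4 = h" "reg s3 13 = lo + int m" "reg s3 26 = 0" "arr s3 = arr s2"
        using agree_reg[OF 1(2)] agree_arr[OF 1(2)] s2 m(1) by (simp_all add: wregs_phases warrs_phases fun_eq_iff)
      \<comment> \<open>The zero digits below \<open>L\<close> are cut off: \<open>X\<close> is
        \<open>p ^ e * Y\<close>, and the digits of \<open>Y\<close> are those of \<open>X\<close>
        shifted by \<open>e\<close>.\<close>
      define L Y N where "L = lo + int e" and "Y = X div int p ^ e" and "N = m - e"
      have em: "e < m" using e(3) m(2) sp by auto
      have LN: "lo + int m = L + int N" using em by (simp add: L_def N_def of_nat_diff)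
      have pp: "int p > 0" using p by simp
      have Ydiv: "Y div int p ^ i = X div int p ^ (e + i)" for i
        unfolding Y_def by (rule div_power_add[OF pp])
      have XY: "X = int p ^ e * Y"
        unfolding Y_def using e(4) m(5) em by (intro low_digits_zero[OF pp]) auto
      have "real p powi L = real p ^ e * real p powi lo"
        unfolding L_def using p0 by (subst power_int_add) auto
      then have wY: "transl p w = of_int Y * real p powi L"
        using X XY by simp
      have L: "L \<le> min 0 h" "L = min 0 h \<or> \<not> int p dvd Y"
        using e(3,5) m(5) em by (auto simp: L_def Y_def dvd_eq_mod_eq_0)
      have N: "max 0 h \<le> L + int N" using LN m(2) sp by auto
      have eN: "e + N = m" using em by (simp add: N_def)
      have top: "Y div int p ^ N \<in> {0, - 1}" "val (arr s3 3 (L + int N)) = Y div int p ^ N"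
        using m(3,4) s3 LN unfolding Ydiv eN by simp_all
      have d: "\<forall>i<N. val (arr s3 3 (L + int i)) = Y div int p ^ i mod int p"
      proof (intro allI impI)
        fix i assume "i < N"
        then have "e + i < m" using eN by simp
        then have "val (arr s2 3 (lo + int (e + i))) = X div int p ^ (e + i) mod int p" using m(5) by blast
        then show "val (arr s3 3 (L + int i)) = Y div int p ^ i mod int p"
          unfolding Ydiv using s3 by (simp add: L_def add.assoc)
      qed
      have hw: "ht w = h" using props by blast
      have o: "out_ok s3 []"
        using s3 s2 by (auto simp: out_ok_def word_code_def array_of_def fun_eq_iff)
      have r3: "reg s3 13 = L + int N" "reg s3 14 = L" using s3 LN e(1) by (simp_all add: L_def)
      show ?case
      proof (rule wp_mono[OF main_tail_wp[OF p c3 hw wY L s3(1) r3 e(2) N top d o]], goal_cases)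
        case (1 s4)
        have "int (pc s4) \<le> int (pc s3) + (50 * int p + 151) * (int N + 1) + 30" using 1 by blast
        \<comment> \<open>Normalisation leaves at most \<open>40 * (n + 1) + 20\<close> digits, by
          its running time, whence the factor 61.\<close>
        also have "\<dots> \<le> int (pc s3) + (50 * int p + 151) * (61 * (n + 1)) + 30"
        proof -
          have "int N \<le> int m" by (simp add: N_def)
          then have "int N + 1 \<le> 61 * (n + 1)" using mn by (simp add: n_def)
          then have "(50 * int p + 151) * (int N + 1) \<le> (50 * int p + 151) * (61 * (n + 1))"
            by (intro mult_left_mono) auto
          then show ?thesis by simp
        qed
        finally have t4: "int (pc s4) \<le> int (pc s3) + (50 * int p + 151) * (61 * (n + 1)) + 30" .
        have "min 0 h - lo \<le> n" using size(2) sp by auto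
        then have "int (pc s3) \<le> int (pc s) + 68 * n + 84" using e(6) t1 t2' by simp
        moreover have "(50 * int p + 151) * (61 * (n + 1)) + 114 * (n + 1) \<le> (3050 * int p + 9500) * (n + 1)"
          by (simp add: n_def algebra_simps)
        moreover have "0 \<le> n" by (simp add: n_def)
        moreover have "x4 \<le> x0 + R"
          if "x3 \<le> x0 + 68 * n + 84" "A + 114 * (n + 1) \<le> R" "0 \<le> n" "x4 \<le> x3 + A + 30"
          for x0 x3 x4 A R n :: int using that by simp
        ultimately have "int (pc s4) \<le> int (pc s) + (3050 * int p + 9500) * (n + 1)" using t4 by blast
        then show ?case using 1 by (simp add: n_def)
      qed
    qed
  qed simp
qed

section \<open>Linear-time solvability\<close>

text \<open>The registers 27, 28 and 29 hold symbols and the direction. Register 9 serves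
  comparisons, while 30 and 32 count the letters of two legs of the output; all three are only
  tested or changed by constants. The bound \<open>p + 4\<close> covers all constants of the program
  and all letter codes.\<close>

lemma ctame_main:
  "ctame {0, 2, 3, 25, 27, 28, 29} {9, 30, 32} (int p + 4) (main_com p)"
  by (simp add: main_com_def norm_phase_def norm_guard_def norm_step_def reduce_down_def reduce_up_def
      low_phase_def low_loop_def dp_phase_def dp_loop_def dp_body_def spread_def fold_phase_def fold_loop_def
      cand_com_def fold_guard_def fold_step_def back_phase_def back_loop_def back_body_def drain_pos_def
      drain_neg_def output_phase_def scan_phase_def scan_letter_def emit_def digit_emit_def trav_loop_def
      trav_body_def)

lemma wp_run:
  assumes "wp c Q (init ins)"
  shows "\<exists>s'. Q s' \<and> halted (code 0 c) (run (code 0 c) ins (pc s')) \<and> arr (run (code 0 c) ins (pc s')) = arr s'"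
proof -
  obtain s' where s': "bigstep c (init ins) s'" "Q s'" using assms by (auto simp: wp_def)
  have "steps (code 0 c) (pc s' - pc (init ins)) (init ins\<lparr>pc := 0\<rparr>) (s'\<lparr>pc := csize c\<rparr>)"
    using code_correct[OF s'(1), of "code 0 c" "[]" "[]"] by simp
  then have "run (code 0 c) ins (pc s') = s'\<lparr>pc := csize c\<rparr>"
    by (simp add: steps_def run_def init_def)
  then show ?thesis using s'(2) by (auto simp: halted_def)
qed

lemma wp_solves:
  assumes wp: "wp c (\<lambda>s'. (\<exists>out. correct out \<and> arr s' 0 = array_of out) \<and> pc s' \<le> T) (init ins)"
    and t: "ctame K W B c" "K \<inter> W = {}" "0 \<le> B" "\<forall>xs\<in>set ins. \<forall>x\<in>set xs. \<bar>x\<bar> \<le> B"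
    and m: "2 * B * int (Suc T) \<le> int m"
  shows "entries_bounded (code 0 c) ins m" "\<exists>out. correct out \<and> outputs_within (code 0 c) ins out T"
    "input_size ins \<le> m \<Longrightarrow> space_within (code 0 c) ins
      ((card (\<Union>i\<in>set (code 0 c). instr_regs i) + 2 * (input_size ins + T)) * (floorlog 2 m + 1))"
proof -
  obtain s' :: config and out where s': "correct out" "arr s' 0 = array_of out" "pc s' \<le> T"
    "halted (code 0 c) (run (code 0 c) ins (pc s'))" "arr (run (code 0 c) ins (pc s')) = arr s'"
    using wp_run[OF wp] by blast
  show eb: "entries_bounded (code 0 c) ins m"
    by (rule entries_boundedI[OF _ t(2,3,4) s'(4,3) m]) (use ctame_code[OF t(1)] in blast)
  show "\<exists>out. correct out \<and> outputs_within (code 0 c) ins out T"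
    unfolding outputs_within_def
    by (intro exI[of _ out] exI[of _ "pc s'"] conjI) (use s' in simp_all)
  have "halted (code 0 c) (run (code 0 c) ins T)"
    using run_halted[OF s'(4,3)] s'(4) by simp
  then show "input_size ins \<le> m \<Longrightarrow> space_within (code 0 c) ins
      ((card (\<Union>i\<in>set (code 0 c). instr_regs i) + 2 * (input_size ins + T)) * (floorlog 2 m + 1))"
    by (rule space_withinI[OF eb])
qed

section \<open>Asymptotic estimates\<close>

lemma linear_in_bigo: "(\<lambda>n. real (a * n + b)) \<in> O(\<lambda>n. real n)"
proof (rule bigoI[where c = "real (a + b)"])
  show "\<forall>\<^sub>F n in at_top. norm (real (a * n + b)) \<le> real (a + b) * norm (real n)"
    using eventually_ge_at_top[of 1]
  proof eventually_elim
    case (elim n)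
    then have "a * n + b \<le> (a + b) * n" by (simp add: algebra_simps)
    then have "real (a * n + b) \<le> real ((a + b) * n)" by (simp only: of_nat_le_iff)
    then show ?case by simp
  qed
qed

text \<open>From \<open>n \<ge> m + 3\<close> on, \<open>m * (n + 1) \<le> n ^ 3\<close>, which
  gives at most \<open>3 * log 2 n + 1\<close> binary digits. As \<open>n \<ge> 3\<close> exceeds e,
  the logarithm is at least 1 and absorbs the additive constants.\<close>

lemma floorlog_in_bigo:
  assumes "m > 0"
  shows "(\<lambda>n. real (floorlog 2 (m * (n + 1)) + 1)) \<in> O(\<lambda>n. ln (real n))"
proof (rule bigoI[where c = "3 / ln 2 + 2"])
  show "\<forall>\<^sub>F n in at_top. norm (real (floorlog 2 (m * (n + 1)) + 1)) \<le> (3 / ln 2 + 2) * norm (ln (real n))"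
    using eventually_ge_at_top[of "m + 3"]
  proof eventually_elim
    case (elim n)
    define x where "x = m * (n + 1)"
    have x: "x > 0" using assms by (simp add: x_def)
    have "3 * n \<le> n * n" using elim by (intro mult_right_mono) simp_all
    then have "n + 1 \<le> n * n" using elim by linarith
    then have "x \<le> n * (n * n)" unfolding x_def using elim by (intro mult_le_mono) simp_all
    then have "real x \<le> real (n * (n * n))" by (simp only: of_nat_le_iff)
    also have "\<dots> = real n ^ 3" by (simp add: power3_eq_cube)
    finally have "real x \<le> real n ^ 3" .
    then have "log 2 (real x) \<le> log 2 (real n ^ 3)"
      by (subst log_le_cancel_iff) (use x elim in simp_all)
    also have "\<dots> = 3 / ln 2 * ln (real n)" using elim by (simp add: log_def ln_realpow)
    finally have log: "log 2 (real x) \<le> 3 / ln 2 * ln (real n)" .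
    have "3 \<le> real n" using elim by simp
    then have "exp 1 \<le> real n" using exp_le by linarith
    then have ln: "1 \<le> ln (real n)" using elim by (subst ln_ge_iff) simp_all
    have "0 \<le> \<lfloor>log 2 (real x)\<rfloor>" using x by simp
    then have "real (floorlog 2 x) = of_int \<lfloor>log 2 (real x)\<rfloor> + 1" using x by (simp add: floorlog_def)
    then have "real (floorlog 2 x) \<le> log 2 (real x) + 1" by simp
    then have "real (floorlog 2 x) + 1 \<le> 3 / ln 2 * ln (real n) + 2 * ln (real n)"
      using log ln by linarith
    moreover have "norm (ln (real n)) = ln (real n)" using ln by simp
    moreover have "norm (real (floorlog 2 x + 1)) = real (floorlog 2 x) + 1" by simp
    ultimately show ?case
      unfolding x_def[symmetric] by (simp only: distrib_right)
  qed
qed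

lemma space_in_bigo:
  assumes "m > 0"
  shows "(\<lambda>n. real ((r + 2 * (n + (a * n + b))) * (floorlog 2 (m * (n + 1)) + 1))) \<in> O(\<lambda>n. real n * ln (real n))"
proof -
  have "(\<lambda>n. real ((2 + 2 * a) * n + (r + 2 * b)) * real (floorlog 2 (m * (n + 1)) + 1)) \<in> O(\<lambda>n. real n * ln (real n))"
    by (intro landau_o.big.mult linear_in_bigo floorlog_in_bigo[OF assms])
  moreover have "(2 + 2 * a) * n + (r + 2 * b) = r + 2 * (n + (a * n + b))" for n
    by (simp add: algebra_simps)
  ultimately show ?thesis by (simp only: of_nat_mult)
qed

lemma init_word:
  "reg (init (word_code w # ins)) r = 0" "arr (init (word_code w # ins)) 1 = array_of (word_code w)"
  "arr (init (word_code w # ins)) 0 = (\<lambda>_. None)" "pc (init (word_code w # ins)) = 0"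
  by (simp_all add: init_def)

lemma word_code_le: "x \<in> set (word_code w) \<Longrightarrow> \<bar>x\<bar> \<le> 4"
  by (auto simp: word_code_def) (case_tac xa; simp)

definition main_time :: "nat \<Rightarrow> nat \<Rightarrow> nat" where
  "main_time p n = (3050 * p + 9500) * (n + 1)"

lemma main_init_wp:
  assumes p: "p \<ge> 2" and ins: "length ins \<le> 1"
  shows "wp (main_com p) (\<lambda>s'. found p w s' \<and> pc s' \<le> main_time p (length w)) (init (word_code w # ins))"
proof (rule wp_mono[OF main_com_wp[OF p init_word(1,2) _ init_word(3)]], goal_cases)
  case 1
  show ?case using ins by (simp add: init_def)
next
  case (2 s')
  have "int (main_time p (length w)) = (3050 * int p + 9500) * (int (length w) + 1)"
    by (simp add: main_time_def algebra_simps)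
  then show ?case using 2 by (simp add: init_word)
qed

section \<open>The geodesic length\<close>

lemma geodesic_length_eq:
  assumes "geodesic p v" "eq_BS p v w"
  shows "geodesic_length p w = length v"
  unfolding geodesic_length_def
proof (rule the_equality)
  show "\<exists>u. eq_BS p u w \<and> geodesic p u \<and> length u = length v" using assms by blast
  fix m assume "\<exists>u. eq_BS p u w \<and> geodesic p u \<and> length u = m"
  then obtain u where u: "eq_BS p u w" "geodesic p u" "length u = m" by blast
  have "eq_BS p u v" "eq_BS p v u" using u(1) assms(2) by (meson eq_BS.sym eq_BS.trans)+
  then show "m = length v" using u assms(1) unfolding geodesic_def by (metis le_antisym)
qed

text \<open>The output array has to contain the answer and nothing else, so the geodesic word is
  deleted again, starting from its end.\<close>

definition clear_loop :: com where
  "clear_loop = While Skip 8 (Do (Sub 8 8 0) ;; Do (Delete 0 8))"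

lemma array_of_take: "n < length xs \<Longrightarrow> (array_of (take (Suc n) xs))(int n := None) = array_of (take n xs)"
  by (auto simp: array_of_def fun_eq_iff)

lemma clear_loop_wp:
  assumes "reg s 0 = 1" "reg s 8 = int (length xs)" "arr s 0 = array_of xs"
  shows "wp clear_loop (\<lambda>s'. arr s' 0 = (\<lambda>_. None) \<and> pc s' \<le> pc s + 4 * length xs + 2) s"
  unfolding clear_loop_def
proof (rule wp_While[where T = "pc s + 4 * length xs" and
    I = "\<lambda>s'. \<exists>i\<le>length xs. reg s' 8 = int i \<and> arr s' 0 = array_of (take i xs) \<and>
      pc s' \<le> pc s + 4 * (length xs - i)"], goal_cases)
  case 1
  then show ?case using assms by (intro exI[of _ "length xs"]) simp
next
  case (2 s1)
  then show ?case by auto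
next
  case (3 s1)
  then obtain i where i: "i \<le> length xs" "reg s1 8 = int i" "arr s1 0 = array_of (take i xs)"
      "pc s1 \<le> pc s + 4 * (length xs - i)" by blast
  have s1: "reg s1 0 = 1" using 3(2) assms by (simp add: agree_def)
  show ?case
  proof (cases i)
    case 0
    have "array_of [] = (\<lambda>_. None)" by (simp add: array_of_def fun_eq_iff)
    then show ?thesis using i s1 0 by simp
  next
    case (Suc n)
    then show ?thesis using i s1 array_of_take[of n xs] by (auto intro!: exI[of _ n])
  qed
qed

definition length_com :: "nat \<Rightarrow> com" where
  "length_com p = main_com p ;; Do (Add 8 26 2) ;; clear_loop ;; Do (Store 0 2 26)"

lemma wregs_clear_loop [simp]: "wregs clear_loop = {8}" "warrs clear_loop = {0}"
  by (auto simp: clear_loop_def)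

lemma found_length:
  assumes "found p w s"
  shows "reg s 26 = int (geodesic_length p w)" "geodesic_length p w \<le> length w"
    "\<exists>v. arr s 0 = array_of (word_code v) \<and> length (word_code v) = geodesic_length p w"
proof -
  obtain v where v: "out_ok s v" "geodesic p v" "eq_BS p v w" using assms by (auto simp: found_def)
  note l = geodesic_length_eq[OF v(2,3)]
  show "reg s 26 = int (geodesic_length p w)" using v(1) l by (simp add: out_ok_def)
  show "geodesic_length p w \<le> length w"
    using v(2) eq_BS.sym[OF v(3)] l unfolding geodesic_def by simp
  show "\<exists>v. arr s 0 = array_of (word_code v) \<and> length (word_code v) = geodesic_length p w"
    using v(1) l by (auto simp: out_ok_def word_code_def)
qed

lemma array_of_single: "(\<lambda>_. None)(0 := Some z) = array_of [z]"
  by (auto simp: array_of_def fun_eq_iff)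

lemma length_com_wp:
  assumes p: "p \<ge> 2"
  shows "wp (length_com p) (\<lambda>s'. arr s' 0 = array_of [int (geodesic_length p w)] \<and>
    pc s' \<le> main_time p (length w) + 4 * length w + 4) (init [word_code w])"
  unfolding length_com_def wp_Seq[of "main_com p"]
proof (rule wp_frame[OF main_init_wp[OF p, of "[]" w]], goal_cases)
  case (2 s1)
  then have f: "found p w s1" "pc s1 \<le> main_time p (length w)" by blast+
  then have con: "reg s1 0 = 1" "reg s1 2 = 0" by (simp_all add: found_def consts_ok_def)
  obtain v where v: "arr s1 0 = array_of (word_code v)" "length (word_code v) = geodesic_length p w"
    using found_length(3)[OF f(1)] by blast
  have "wp (clear_loop ;; Do (Store 0 2 26)) (\<lambda>s'. arr s' 0 = array_of [int (geodesic_length p w)] \<and>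
      pc s' \<le> main_time p (length w) + 4 * length w + 4) (exec (Add 8 26 2) s1)"
    unfolding wp_Seq
  proof (rule wp_frame[OF clear_loop_wp[of _ "word_code v"]], goal_cases)
    case (4 s2)
    have s2: "reg s2 2 = 0" "reg s2 26 = int (geodesic_length p w)"
      using agree_reg[OF 4(2)] con found_length(1)[OF f(1)] by simp_all
    have "pc s2 \<le> main_time p (length w) + 4 * length w + 3"
      using 4(1) f(2) v(2) found_length(2)[OF f(1)] by simp
    then show ?case using 4(1) s2 by (simp add: array_of_single)
  qed (use con v found_length(1)[OF f(1)] in simp_all)
  then show ?case by simp
qed simp

section \<open>Comparison with a binary integer\<close>

lemma int_code_nth:
  "array_of (int_code k) 0 = Some (of_bool (k < 0))"
  "i < floorlog 2 (nat \<bar>k\<bar>) \<Longrightarrow>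
    array_of (int_code k) (1 + int i) = Some (of_bool (bit \<bar>k\<bar> (floorlog 2 (nat \<bar>k\<bar>) - Suc i)))"
  "array_of (int_code k) (1 + int (floorlog 2 (nat \<bar>k\<bar>))) = None"
  by (simp_all add: array_of_def int_code_def nat_add_distrib rev_nth)

definition read_body :: com where
  "read_body = Do (Load 11 2 38) ;; Do (Add 38 38 0) ;; Do (Sub 9 39 26) ;;
     If_pos 9 Skip (Do (Add 8 39 2) ;; drain_pos Add 8 39 0 ;; If_pos 11 (Do (Add 39 39 0)) Skip)"

definition read_loop :: com where
  "read_loop = While (Test_empty 8 2 38 ;; Do (Sub 8 0 8)) 8 read_body"

text \<open>Doubling in unit steps takes time proportional to the old value, which is at most the
  increase of register 39. That register is thus its own potential, and all doublings together stay
  linear in its final value.\<close>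

lemma read_body_wp:
  assumes c: "reg s 0 = 1" "reg s 2 = 0" and b: "arr s 2 (reg s 38) = Some (of_bool b)" and v: "reg s 39 \<ge> 0"
  shows "wp read_body (\<lambda>s'. reg s' 38 = reg s 38 + 1 \<and>
     reg s' 39 = (if reg s 39 > reg s 26 then reg s 39 else 2 * reg s 39 + of_bool b) \<and>
     int (pc s') + 4 * reg s 39 \<le> int (pc s) + 4 * reg s' 39 + 12) s"
proof (cases "reg s 39 > reg s 26")
  case True
  then show ?thesis using c b by (simp add: read_body_def)
next
  case False
  have dr: "wp (drain_pos Add 8 39 0) Q s1"
    if s1: "reg s1 0 = 1" "reg s1 8 = reg s 39" "reg s1 39 = reg s 39"
      and Q: "\<And>s2. agree (drain_pos Add 8 39 0) s1 s2 \<Longrightarrow> reg s2 39 = 2 * reg s 39 \<Longrightarrow>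
        int (pc s2) \<le> int (pc s1) + 4 * reg s 39 + 2 \<Longrightarrow> Q s2" for s1 Q
    by (rule wp_frame[OF drain_pos_wp[of s1 Add 1 8 39 0]]) (use s1 v Q in auto)
  show ?thesis
    using False c b v
    by (cases b) (auto simp: read_body_def agree_def intro!: dr)
qed

lemma bits_step:
  assumes "i < F"
  shows "(k :: int) div 2 ^ (F - Suc i) = 2 * (k div 2 ^ (F - i)) + of_bool (bit k (F - Suc i))"
proof -
  define y where "y = k div 2 ^ (F - Suc i)"
  have "F - i = Suc (F - Suc i)" using assms by simp
  then have "k div 2 ^ (F - i) = y div 2" by (simp add: y_def div_power_Suc del: power_Suc)
  moreover have "bit k (F - Suc i) = odd y" by (simp add: y_def bit_iff_odd)
  moreover have "y = 2 * (y div 2) + of_bool (odd y)"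
    unfolding of_bool_odd_eq_mod_2 by simp
  ultimately show ?thesis unfolding y_def[symmetric] by simp
qed

text \<open>The prefixes of the binary expansion can only grow, so once one exceeds \<open>l\<close>
  the comparison is settled and the value is frozen. Hence register 39 never exceeds
  \<open>2 * l + 1\<close>, even though \<open>\<bar>k\<bar>\<close> may be exponential in the input
  size.\<close>

lemma read_loop_wp:
  assumes c: "reg s 0 = 1" "reg s 2 = 0" and l: "reg s 26 = int l" and r: "reg s 38 = 1" "reg s 39 = 0"
    and a: "arr s 2 = array_of (int_code k)" and F: "F = floorlog 2 (nat \<bar>k\<bar>)"
  shows "wp read_loop (\<lambda>s'. (reg s' 39 > int l \<longleftrightarrow> \<bar>k\<bar> > int l) \<and>
     int (pc s') \<le> int (pc s) + 20 * int F + 8 * int l + 10) s"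
  unfolding read_loop_def
proof (rule wp_While[where T = "nat (int (pc s) + 20 * int F + 8 * int l + 4)" and
    I = "\<lambda>s'. \<exists>i\<le>F. reg s' 38 = 1 + int i \<and> 0 \<le> reg s' 39 \<and> reg s' 39 \<le> 2 * int l + 1 \<and>
      reg s' 39 \<le> \<bar>k\<bar> div 2 ^ (F - i) \<and> (reg s' 39 = \<bar>k\<bar> div 2 ^ (F - i) \<or> reg s' 39 > int l) \<and>
      int (pc s') \<le> int (pc s) + 20 * int i + 4 * reg s' 39"], goal_cases)
  case 1
  have "\<bar>k\<bar> < 2 ^ F"
  proof (cases "k = 0")
    case False
    then have "nat \<bar>k\<bar> < 2 ^ F" using floorlog_bounds[of "nat \<bar>k\<bar>" 2] F by simp
    then have "int (nat \<bar>k\<bar>) < int (2 ^ F)" by (simp only: of_nat_less_iff)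
    then show ?thesis by simp
  qed simp
  then show ?case using r by (intro exI[of _ 0]) simp
next
  case (2 s1)
  then obtain i where "i \<le> F" "reg s1 39 \<le> 2 * int l + 1" "int (pc s1) \<le> int (pc s) + 20 * int i + 4 * reg s1 39"
    by blast
  then have "int (pc s1) \<le> int (pc s) + 20 * int F + 8 * int l + 4" by simp
  then show ?case by simp
next
  case (3 s1)
  then obtain i where i: "i \<le> F" "reg s1 38 = 1 + int i" "0 \<le> reg s1 39" "reg s1 39 \<le> 2 * int l + 1"
      "reg s1 39 \<le> \<bar>k\<bar> div 2 ^ (F - i)" "reg s1 39 = \<bar>k\<bar> div 2 ^ (F - i) \<or> reg s1 39 > int l"
      "int (pc s1) \<le> int (pc s) + 20 * int i + 4 * reg s1 39" by blast
  note ag = 3(2)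
  have s1: "reg s1 0 = 1" "reg s1 2 = 0" "reg s1 26 = int l" "arr s1 2 = array_of (int_code k)"
    using agree_reg[OF ag] agree_arr[OF ag, of 2] c l a by (simp_all add: read_body_def)
  show ?case
  proof (cases "i < F")
    case True
    define b where "b = bit \<bar>k\<bar> (F - Suc i)"
    have cell: "arr s1 2 (1 + int i) = Some (of_bool b)"
      using int_code_nth(2)[of i k] True F s1(4) by (simp add: b_def)
    let ?s = "tick (exec (Sub 8 0 8) (s1\<lparr>pc := pc s1 + 3, reg := (reg s1)(8 := 0)\<rparr>))"
    have "wp read_body (\<lambda>s2. 0 < reg s2 0 \<and> (\<exists>i\<le>F. reg (tick s2) 38 = 1 + int i \<and> 0 \<le> reg (tick s2) 39 \<and>
      reg (tick s2) 39 \<le> 2 * int l + 1 \<and> reg (tick s2) 39 \<le> \<bar>k\<bar> div 2 ^ (F - i) \<and>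
      (reg (tick s2) 39 = \<bar>k\<bar> div 2 ^ (F - i) \<or> reg (tick s2) 39 > int l) \<and>
      int (pc (tick s2)) \<le> int (pc s) + 20 * int i + 4 * reg (tick s2) 39)) ?s"
    proof (rule wp_frame[OF read_body_wp[of _ b]], goal_cases)
      case (5 s2)
      have r0: "reg s2 0 = 1" using agree_reg[OF 5(2), of 0] s1 by (simp add: read_body_def)
      have v: "reg s2 39 = (if reg s1 39 > int l then reg s1 39 else 2 * reg s1 39 + of_bool b)"
        using 5(1) s1 by simp
      have u: "\<bar>k\<bar> div 2 ^ (F - Suc i) = 2 * (\<bar>k\<bar> div 2 ^ (F - i)) + of_bool b"
        unfolding b_def by (rule bits_step[OF True])
      have "0 \<le> reg s2 39 \<and> reg s2 39 \<le> 2 * int l + 1 \<and> reg s2 39 \<le> \<bar>k\<bar> div 2 ^ (F - Suc i) \<and>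
        (reg s2 39 = \<bar>k\<bar> div 2 ^ (F - Suc i) \<or> reg s2 39 > int l)"
        unfolding u v using i(3-6) by (cases b) auto
      moreover have "int (pc s2) + 1 \<le> int (pc s) + 20 * int (Suc i) + 4 * reg s2 39"
        using 5(1) i(7) by simp
      ultimately show ?case using r0 5(1) i(2) True
        by (intro conjI exI[of _ "Suc i"]) (simp_all del: power_Suc)
    qed (use s1 cell i in simp_all)
    then show ?thesis using s1 i cell by simp
  next
    case False
    then have iF: "i = F" using i(1) by simp
    then have "arr s1 2 (1 + int i) = None" using int_code_nth(3)[of k] F s1(4) by simp
    then show ?thesis using s1 i iF by auto
  qed
qed

lemma wregs_read_loop [simp]: "wregs read_loop = {8, 9, 11, 38, 39}" "warrs read_loop = {}"
  by (auto simp: read_loop_def read_body_def)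

definition bounded_com :: "nat \<Rightarrow> com" where
  "bounded_com p = main_com p ;; Do (Load 37 2 2) ;; Do (Const 38 1) ;; Do (Const 39 0) ;; read_loop ;;
     Do (Add 8 26 2) ;; clear_loop ;;
     If_pos 37 (Do (Const 8 0)) (Do (Sub 9 39 26) ;; If_pos 9 (Do (Const 8 1)) (Do (Const 8 0))) ;;
     Do (Store 0 2 8)"

lemma wp_Do_Seq: "straight i \<Longrightarrow> wp c Q (exec i s) \<Longrightarrow> wp (Do i ;; c) Q s"
  by simp

lemma bounded_com_wp:
  assumes p: "p \<ge> 2" and F: "F = floorlog 2 (nat \<bar>k\<bar>)"
  shows "wp (bounded_com p) (\<lambda>s'. arr s' 0 = array_of [of_bool (int (geodesic_length p w) < k)] \<and>
    pc s' \<le> main_time p (length w) + 20 * F + 12 * length w + 30) (init [word_code w, int_code k])"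
  unfolding bounded_com_def wp_Seq[of "main_com p"]
proof (rule wp_frame[OF main_init_wp[OF p, of "[int_code k]" w]], goal_cases)
  case (2 s1)
  let ?l = "geodesic_length p w"
  have f: "found p w s1" "pc s1 \<le> main_time p (length w)" using 2(1) by blast+
  then have con: "reg s1 0 = 1" "reg s1 2 = 0" by (simp_all add: found_def consts_ok_def)
  obtain v where v: "arr s1 0 = array_of (word_code v)" "length (word_code v) = ?l"
    using found_length(3)[OF f(1)] by blast
  have a2: "arr s1 2 = array_of (int_code k)"
    using agree_arr[OF 2(2), of 2] by (simp add: main_com_def warrs_phases init_def)
  have l: "reg s1 26 = int ?l" "?l \<le> length w" using found_length[OF f(1)] by auto
  let ?Q = "\<lambda>s'. arr s' 0 = array_of [of_bool (int ?l < k)] \<and>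
    pc s' \<le> main_time p (length w) + 20 * F + 12 * length w + 30"
  let ?s = "exec (Const 39 0) (exec (Const 38 1) (exec (Load 37 2 2) s1))"
  have R: "wp (read_loop ;; Do (Add 8 26 2) ;; clear_loop ;;
     If_pos 37 (Do (Const 8 0)) (Do (Sub 9 39 26) ;; If_pos 9 (Do (Const 8 1)) (Do (Const 8 0))) ;;
     Do (Store 0 2 8)) ?Q ?s"
    unfolding wp_Seq[of read_loop]
  proof (rule wp_frame[OF read_loop_wp[of _ ?l k F]], goal_cases)
    case (8 s2)
    have s2: "reg s2 0 = 1" "reg s2 2 = 0" "reg s2 26 = int ?l" "reg s2 37 = of_bool (k < 0)"
      "arr s2 0 = array_of (word_code v)"
      using agree_reg[OF 8(2)] agree_arr[OF 8(2), of 0] con l v a2 int_code_nth(1)[of k] by simp_all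
    have t2: "int (pc s2) \<le> int (pc s1) + 20 * int F + 8 * int ?l + 13" using 8(1) by simp
    have cmp: "reg s2 39 > int ?l \<longleftrightarrow> \<bar>k\<bar> > int ?l" using 8(1) by blast
    have R: "wp (clear_loop ;; If_pos 37 (Do (Const 8 0)) (Do (Sub 9 39 26) ;; If_pos 9 (Do (Const 8 1)) (Do (Const 8 0))) ;;
     Do (Store 0 2 8)) ?Q (exec (Add 8 26 2) s2)"
      unfolding wp_Seq[of clear_loop]
    proof (rule wp_frame[OF clear_loop_wp[of _ "word_code v"]], goal_cases)
      case (4 s3)
      have s3: "reg s3 0 = 1" "reg s3 2 = 0" "reg s3 26 = int ?l" "reg s3 37 = of_bool (k < 0)" "reg s3 39 = reg s2 39"
        using agree_reg[OF 4(2)] s2 by simp_all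
      have "int (pc s3) \<le> int (pc s2) + 4 * int ?l + 3" using 4(1) v(2) by simp
      then have "int (pc s3) \<le> int (pc s1) + 20 * int F + 12 * int ?l + 16" using t2 by simp
      then have t3: "pc s3 \<le> main_time p (length w) + 20 * F + 12 * length w + 16"
        using f(2) l(2) by linarith
      show ?case
      proof (cases "k < 0")
        case True
        then show ?thesis using s3 4(1) t3 by (simp add: array_of_single)
      next
        case False
        then show ?thesis using s3 4(1) t3 cmp
          by (cases "int ?l < k") (simp_all add: array_of_single)
      qed
    qed (use s2 v in simp_all)
    show ?case by (rule wp_Do_Seq[OF _ R]) simp
  qed (use con l a2 F in simp_all)
  show ?case by (rule wp_Do_Seq[OF _ wp_Do_Seq[OF _ wp_Do_Seq[OF _ R]]]) simp_all
qed simp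

theorem mainTheorem1:
  fixes p :: nat
  assumes "p \<ge> 2"
  shows
    "(\<exists>P (time :: nat \<Rightarrow> nat) (space :: nat \<Rightarrow> nat) (bound :: nat \<Rightarrow> nat).
        (\<lambda>n. real (time n)) \<in> O(\<lambda>n. real n) \<and>
        (\<lambda>n. real (space n)) \<in> O(\<lambda>n. real n * ln (real n)) \<and>
        (\<lambda>n. real (bound n)) \<in> O(\<lambda>n. real n) \<and>
        (\<forall>w. entries_bounded P [word_code w] (bound (length w)) \<and>
             space_within P [word_code w] (space (length w)) \<and>
             (\<exists>v. geodesic p v \<and> eq_BS p v w \<and>
                outputs_within P [word_code w] (word_code v) (time (length w))))) \<and>
     geodesic_problem_linear p \<and>
     geodesic_length_problem_linear p \<and>
     bounded_geodesic_length_problem_linear p"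
proof -
  define K W where "K = {0, 2, 3, 25, 27, 28, 29 :: nat}" and "W = {9, 30, 32 :: nat}"
  have KW: "K \<inter> W = {}" by (simp add: K_def W_def)
  define B where "B = int p + 4"
  have B: "0 \<le> B" "4 \<le> B" by (simp_all add: B_def)
  \<comment> \<open>Compared with \<open>main_time\<close> there are 100 more steps per unit of
    \<open>n + 1\<close>, room for deleting the word and reading the integer.\<close>
  define a where "a = 3050 * p + 9600"
  define time where "time n = a * n + a" for n
  \<comment> \<open>This is the bound \<open>2 * B * Suc (time n)\<close> of
    \<open>entries_boundedI\<close>, with \<open>B = p + 4\<close> and
    \<open>Suc (time n) \<le> (a + 1) * (n + 1)\<close>.\<close>
  define m where "m = 2 * (p + 4) * (a + 1)"
  have bound: "2 * B * int (Suc (time n)) \<le> int (m * (n + 1))" for n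
  proof -
    have "Suc (time n) \<le> (a + 1) * (n + 1)" by (simp add: time_def)
    then have "int (Suc (time n)) \<le> int ((a + 1) * (n + 1))" by (simp only: of_nat_le_iff)
    then have "2 * B * int (Suc (time n)) \<le> 2 * B * int ((a + 1) * (n + 1))"
      using B by (intro mult_left_mono) auto
    then show ?thesis by (simp add: m_def B_def algebra_simps)
  qed
  have mt: "main_time p n + 20 * n + 50 \<le> time n" for n
    by (simp add: main_time_def time_def a_def algebra_simps)
  have bigo: "(\<lambda>n. real (time n)) \<in> O(\<lambda>n. real n)" "(\<lambda>n. real (m * (n + 1))) \<in> O(\<lambda>n. real n)"
    using linear_in_bigo[of a a] linear_in_bigo[of m m] by (simp_all add: time_def algebra_simps)
  have sz: "input_size [word_code w] = length w" for w by (simp add: input_size_def word_code_def)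
  have wc: "\<forall>xs\<in>set [word_code w]. \<forall>x\<in>set xs. \<bar>x\<bar> \<le> B" for w
    using word_code_le[of _ w] B(2) by fastforce

  have t1: "ctame K W B (main_com p)" using ctame_main by (simp add: K_def W_def B_def)
  define P where "P = code 0 (main_com p)"
  have wp1: "wp (main_com p) (\<lambda>s'. (\<exists>out. (\<exists>v. geodesic p v \<and> eq_BS p v w \<and> out = word_code v) \<and>
      arr s' 0 = array_of out) \<and> pc s' \<le> time (length w)) (init [word_code w])" for w
    by (rule wp_mono[OF main_init_wp[OF assms, of "[]"]])
      (use mt[of "length w"] in \<open>auto simp: found_def out_ok_def\<close>)
  note solve1 = wp_solves[OF wp1 t1 KW B(1) wc bound, folded P_def]
  define space where "space n = (card (\<Union>i\<in>set P. instr_regs i) + 2 * (n + (a * n + a))) * (floorlog 2 (m * (n + 1)) + 1)" for n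
  have sp: "(\<lambda>n. real (space n)) \<in> O(\<lambda>n. real n * ln (real n))"
    unfolding space_def by (rule space_in_bigo) (simp add: m_def)
  have space1: "space_within P [word_code w] (space (length w))" for w
  proof -
    have "1 * (length w + 1) \<le> m * (length w + 1)" by (intro mult_right_mono) (simp_all add: m_def)
    then have "input_size [word_code w] \<le> m * (length w + 1)" by (simp add: sz)
    then show ?thesis using solve1(3)[of w] unfolding space_def sz time_def by blast
  qed
  have p1: "geodesic_problem_linear p"
    unfolding geodesic_problem_linear_def linear_time_solvable_def sz
    by (rule exI[of _ P], rule exI[of _ time], rule exI[of _ "\<lambda>n. m * (n + 1)"])
      (intro conjI allI bigo solve1(1,2)[unfolded sz])
  have p2: "geodesic_length_problem_linear p"
  proof -
    have t2: "ctame K W B (length_com p)"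
      using t1 by (simp add: length_com_def clear_loop_def) (simp add: K_def W_def)
    have wp2: "wp (length_com p) (\<lambda>s'. (\<exists>out. out = [int (geodesic_length p w)] \<and>
      arr s' 0 = array_of out) \<and> pc s' \<le> time (length w)) (init [word_code w])" for w
      by (rule wp_mono[OF length_com_wp[OF assms]]) (use mt[of "length w"] in auto)
    note solve2 = wp_solves[OF wp2 t2 KW B(1) wc bound]
    show ?thesis
      unfolding geodesic_length_problem_linear_def linear_time_solvable_def sz
      by (rule exI[of _ "code 0 (length_com p)"], rule exI[of _ time], rule exI[of _ "\<lambda>n. m * (n + 1)"])
        (intro conjI allI bigo solve2(1,2)[unfolded sz])
  qed
  have p3: "bounded_geodesic_length_problem_linear p"
  proof -
    have t3: "ctame K W B (bounded_com p)"
      using t1 by (simp add: bounded_com_def clear_loop_def read_loop_def read_body_def drain_pos_def)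
        (simp add: K_def W_def B_def)
    let ?size = "\<lambda>w k. input_size [word_code w, int_code k]"
    have wp3: "wp (bounded_com p) (\<lambda>s'. (\<exists>out. out = [of_bool (int (geodesic_length p w) < k)] \<and>
      arr s' 0 = array_of out) \<and> pc s' \<le> time (?size w k)) (init [word_code w, int_code k])" for w k
    proof (rule wp_mono[OF bounded_com_wp[OF assms HOL.refl]], goal_cases)
      case (1 s')
      have s: "?size w k = length w + floorlog 2 (nat \<bar>k\<bar>) + 1"
        by (simp add: input_size_def word_code_def int_code_def)
      have "main_time p (length w) \<le> main_time p (?size w k)"
        unfolding main_time_def s by (intro mult_left_mono) auto
      then have "pc s' \<le> time (?size w k)" using 1 mt[of "?size w k"] s by simp
      then show ?case using 1 by blast
    qed
    have ic: "\<forall>xs\<in>set [word_code w, int_code k]. \<forall>x\<in>set xs. \<bar>x\<bar> \<le> B" for w k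
    proof -
      have "\<bar>x\<bar> \<le> B" if "x \<in> set (int_code k)" for x
        using that B(2) by (auto simp: int_code_def)
      then show ?thesis using wc[of w] by auto
    qed
    note solve3 = wp_solves[OF wp3 t3 KW B(1) ic bound]
    show ?thesis
      unfolding bounded_geodesic_length_problem_linear_def linear_time_solvable_def
    proof (rule exI[of _ "code 0 (bounded_com p)"], rule exI[of _ time],
          rule exI[of _ "\<lambda>n. m * (n + 1)"], intro conjI allI bigo, goal_cases)
      case (1 x)
      show ?case using solve3(1)[of "fst x" "snd x"] by (simp add: case_prod_beta)
    next
      case (2 x)
      show ?case using solve3(2)[of "fst x" "snd x"] by (simp only: case_prod_beta)
    qed
  qed
  show ?thesis
  proof (rule conjI, rule exI[of _ P], rule exI[of _ time], rule exI[of _ space],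
      rule exI[of _ "\<lambda>n. m * (n + 1)"], intro conjI allI bigo sp, goal_cases)
    case (1 w)
    show ?case using solve1(1)[of w] by (simp only: sz)
  next
    case (2 w)
    show ?case by (rule space1)
  next
    case (3 w)
    show ?case using solve1(2)[of w] by auto
  qed (intro conjI p1 p2 p3)
qed

end
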